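(* Let $\mathcal{A}$ be an essential central arrangement of rank $\ell$ in $V$, $\dim V=m=\ell$. Suppose that $\mathcal{A}$ is tame, or, more generally, that the complex $$0\to\Omega^0_{S/C}(\mathcal{A})\xrightarrow{\ \omega_{\mathbf a}\wedge\ }\Omega^1_{S/C}(\mathcal{A})\xrightarrow{\ \omega_{\mathbf a}\wedge\ }\cdots\xrightarrow{\ \omega_{\mathbf a}\wedge\ }\Omega^\ell_{S/C}(\mathcal{A})\to S/I\to0$$ is exact. Then the formal power series $$\Psi_{\mathcal{A}}(s,t)=\sum_{p=0}^m h(D_p(\mathcal{A}),t)\,t^p\,(s(1-t)-1)^p$$ is a Laurent polynomial in $\mathbb{Z}[s,t,t^{-1}]$, and its specialization at $t=1$ is $\Psi_{\mathcal{A}}(s,1)=(-1)^m\chi(\mathcal{A},-s)$.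
   Context: Let $V$ be a complex vector space of dimension $m$ and $\mathcal{A}=\{H_1,\dots,H_n\}$ a central arrangement: a set of $n$ distinct linear hyperplanes $H_i=\ker f_i$, $f_i\in V^*$ nonzero; $f=f_1\cdots f_n$. Its rank is $\ell=\operatorname{codim}_V\bigcap_iH_i$; $\mathcal{A}$ is essential if $\bigcap_iH_i=\{0\}$. The characteristic polynomial is $\chi(\mathcal{A},t)=\sum_{X\in L(\mathcal{A})}\mu(V,X)t^{\ell-\operatorname{codim}X}$, where $L(\mathcal{A})$ is the lattice of intersections ordered by reverse inclusion and $\mu$ its Möbius function. Let $R=\mathbb{C}[V]$, with linear coordinates $x_1,\dots,x_m$. The module of logarithmic $p$-derivations is $$D_p(\mathcal{A})=\{\theta\in\textstyle\bigwedge^p\operatorname{Der}_{\mathbb{C}}(R):\theta(f,g_2,\dots,g_p)\in(f)\ \ \forall g_2,\dots,g_p\in R\},$$ with $D_0(\mathcal{A})=R$ and $D(\mathcal{A})=D_1(\mathcal{A})$, where elements of $\bigwedge^p\operatorname{Der}_{\mathbb{C}}(R)$ are viewed as $p$-linear skew-symmetric maps $R^p\to R$ that are derivations in each factor. It is graded so that each $\partial_{x_i}$ has degree $-1$ (the Euler derivation $\sum x_i\partial_{x_i}$ has degree $0$, and $\partial_{x_{i_1}}\wedge\dots\wedge\partial_{x_{i_p}}$ has degree $-p$); $h(-,t)$ denotes the Hilbert series with respect to this grading. The module of logarithmic $p$-forms $\Omega^p(\mathcal{A})$ consists of the rational $p$-forms $\omega$ with poles along $f=0$ such that both $f\omega$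 and $f\,d\omega$ are regular (polynomial) forms. $\mathcal{A}$ is tame if the projective dimension over $R$ satisfies $\operatorname{pd}_R\Omega^p(\mathcal{A})\le p$ for all $0\le p\le\ell$. Let $C=\mathbb{C}[a_1,\dots,a_n]$, $S=R\otimes_{\mathbb{C}}C$, $\omega_{\mathbf a}=\sum_i a_i\frac{df_i}{f_i}$, and $\Omega^p_{S/C}(\mathcal{A})=\Omega^p(\mathcal{A})\otimes_{\mathbb{C}}C$. The ideal $I=I(\mathcal{A})\subseteq S$ is generated by all contractions $\langle\theta,\omega_{\mathbf a}\rangle=\sum_ia_i\frac{\theta(f_i)}{f_i}$, $\theta\in D(\mathcal{A})$. The last map of the complex sends $g\,\frac{dx_1\wedge\dots\wedge dx_\ell}{f}$ to the class of $g\in S$ modulo $I$. *)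

theory Defs
  imports
    "HOL-Analysis.Analysis"
    "HOL-Library.Poly_Mapping"
    "HOL-Library.Function_Algebras"
    "HOL-Computational_Algebra.Fraction_Field"
    "HOL-Computational_Algebra.Formal_Laurent_Series"
begin

section \<open>The coordinate ring and its fraction field\<close>

text \<open>
  \<open>V = complex ^ 'm\<close> and \<open>R = \<complex>[V]\<close>. The index type is linearly ordered in order to have the basis
  \<open>dx\<^sub>I\<close> of the differential forms; the library also needs the order to show that \<open>R\<close> is a domain.
\<close>

type_synonym 'm cpoly = "('m \<Rightarrow>\<^sub>0 nat) \<Rightarrow>\<^sub>0 complex"

definition Const :: "complex \<Rightarrow> 'm cpoly" where
  "Const c = Poly_Mapping.single 0 c"

definition Var :: "'m \<Rightarrow> 'm cpoly" where
  "Var i = Poly_Mapping.single (Poly_Mapping.single i 1) 1"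

definition homogeneous :: "int \<Rightarrow> 'm::finite cpoly \<Rightarrow> bool" where
  "homogeneous d p \<longleftrightarrow>
     (\<forall>k\<in>Poly_Mapping.keys p. int (\<Sum>i\<in>UNIV. Poly_Mapping.lookup k i) = d)"

definition partial_deriv :: "'m \<Rightarrow> 'm cpoly \<Rightarrow> 'm cpoly" where
  "partial_deriv i p =
     (\<Sum>k\<in>Poly_Mapping.keys p. Poly_Mapping.single (k - Poly_Mapping.single i 1)
        (of_nat (Poly_Mapping.lookup k i) * Poly_Mapping.lookup p k))"

lemma partial_deriv_superset:
  assumes "finite F" "Poly_Mapping.keys p \<subseteq> F"
  shows "partial_deriv i p =
     (\<Sum>k\<in>F. Poly_Mapping.single (k - Poly_Mapping.single i 1)
        (of_nat (Poly_Mapping.lookup k i) * Poly_Mapping.lookup p k))"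
  unfolding partial_deriv_def using assms
  by (intro sum.mono_neutral_left) (auto simp: in_keys_iff)

lemma partial_deriv_add: "partial_deriv i (p + q) = partial_deriv i p + partial_deriv i q"
proof -
  let ?F = "Poly_Mapping.keys p \<union> Poly_Mapping.keys q"
  have "Poly_Mapping.keys (p + q) \<subseteq> ?F" by (rule Poly_Mapping.keys_add)
  then show ?thesis
    by (simp add: partial_deriv_superset[of ?F] lookup_add distrib_left single_add sum.distrib)
qed

lemma partial_deriv_zero: "partial_deriv i 0 = 0"
  by (simp add: partial_deriv_def)

lemma partial_deriv_sum: "partial_deriv i (sum g X) = (\<Sum>x\<in>X. partial_deriv i (g x))"
  by (induction X rule: infinite_finite_induct) (auto simp: partial_deriv_add partial_deriv_zero)

lemma partial_deriv_single:
  "partial_deriv i (Poly_Mapping.single k c) =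
     Poly_Mapping.single (k - Poly_Mapping.single i 1) (of_nat (Poly_Mapping.lookup k i) * c)"
  by (simp add: partial_deriv_superset[of "{k}"])

lemma exponent_diff_add:
  fixes k l :: "'m \<Rightarrow>\<^sub>0 nat"
  assumes "Poly_Mapping.lookup k i \<noteq> 0"
  shows "k + l - Poly_Mapping.single i 1 = (k - Poly_Mapping.single i 1) + l"
  using assms
  by (intro poly_mapping_eqI) (auto simp: lookup_add lookup_minus lookup_single when_def)

lemma partial_deriv_mult_single:
  "partial_deriv i (Poly_Mapping.single k c * Poly_Mapping.single l d) =
     partial_deriv i (Poly_Mapping.single k c) * Poly_Mapping.single l d
     + Poly_Mapping.single k c * partial_deriv i (Poly_Mapping.single l d)"
proof -
  let ?u = "Poly_Mapping.single i (1::nat)"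
  have 1: "Poly_Mapping.single (k + l - ?u) (of_nat (Poly_Mapping.lookup k i) * c * d) =
        Poly_Mapping.single ((k - ?u) + l) (of_nat (Poly_Mapping.lookup k i) * c * d)"
    using exponent_diff_add[of k i l]
    by (cases "Poly_Mapping.lookup k i = 0") simp_all
  have 2: "Poly_Mapping.single (k + l - ?u) (of_nat (Poly_Mapping.lookup l i) * c * d) =
        Poly_Mapping.single (k + (l - ?u)) (of_nat (Poly_Mapping.lookup l i) * c * d)"
    using exponent_diff_add[of l i k]
    by (cases "Poly_Mapping.lookup l i = 0") (simp_all add: add.commute)
  have "partial_deriv i (Poly_Mapping.single k c * Poly_Mapping.single l d) =
      Poly_Mapping.single (k + l - ?u) (of_nat (Poly_Mapping.lookup k i) * c * d)
      + Poly_Mapping.single (k + l - ?u) (of_nat (Poly_Mapping.lookup l i) * c * d)"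
    by (simp add: mult_single partial_deriv_single lookup_add algebra_simps flip: single_add)
  then show ?thesis
    unfolding 1 2 by (simp add: mult_single partial_deriv_single mult.assoc mult.left_commute)
qed

lemma cpoly_eq_sum_single:
  "p = (\<Sum>k\<in>Poly_Mapping.keys p. Poly_Mapping.single k (Poly_Mapping.lookup p k))"
proof (intro poly_mapping_eqI)
  fix j
  show "Poly_Mapping.lookup p j = Poly_Mapping.lookup
     (\<Sum>k\<in>Poly_Mapping.keys p. Poly_Mapping.single k (Poly_Mapping.lookup p k)) j"
    by (simp add: lookup_sum lookup_single when_def in_keys_iff)
qed

lemma partial_deriv_mult:
  "partial_deriv i (p * q) = partial_deriv i p * q + p * partial_deriv i q"
proof -
  define a where "a = (\<lambda>k. Poly_Mapping.single k (Poly_Mapping.lookup p k))"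
  define b where "b = (\<lambda>k. Poly_Mapping.single k (Poly_Mapping.lookup q k))"
  have p: "p = sum a (Poly_Mapping.keys p)" and q: "q = sum b (Poly_Mapping.keys q)"
    unfolding a_def b_def by (rule cpoly_eq_sum_single)+
  have "partial_deriv i (sum a X * sum b Y) =
      partial_deriv i (sum a X) * sum b Y + sum a X * partial_deriv i (sum b Y)" for X Y
    by (simp add: sum_product partial_deriv_sum a_def b_def partial_deriv_mult_single sum.distrib)
  with p q show ?thesis by metis
qed

definition to_frac :: "'m::{finite,linorder} cpoly \<Rightarrow> 'm cpoly fract" where
  "to_frac r = Fract r 1"

lift_definition frac_deriv ::
    "'m \<Rightarrow> 'm::{finite,linorder} cpoly fract \<Rightarrow> 'm cpoly fract"
  is "\<lambda>i q. (partial_deriv i (fst q) * snd q - fst q * partial_deriv i (snd q), snd q * snd q)"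
proof -
  fix i :: 'm and q r :: "'m cpoly \<times> 'm cpoly"
  assume *: "fractrel q r"
  obtain a b c d where qr: "q = (a, b)" "r = (c, d)" by (metis surj_pair)
  have nz: "b \<noteq> 0" "d \<noteq> 0" and e: "a * d = c * b" using * qr by auto
  have e': "partial_deriv i a * d + a * partial_deriv i d
      = partial_deriv i c * b + c * partial_deriv i b"
    using e by (metis partial_deriv_mult)
  have "(partial_deriv i a * b - a * partial_deriv i b) * (d * d)
      = (partial_deriv i c * d - c * partial_deriv i d) * (b * b)"
    using e e' by algebra
  then show "fractrel
      (partial_deriv i (fst q) * snd q - fst q * partial_deriv i (snd q), snd q * snd q)
      (partial_deriv i (fst r) * snd r - fst r * partial_deriv i (snd r), snd r * snd r)"
    using nz qr by simp
qed


section \<open>Hyperplane arrangements\<close>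

text \<open>
  An arrangement is given by the coefficient vectors \<open>A i\<close> of the linear forms \<open>f\<^sub>i\<close>,
  \<open>i :: 'n\<close>.
\<close>

definition hyperplane :: "('n \<Rightarrow> complex ^ 'm::finite) \<Rightarrow> 'n \<Rightarrow> (complex ^ 'm) set" where
  "hyperplane A i = {v. (\<Sum>j\<in>UNIV. A i $ j * v $ j) = 0}"

definition central_arrangement :: "('n \<Rightarrow> complex ^ 'm::finite) \<Rightarrow> bool" where
  "central_arrangement A \<longleftrightarrow> (\<forall>i. A i \<noteq> 0) \<and> inj (hyperplane A)"

definition essential :: "('n \<Rightarrow> complex ^ 'm::finite) \<Rightarrow> bool" where
  "essential A \<longleftrightarrow> (\<Inter>i. hyperplane A i) = {0}"

definition codim :: "(complex ^ 'm::finite) set \<Rightarrow> nat" where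
  "codim X = CARD('m) - vec.dim X"

definition arr_rank :: "('n \<Rightarrow> complex ^ 'm::finite) \<Rightarrow> nat" where
  "arr_rank A = codim (\<Inter>i. hyperplane A i)"

definition intersection_lattice :: "('n \<Rightarrow> complex ^ 'm::finite) \<Rightarrow> (complex ^ 'm) set set" where
  "intersection_lattice A = {\<Inter>i\<in>J. hyperplane A i | J. True}"

text \<open>The Moebius function \<open>\<mu>(U, X)\<close> of a finite family \<open>L\<close> of sets ordered by reverse inclusion.\<close>

function moebius :: "'a set set \<Rightarrow> 'a set \<Rightarrow> 'a set \<Rightarrow> int" where
  "moebius L U X =
     (if X = U then 1
      else if finite L \<and> X \<subset> U then - (\<Sum>Y\<in>{Y\<in>L. X \<subset> Y \<and> Y \<subseteq> U}. moebius L U Y)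
      else 0)"
  by auto
termination
proof (relation "Wellfounded.measure (\<lambda>(L, U, X). card {Y\<in>L. X \<subset> Y})", goal_cases)
  case (2 L U X Y)
  then have "{Z\<in>L. Y \<subset> Z} \<subset> {Z\<in>L. X \<subset> Z}" by auto
  with 2 show ?case by (auto intro!: psubset_card_mono)
qed auto

declare moebius.simps [simp del]

definition char_poly :: "('n \<Rightarrow> complex ^ 'm::finite) \<Rightarrow> int poly" where
  "char_poly A = (\<Sum>X\<in>intersection_lattice A.
     monom (moebius (intersection_lattice A) UNIV X) (arr_rank A - codim X))"

definition linear_form :: "('n \<Rightarrow> complex ^ 'm::finite) \<Rightarrow> 'n \<Rightarrow> 'm cpoly" where
  "linear_form A i = (\<Sum>j\<in>UNIV. Const (A i $ j) * Var j)"

definition defining_poly :: "('n::finite \<Rightarrow> complex ^ 'm::finite) \<Rightarrow> 'm cpoly" where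
  "defining_poly A = (\<Prod>i\<in>UNIV. linear_form A i)"


section \<open>Logarithmic multiderivations\<close>

definition derivation :: "('m cpoly \<Rightarrow> 'm cpoly) \<Rightarrow> bool" where
  "derivation D \<longleftrightarrow>
     (\<forall>g h. D (g + h) = D g + D h) \<and>
     (\<forall>c g. D (Const c * g) = Const c * D g) \<and>
     (\<forall>g h. D (g * h) = D g * h + g * D h)"

text \<open>
  Elements of \<open>\<And>\<^sup>p Der(R)\<close> as maps on \<open>R\<^sup>p\<close>. The elements of \<open>R\<^sup>p\<close> are the lists of length \<open>p\<close>,
  and the maps are extended by \<open>0\<close> to the other lists; for \<open>p = 0\<close> this gives \<open>R\<close>.
\<close>

definition multiderivation :: "nat \<Rightarrow> ('m cpoly list \<Rightarrow> 'm cpoly) \<Rightarrow> bool" where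
  "multiderivation p \<theta> \<longleftrightarrow>
     (\<forall>gs. length gs \<noteq> p \<longrightarrow> \<theta> gs = 0) \<and>
     (\<forall>gs i. length gs = p \<longrightarrow> i < p \<longrightarrow> derivation (\<lambda>g. \<theta> (gs[i := g]))) \<and>
     (\<forall>gs i j. length gs = p \<longrightarrow> i < j \<longrightarrow> j < p \<longrightarrow>
        \<theta> (gs[i := gs ! j, j := gs ! i]) = - \<theta> gs)"

text \<open>For \<open>p = 0\<close> the divisibility condition is void, so that \<open>D\<^sub>0(A) = R\<close>.\<close>

definition log_derivations ::
    "('n::finite \<Rightarrow> complex ^ 'm::finite) \<Rightarrow> nat \<Rightarrow> ('m cpoly list \<Rightarrow> 'm cpoly) set" where
  "log_derivations A p = {\<theta>. multiderivation p \<theta> \<and>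
     (\<forall>gs. Suc (length gs) = p \<longrightarrow> defining_poly A dvd \<theta> (defining_poly A # gs))}"

text \<open>
  The coefficient of \<open>\<theta>\<close> at \<open>\<partial>\<^sub>i\<^sub>1 \<and> \<dots> \<and> \<partial>\<^sub>i\<^sub>p\<close>, which is a multivector of degree \<open>-p\<close>,
  is \<open>\<theta>(x\<^sub>i\<^sub>1, \<dots>, x\<^sub>i\<^sub>p)\<close>.
\<close>

definition homogeneous_multiderivation ::
    "nat \<Rightarrow> int \<Rightarrow> ('m::finite cpoly list \<Rightarrow> 'm cpoly) \<Rightarrow> bool" where
  "homogeneous_multiderivation p d \<theta> \<longleftrightarrow>
     (\<forall>is. length is = p \<longrightarrow> homogeneous (d + int p) (\<theta> (map Var is)))"

definition multider_scale ::
    "complex \<Rightarrow> ('m cpoly list \<Rightarrow> 'm cpoly) \<Rightarrow> 'm cpoly list \<Rightarrow> 'm cpoly" where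
  "multider_scale c \<theta> = (\<lambda>gs. Const c * \<theta> gs)"

lemma vector_space_multider_scale: "vector_space multider_scale"
proof
  fix a b :: complex and x y :: "'a cpoly list \<Rightarrow> 'a cpoly"
  have add: "Const (a + b) = (Const a + Const b :: 'a cpoly)"
    and mult: "Const (a * b) = (Const a * Const b :: 'a cpoly)"
    and one: "Const 1 = (1 :: 'a cpoly)"
    by (simp_all add: Const_def single_add mult_single)
  show "multider_scale a (x + y) = multider_scale a x + multider_scale a y"
    "multider_scale (a + b) x = multider_scale a x + multider_scale b x"
    "multider_scale a (multider_scale b x) = multider_scale (a * b) x"
    "multider_scale 1 x = x"
    by (simp_all add: multider_scale_def fun_eq_iff add mult one algebra_simps)
qed

text \<open>
  \<open>h(D\<^sub>p(A), t)\<close>, with coefficients viewed in \<open>\<int>[s]\<close>. There is no component of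
  degree below \<open>-p\<close>, so this is a Laurent series.
\<close>

definition hilbert_series_D ::
    "('n::finite \<Rightarrow> complex ^ 'm::finite) \<Rightarrow> nat \<Rightarrow> int poly fls" where
  "hilbert_series_D A p = Abs_fls (\<lambda>d. of_nat (vector_space.dim multider_scale
     {\<theta> \<in> log_derivations A p. homogeneous_multiderivation p d \<theta>}))"

text \<open>Here \<open>t\<close> is \<open>fls_X\<close> and \<open>s\<close> is the constant series \<open>fls_const [:0, 1:]\<close>.\<close>

definition Psi :: "('n::finite \<Rightarrow> complex ^ 'm::finite) \<Rightarrow> int poly fls" where
  "Psi A = (\<Sum>p = 0..CARD('m).
     hilbert_series_D A p * fls_X ^ p * (fls_const [:0, 1:] * (1 - fls_X) - 1) ^ p)"

definition is_laurent_polynomial :: "'a::zero fls \<Rightarrow> bool" where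
  "is_laurent_polynomial F \<longleftrightarrow> finite {k. fls_nth F k \<noteq> 0}"

text \<open>The value at \<open>t = 1\<close> of a Laurent polynomial in \<open>t\<close>.\<close>

definition laurent_at_one :: "'a::comm_monoid_add fls \<Rightarrow> 'a" where
  "laurent_at_one F = (\<Sum>k\<in>{k. fls_nth F k \<noteq> 0}. fls_nth F k)"


section \<open>Logarithmic forms\<close>

text \<open>The component of a rational form at \<open>I\<close> is its coefficient at \<open>dx\<^sub>I\<close>, \<open>I\<close> in increasing order.\<close>

type_synonym 'm ratform = "('m cpoly fract, 'm set) vec"

text \<open>For disjoint \<open>I\<close>, \<open>J\<close> one has \<open>dx\<^sub>I \<and> dx\<^sub>J = wedge_sign I J dx\<^bsub>I \<union> J\<^esub>\<close>.\<close>

definition wedge_sign :: "'m::linorder set \<Rightarrow> 'm set \<Rightarrow> 'a::comm_ring_1" where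
  "wedge_sign I J = (-1) ^ card {(i, j). i \<in> I \<and> j \<in> J \<and> j < i}"

definition wedge ::
    "'m::{finite,linorder} ratform \<Rightarrow> 'm ratform \<Rightarrow> 'm ratform" where
  "wedge \<eta> \<omega> = (\<chi> K. \<Sum>I\<in>Pow K. wedge_sign I (K - I) * (\<eta> $ I) * (\<omega> $ (K - I)))"

definition ext_deriv :: "'m::{finite,linorder} ratform \<Rightarrow> 'm ratform" where
  "ext_deriv \<omega> = (\<chi> K. \<Sum>i\<in>K. wedge_sign {i} (K - {i}) * frac_deriv i (\<omega> $ (K - {i})))"

definition is_form_of_degree :: "nat \<Rightarrow> 'm::{finite,linorder} ratform \<Rightarrow> bool" where
  "is_form_of_degree p \<omega> \<longleftrightarrow> (\<forall>I. \<omega> $ I \<noteq> 0 \<longrightarrow> card I = p)"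

definition regular_form :: "'m::{finite,linorder} ratform \<Rightarrow> bool" where
  "regular_form \<omega> \<longleftrightarrow> (\<forall>I. \<omega> $ I \<in> range to_frac)"

definition log_forms ::
    "('n::finite \<Rightarrow> complex ^ 'm::{finite,linorder}) \<Rightarrow> nat \<Rightarrow> 'm ratform set" where
  "log_forms A p = {\<omega>. is_form_of_degree p \<omega> \<and>
     regular_form (to_frac (defining_poly A) *s \<omega>) \<and>
     regular_form (to_frac (defining_poly A) *s ext_deriv \<omega>)}"

definition form_scale :: "'m::{finite,linorder} cpoly \<Rightarrow> 'm ratform \<Rightarrow> 'm ratform" where
  "form_scale r \<omega> = to_frac r *s \<omega>"


section \<open>Projective dimension and tame arrangements\<close>

text \<open>
  Modules are submodules of an ambient additive group \<open>'b\<close> with a scalar multiplication;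
  \<open>'x \<Rightarrow>\<^sub>0 'r\<close> with \<open>free_scale\<close> is the free module on the type \<open>'x\<close>.
\<close>

definition free_scale :: "'r::comm_ring_1 \<Rightarrow> ('x \<Rightarrow>\<^sub>0 'r) \<Rightarrow> ('x \<Rightarrow>\<^sub>0 'r)" where
  "free_scale r = Poly_Mapping.map (\<lambda>c. r * c)"

definition linear_map_on ::
    "('r \<Rightarrow> 'b \<Rightarrow> 'b::ab_group_add) \<Rightarrow> ('r \<Rightarrow> 'c \<Rightarrow> 'c::ab_group_add) \<Rightarrow> 'b set \<Rightarrow> ('b \<Rightarrow> 'c) \<Rightarrow> bool" where
  "linear_map_on s1 s2 M g \<longleftrightarrow>
     (\<forall>x\<in>M. \<forall>y\<in>M. g (x + y) = g x + g y) \<and> (\<forall>r. \<forall>x\<in>M. g (s1 r x) = s2 r (g x))"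

text \<open>
  Projective modules are the direct summands of free modules. A module \<open>P \<subseteq> 'b\<close> is the image
  of the free module on \<open>'b\<close>, so it suffices to consider that free module.
\<close>

definition projective_module ::
    "('r::comm_ring_1 \<Rightarrow> 'b \<Rightarrow> 'b::ab_group_add) \<Rightarrow> 'b set \<Rightarrow> bool" where
  "projective_module scl P \<longleftrightarrow> module.subspace scl P \<and>
     (\<exists>(\<iota> :: 'b \<Rightarrow> ('b \<Rightarrow>\<^sub>0 'r)) \<pi>.
        linear_map_on scl free_scale P \<iota> \<and>
        linear_map_on free_scale scl UNIV \<pi> \<and> range \<pi> = P \<and>
        (\<forall>x\<in>P. \<pi> (\<iota> x) = x))"

text \<open>
  The existence of a projective resolution \<open>0 \<rightarrow> P\<^sub>n \<rightarrow> \<dots> \<rightarrow> P\<^sub>0 \<rightarrow> M \<rightarrow> 0\<close>. HOL cannot quantify over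
  all modules; the \<open>P\<^sub>i\<close> range over the submodules of the free module on \<open>'b\<close>. This is no
  restriction when \<open>'b\<close> is infinite and at least as large as the ring: a module \<open>M \<subseteq> 'b\<close> then
  has a free resolution by modules with at most as many elements as \<open>'b\<close>, and the syzygy at which
  it is truncated is a submodule of such a free module.
\<close>

definition proj_dim_le ::
    "('r::comm_ring_1 \<Rightarrow> 'b \<Rightarrow> 'b::ab_group_add) \<Rightarrow> 'b set \<Rightarrow> nat \<Rightarrow> bool" where
  "proj_dim_le scl M n \<longleftrightarrow>
     (\<exists>(P :: nat \<Rightarrow> ('b \<Rightarrow>\<^sub>0 'r) set) \<epsilon> d.
        (\<forall>i. projective_module free_scale (P i)) \<and> (\<forall>i>n. P i = {0}) \<and>
        linear_map_on free_scale scl (P 0) \<epsilon> \<and> \<epsilon> ` P 0 = M \<and>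
        (\<forall>i. linear_map_on free_scale free_scale (P (Suc i)) (d i)) \<and>
        d 0 ` P 1 = {x \<in> P 0. \<epsilon> x = 0} \<and>
        (\<forall>i. d (Suc i) ` P (Suc (Suc i)) = {x \<in> P (Suc i). d i x = 0}))"

definition tame :: "('n::finite \<Rightarrow> complex ^ 'm::{finite,linorder}) \<Rightarrow> bool" where
  "tame A \<longleftrightarrow> (\<forall>p\<le>arr_rank A. proj_dim_le form_scale (log_forms A p) p)"


section \<open>The complex of relative logarithmic forms\<close>

text \<open>
  For a complex vector space \<open>M\<close>, the tensor product \<open>M \<otimes> \<complex>[a\<^sub>i | i :: 'n]\<close> consists of the
  polynomials in the \<open>a\<^sub>i\<close> with coefficients in \<open>M\<close>. In particular \<open>S = R[a\<^sub>i | i :: 'n]\<close>.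
\<close>

type_synonym ('n, 'm) param_poly = "('n \<Rightarrow>\<^sub>0 nat) \<Rightarrow>\<^sub>0 'm cpoly"

type_synonym ('n, 'm) param_form = "('n \<Rightarrow>\<^sub>0 nat) \<Rightarrow>\<^sub>0 'm ratform"

definition relative_log_forms ::
    "('n::finite \<Rightarrow> complex ^ 'm::{finite,linorder}) \<Rightarrow> nat \<Rightarrow> ('n, 'm) param_form set" where
  "relative_log_forms A p = {w. \<forall>k. Poly_Mapping.lookup w k \<in> log_forms A p}"

definition dlog_form ::
    "('n::finite \<Rightarrow> complex ^ 'm::{finite,linorder}) \<Rightarrow> 'n \<Rightarrow> 'm ratform" where
  "dlog_form A i =
     inverse (to_frac (linear_form A i)) *s ext_deriv (axis {} (to_frac (linear_form A i)))"

text \<open>The map \<open>w \<mapsto> \<omega>\<^sub>a \<and> w\<close>, where \<open>\<omega>\<^sub>a = \<Sum>\<^sub>i a\<^sub>i df\<^sub>i / f\<^sub>i\<close>.\<close>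

definition omega_wedge ::
    "('n::finite \<Rightarrow> complex ^ 'm::{finite,linorder}) \<Rightarrow> ('n, 'm) param_form \<Rightarrow> ('n, 'm) param_form" where
  "omega_wedge A w = (\<Sum>k\<in>Poly_Mapping.keys w. \<Sum>i\<in>UNIV.
     Poly_Mapping.single (k + Poly_Mapping.single i 1)
       (wedge (dlog_form A i) (Poly_Mapping.lookup w k)))"

text \<open>The contraction \<open>\<Sum>\<^sub>i a\<^sub>i \<theta>(f\<^sub>i) / f\<^sub>i\<close>, a priori a polynomial over the fraction field of \<open>R\<close>.\<close>

definition contraction ::
    "('n::finite \<Rightarrow> complex ^ 'm::{finite,linorder}) \<Rightarrow> ('m cpoly list \<Rightarrow> 'm cpoly) \<Rightarrow>
       ('n \<Rightarrow>\<^sub>0 nat) \<Rightarrow>\<^sub>0 'm cpoly fract" where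
  "contraction A \<theta> = (\<Sum>i\<in>UNIV. Poly_Mapping.single (Poly_Mapping.single i 1)
     (to_frac (\<theta> [linear_form A i]) / to_frac (linear_form A i)))"

definition meromorphic_ideal ::
    "('n::finite \<Rightarrow> complex ^ 'm::{finite,linorder}) \<Rightarrow> ('n, 'm) param_poly set" where
  "meromorphic_ideal A = module.span (*)
     {\<sigma>. \<exists>\<theta>\<in>log_derivations A 1. Poly_Mapping.map to_frac \<sigma> = contraction A \<theta>}"

definition coset :: "'a::ab_group_add set \<Rightarrow> 'a \<Rightarrow> 'a set" where
  "coset I g = {h. h - g \<in> I}"

text \<open>The form \<open>g dx\<^sub>1 \<and> \<dots> \<and> dx\<^sub>m / f\<close>.\<close>

definition top_form ::
    "('n::finite \<Rightarrow> complex ^ 'm::{finite,linorder}) \<Rightarrow> ('n, 'm) param_poly \<Rightarrow> ('n, 'm) param_form" where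
  "top_form A g = Poly_Mapping.map (\<lambda>r. axis UNIV (to_frac r / to_frac (defining_poly A))) g"

definition residue_class ::
    "('n::finite \<Rightarrow> complex ^ 'm::{finite,linorder}) \<Rightarrow> ('n, 'm) param_form \<Rightarrow> ('n, 'm) param_poly set" where
  "residue_class A w = coset (meromorphic_ideal A) (THE g. w = top_form A g)"

text \<open>
  Exactness of \<open>0 \<rightarrow> \<Omega>\<^sup>0 \<rightarrow> \<Omega>\<^sup>1 \<rightarrow> \<dots> \<rightarrow> \<Omega>\<^sup>m \<rightarrow> S/I \<rightarrow> 0\<close>, where \<open>m = CARD('m)\<close> is the rank
  of the arrangement, which is assumed to be essential; the zero of \<open>S/I\<close> is the coset \<open>I\<close>.
\<close>

definition log_complex_exact ::
    "('n::finite \<Rightarrow> complex ^ 'm::{finite,linorder}) \<Rightarrow> bool" where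
  "log_complex_exact A \<longleftrightarrow>
     {w \<in> relative_log_forms A 0. omega_wedge A w = 0} = {0} \<and>
     (\<forall>p. Suc p < CARD('m) \<longrightarrow>
        omega_wedge A ` relative_log_forms A p =
          {w \<in> relative_log_forms A (Suc p). omega_wedge A w = 0}) \<and>
     omega_wedge A ` relative_log_forms A (CARD('m) - 1) =
       {w \<in> relative_log_forms A CARD('m). residue_class A w = meromorphic_ideal A} \<and>
     residue_class A ` relative_log_forms A CARD('m) = range (coset (meromorphic_ideal A))"

end

theory Submission
  imports Defs
begin

text \<open>
  This is the formula of Solomon and Terao. For a set \<open>J\<close> of hyperplanes let \<open>P\<^sub>p(J)\<close> be the Hilbert
  series of \<open>D\<^sub>p(J)\<close>, graded by the degree of the coefficients, let \<open>d\<close> be the dimension of the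
  intersection \<open>Y\<close> of \<open>J\<close>, and let \<open>\<Psi>\<^sub>J\<close> be the series \<open>\<Psi>\<close> of \<open>J\<close>. One shows by induction on \<open>J\<close>
  that \<open>\<Psi>\<^sub>J\<close> is a polynomial and that its value at \<open>t = 1\<close> is
  \<open>(-1)\<^sup>m \<Sum>\<^sub>I (-1)\<^bsup>|I|\<^esup> (-s)\<^bsup>dim I\<^esup>\<close>, where \<open>I\<close> ranges over the subsets of \<open>J\<close>; by Whitney's theorem
  this is the characteristic polynomial. The inductive step rests on three facts.

  Contraction with linear forms dual to a basis of \<open>Y\<close> splits off \<open>d\<close> constant vector fields, so
  that \<open>\<Psi>\<^sub>I\<close> for \<open>I \<subseteq> J\<close> is \<open>(s (1 - t))\<^sup>d\<close> times the series formed with the submodule \<open>K\<^sub>p(I)\<close> of the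
  multiderivations which vanish on these forms.

  Since \<open>f\<^sub>i K\<^sub>p(I) \<subseteq> K\<^sub>p(I \<union> {i}) \<subseteq> K\<^sub>p(I)\<close>, the alternating sum of the Hilbert series of \<open>K\<^sub>p(I)\<close> over
  all \<open>I \<subseteq> J\<close> is a combination of Hilbert series of finitely generated modules annihilated by all
  \<open>f\<^sub>i\<close>, \<open>i \<in> J\<close>, and so has a pole of order at most \<open>d\<close> at \<open>1\<close>. Hence the alternating sum of the \<open>\<Psi>\<^sub>I\<close>
  is a polynomial with value \<open>c s\<^sup>d\<close> at \<open>t = 1\<close>, and \<open>\<Psi>\<^sub>J\<close> is determined up to the constant \<open>c\<close>.

  If \<open>J\<close> is not empty, the exterior product with the Euler derivation and the contraction with
  \<open>df\<^sub>i / f\<^sub>i\<close> show that \<open>\<Sum>\<^sub>p (-1/t)\<^sup>p P\<^sub>p(J) = 0\<close>, that is, that \<open>\<Psi>\<^sub>J\<close> vanishes for \<open>s = -1/t\<close>. At \<open>t = 1\<close>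
  this determines \<open>c\<close>.
\<close>


section \<open>Dimension counts inside an infinite-dimensional space\<close>

section \<open>Finite-dimensional subspaces\<close>

text \<open>The alternating sum over subsets takes the place of localization at the flat
  \<open>Y\<close>: the bound \<open>d\<close> on the pole holds for the combination, not for the
  single series. It holds because the forms of \<open>J\<close> and \<open>d\<close> further forms
  span the dual space, so that a finitely generated graded module annihilated by the former is
  finite over a polynomial ring in \<open>d\<close> variables.

  Put \<open>z = s (1 - t)\<close>. Splitting off one constant field replaces a sequence of series
  \<open>K_p\<close> by \<open>K_p + K_(p-1)\<close>, which multiplies the sum of the
  \<open>K_p (z - 1)^p\<close> by \<open>1 + (z - 1) = z\<close>. The resulting factor
  \<open>(1 - t)^d\<close> just cancels the pole in the coefficient of \<open>s^d\<close>, and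
  leaves a zero at \<open>t = 1\<close> in all higher coefficients; lower ones are absent. This is
  why a single constant stays open. The fields chosen for \<open>J\<close> serve every
  \<open>I \<subseteq> J\<close>, since \<open>Y\<close> lies in the intersection of
  \<open>I\<close>.

  Whitney's sum obeys the same recursion: by inclusion-exclusion its alternating sum over the
  subsets of \<open>J\<close> is the one term belonging to \<open>J\<close>. For nonempty
  \<open>J\<close> it also vanishes at \<open>s = -1\<close>, which is what \<open>s = -1/t\<close>
  becomes at \<open>t = 1\<close>.\<close>

locale graded_space = vector_space scale for scale :: "'a::field \<Rightarrow> 'b::ab_group_add \<Rightarrow> 'b"
begin

abbreviation lin :: "('b \<Rightarrow> 'b) \<Rightarrow> bool" where
  "lin \<equiv> Vector_Spaces.linear scale scale"

text \<open>The ambient space of functions is infinite-dimensional, and \<open>dim\<close> of an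
  infinite-dimensional subspace is 0. Every dimension count therefore carries this
  condition.\<close>

definition fin_dim :: "'b set \<Rightarrow> bool" where
  "fin_dim S \<longleftrightarrow> (\<exists>C. finite C \<and> S \<subseteq> span C)"

definition subspace_sum :: "'b set \<Rightarrow> 'b set \<Rightarrow> 'b set" where
  "subspace_sum S T = {x + y |x y. x \<in> S \<and> y \<in> T}"

lemma subspace_subspace_sum: "subspace S \<Longrightarrow> subspace T \<Longrightarrow> subspace (subspace_sum S T)"
  unfolding subspace_sum_def by (rule subspace_sums)

lemma subspace_sumI: "x \<in> S \<Longrightarrow> y \<in> T \<Longrightarrow> x + y \<in> subspace_sum S T"
  by (auto simp: subspace_sum_def)

lemma subspace_sum_left: "x \<in> S \<Longrightarrow> subspace T \<Longrightarrow> x \<in> subspace_sum S T"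
  using subspace_sumI[of x S 0 T] subspace_0[of T] by simp

lemma subspace_sum_right: "x \<in> T \<Longrightarrow> subspace S \<Longrightarrow> x \<in> subspace_sum S T"
  using subspace_sumI[of 0 S x T] subspace_0[of S] by simp

lemma subspace_sum_minimal:
  "S \<subseteq> U \<Longrightarrow> T \<subseteq> U \<Longrightarrow> subspace U \<Longrightarrow> subspace_sum S T \<subseteq> U"
  by (auto simp: subspace_sum_def intro!: subspace_add)

lemma fin_dim_subset: "fin_dim T \<Longrightarrow> S \<subseteq> T \<Longrightarrow> fin_dim S"
  unfolding fin_dim_def by blast

lemma lin_image_span: "lin T \<Longrightarrow> T ` span C = span (T ` C)"
  by (metis module_hom.span_image module_hom_iff_linear)

lemma fin_dim_image: "lin T \<Longrightarrow> fin_dim S \<Longrightarrow> fin_dim (T ` S)"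
  unfolding fin_dim_def by (metis finite_imageI image_mono lin_image_span)

lemma subspace_lin_image: "lin T \<Longrightarrow> subspace S \<Longrightarrow> subspace (T ` S)"
  by (metis module_hom.subspace_image module_hom_iff_linear)

lemma lin_add: "lin T \<Longrightarrow> T (x + y) = T x + T y"
  by (simp add: Vector_Spaces.linear_iff)

lemma lin_zero: "lin T \<Longrightarrow> T 0 = 0"
  by (metis lin_add add_cancel_right_right)

lemma lin_neg: "lin T \<Longrightarrow> T (- x) = - T x"
  by (metis lin_add lin_zero add.right_inverse add_eq_0_iff)

lemma lin_diff: "lin T \<Longrightarrow> T (x - y) = T x - T y"
  by (metis lin_add lin_neg diff_conv_add_uminus)

lemma subspace_lin_vimage: "lin T \<Longrightarrow> subspace S \<Longrightarrow> subspace {x. T x \<in> S}"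
  by (metis module_hom.subspace_linear_preimage module_hom_iff_linear)

lemma subspace_lin_vimage': "lin T \<Longrightarrow> subspace S \<Longrightarrow> subspace U \<Longrightarrow> subspace {x\<in>U. T x \<in> S}"
  using subspace_inter[of U, OF _ subspace_lin_vimage[of T S]]
  by (simp add: Int_def)

lemma subspace_lin_kernel: "lin T \<Longrightarrow> subspace U \<Longrightarrow> subspace {x\<in>U. T x = 0}"
  using subspace_lin_vimage'[of T "{0}" U] by simp

lemma lin_funpow: "lin T \<Longrightarrow> lin (T ^^ j)"
proof (induction j)
  case 0
  then show ?case by (simp add: Vector_Spaces.linear_iff)
next
  case (Suc j)
  then show ?case by (simp add: Vector_Spaces.linear_iff)
qed

lemma finite_independent_subset:
  assumes "fin_dim S" "independent B" "B \<subseteq> S"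
  shows "finite B"
proof -
  obtain C where "finite C" "S \<subseteq> span C" using assms(1) unfolding fin_dim_def by blast
  then show ?thesis using independent_span_bound[of C B] assms by blast
qed

text \<open>A basis \<open>B\<close> of the kernel extends to a basis \<open>C\<close> of
  \<open>S\<close>. The images of \<open>C - B\<close> form a basis of the image, because
  \<open>T\<close> is injective on the span of \<open>C - B\<close>.\<close>

lemma rank_nullity:
  assumes T: "lin T" and S: "subspace S" "fin_dim S"
  shows "dim S = dim {x\<in>S. T x = 0} + dim (T ` S)"
proof -
  let ?K = "{x\<in>S. T x = 0}"
  have K: "subspace ?K" using subspace_lin_kernel[OF T S(1)] .
  obtain B where B: "B \<subseteq> ?K" "independent B" "?K \<subseteq> span B"
    using maximal_independent_subset[of ?K] by blast
  obtain C where C: "B \<subseteq> C" "C \<subseteq> S" "independent C" "S \<subseteq> span C"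
    using maximal_independent_subset_extend[of B S] B by auto
  have fC: "finite C" using finite_independent_subset[OF S(2) C(3,2)] .
  then have fB: "finite B" using C(1) finite_subset by blast
  let ?D = "C - B"
  \<comment> \<open>The coordinates of \<open>x\<close> with respect to \<open>C\<close> are
    supported both in \<open>C - B\<close> and in \<open>B\<close>, hence nowhere.\<close>
  have span_D: "x \<in> span ?D \<Longrightarrow> x \<in> ?K \<Longrightarrow> x = 0" for x
  proof -
    assume x: "x \<in> span ?D" "x \<in> ?K"
    have "representation C x = representation ?D x"
      using C(3) x(1) by (intro representation_extend) auto
    moreover have "representation C x = representation B x"
      using C(3,1) x(2) B(3) by (intro representation_extend) auto
    ultimately have *: "representation ?D x = representation B x" by simp
    have "representation C x b = 0" for b
    proof (cases "b \<in> B")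
      case True
      then show ?thesis
        using representation_ne_zero[of ?D x b] \<open>representation C x = representation ?D x\<close> by auto
    next
      case False
      then show ?thesis
        using representation_ne_zero[of B x b] \<open>representation C x = representation B x\<close> by auto
    qed
    moreover have "(\<Sum>b\<in>C. scale (representation C x b) b) = x"
      using sum_representation_eq[OF C(3) _ fC subset_refl] x(2) C(4) by auto
    ultimately show "x = 0" by (metis (no_types, lifting) scale_zero_left sum.neutral)
  qed
  have inj: "inj_on T (span ?D)"
  proof (rule inj_onI)
    fix x y assume xy: "x \<in> span ?D" "y \<in> span ?D" "T x = T y"
    have "x - y \<in> span ?D" using xy by (intro span_diff)
    moreover have "span ?D \<subseteq> S" using C(2) S(1) by (intro span_minimal) auto
    ultimately have "x - y = 0"
      using span_D[of "x - y"] xy lin_diff[OF T] by auto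
    then show "x = y" by simp
  qed
  have TI: "independent (T ` ?D)"
    using T inj independent_mono[OF C(3), of ?D]
    by (metis Diff_subset module_hom.independent_injective_image module_hom_iff_linear)
  have "T ` S \<subseteq> span (T ` ?D)"
  proof -
    have "span C \<subseteq> {x. T x \<in> span (T ` ?D)}"
    proof (rule span_minimal)
      show "C \<subseteq> {x. T x \<in> span (T ` ?D)}"
      proof
        fix x assume "x \<in> C"
        then show "x \<in> {x. T x \<in> span (T ` ?D)}"
          using B(1) span_zero by (cases "x \<in> B") (auto intro: span_base)
      qed
      show "subspace {x. T x \<in> span (T ` ?D)}" using T by (intro subspace_lin_vimage) auto
    qed
    then show ?thesis using C(4) by blast
  qed
  then have "dim (T ` S) = card (T ` ?D)"
    using TI C(2) by (intro dim_unique) auto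
  also have "\<dots> = card ?D"
    using inj by (intro card_image) (meson inj_on_subset span_superset)
  finally have "dim (T ` S) = card C - card B" using card_Diff_subset[OF fB C(1)] by simp
  moreover have "dim S = card C" using C by (intro dim_unique) auto
  moreover have "dim ?K = card B" using B by (intro dim_unique) auto
  ultimately show ?thesis using card_mono[OF fC C(1)] by simp
qed

text \<open>Stands in for the quotient by \<open>B\<close>: the projection along \<open>B\<close>
  onto a complement is an endomorphism of the same space, so quotients need no type of their
  own.\<close>

lemma exists_lin_with_kernel:
  assumes "subspace B"
  obtains T where "lin T" "\<And>x. T x = 0 \<longleftrightarrow> x \<in> B"
proof -
  interpret vp: vector_space_pair scale scale by unfold_locales
  obtain b where b: "b \<subseteq> B" "independent b" "B \<subseteq> span b"
    using maximal_independent_subset[of B] by blast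
  let ?C = "extend_basis b"
  have C: "b \<subseteq> ?C" "independent ?C" "span ?C = UNIV"
    using extend_basis_superset[OF b(2)] independent_extend_basis[OF b(2)] span_extend_basis[OF b(2)]
    by auto
  define T where "T = vp.construct ?C (\<lambda>x. if x \<in> b then 0 else x)"
  have T: "lin T" unfolding T_def by (rule vp.linear_construct[OF C(2)])
  have Tb: "T x = (if x \<in> b then 0 else x)" if "x \<in> ?C" for x
    unfolding T_def using vp.construct_basis[OF C(2) that] by simp
  have B: "B = span b" using b assms by (metis span_subspace)
  have 1: "T x = 0" if "x \<in> B" for x
  proof -
    have "span b \<subseteq> {x. T x \<in> {0}}"
      using T Tb C(1) by (intro span_minimal subspace_lin_vimage) auto
    then show ?thesis using that B by auto
  qed
  have 2: "x - T x \<in> B" for x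
  proof -
    have "span ?C \<subseteq> {x. x - T x \<in> B}"
    proof (rule span_minimal)
      show "?C \<subseteq> {x. x - T x \<in> B}"
        using Tb b(1) assms by (auto intro: subspace_0)
      have "lin (\<lambda>x. x - T x)"
        using T by (simp add: Vector_Spaces.linear_iff algebra_simps scale_right_diff_distrib)
      then show "subspace {x. x - T x \<in> B}" using assms by (rule subspace_lin_vimage)
    qed
    then show ?thesis using C(3) by auto
  qed
  have "x \<in> B" if "T x = 0" for x using 2[of x] that by simp
  with 1 T that show ?thesis by metis
qed

lemma dim_subset_fin_dim:
  assumes "subspace S" "subspace T" "fin_dim T" "S \<subseteq> T"
  shows "dim S \<le> dim T"
proof -
  obtain f where f: "lin f" "\<And>x. f x = 0 \<longleftrightarrow> x \<in> S" using exists_lin_with_kernel[OF assms(1)] by blast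
  have "{x\<in>T. f x = 0} = S" using f(2) assms(4) by auto
  then show ?thesis using rank_nullity[OF f(1) assms(2,3)] by simp
qed

lemma dim_zero_fin_dim:
  assumes "subspace S" "fin_dim S" "dim S = 0"
  shows "S = {0}"
proof -
  obtain b where b: "b \<subseteq> S" "independent b" "S \<subseteq> span b" "card b = dim S"
    using basis_exists[of S] by blast
  then have "b = {}" using finite_independent_subset[OF assms(2) b(2,1)] assms(3) by simp
  then show ?thesis using b(3) subspace_0[OF assms(1)] by auto
qed

lemma dim_eq_imp_eq:
  assumes "subspace S" "subspace T" "fin_dim T" "S \<subseteq> T" "dim T \<le> dim S"
  shows "S = T"
proof -
  obtain f where f: "lin f" "\<And>x. f x = 0 \<longleftrightarrow> x \<in> S" using exists_lin_with_kernel[OF assms(1)] by blast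
  have "{x\<in>T. f x = 0} = S" using f(2) assms(4) by auto
  then have "dim (f ` T) = 0" using rank_nullity[OF f(1) assms(2,3)] assms(5) by simp
  then have "f ` T = {0}"
    using assms f by (intro dim_zero_fin_dim subspace_lin_image fin_dim_image)
  then show ?thesis using f(2) assms(4) by auto
qed

lemma fin_dim_subspace_sum:
  assumes "fin_dim S" "fin_dim T"
  shows "fin_dim (subspace_sum S T)"
proof -
  obtain C D where "finite C" "S \<subseteq> span C" "finite D" "T \<subseteq> span D"
    using assms unfolding fin_dim_def by blast
  then have "finite (C \<union> D)" "subspace_sum S T \<subseteq> span (C \<union> D)"
    unfolding subspace_sum_def span_Un by auto
  then show ?thesis unfolding fin_dim_def by blast
qed

text \<open>An endomorphism with kernel \<open>T\<close> has the same image on \<open>S\<close> and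
  on the sum; rank-nullity is applied to both.\<close>

lemma dim_subspace_sum_Int:
  assumes S: "subspace S" "fin_dim S" and T: "subspace T" "fin_dim T"
  shows "dim (subspace_sum S T) + dim (S \<inter> T) = dim S + dim T"
proof -
  obtain f where f: "lin f" "\<And>x. f x = 0 \<longleftrightarrow> x \<in> T" using exists_lin_with_kernel[OF T(1)] by blast
  have "f ` subspace_sum S T = f ` S"
  proof
    show "f ` subspace_sum S T \<subseteq> f ` S"
    proof
      fix z assume "z \<in> f ` subspace_sum S T"
      then obtain x y where "z = f (x + y)" "x \<in> S" "y \<in> T" by (auto simp: subspace_sum_def)
      then show "z \<in> f ` S" using f(2)[of y] by (simp add: lin_add[OF f(1)])
    qed
    show "f ` S \<subseteq> f ` subspace_sum S T"
      using subspace_sum_left[OF _ T(1)] by blast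
  qed
  moreover have "{x \<in> subspace_sum S T. f x = 0} = T"
    using f(2) subspace_sum_right[OF _ S(1)] by auto
  moreover have "{x \<in> S. f x = 0} = S \<inter> T" using f(2) by auto
  ultimately show ?thesis
    using rank_nullity[OF f(1) S] rank_nullity[OF f(1) subspace_subspace_sum[OF S(1) T(1)]
        fin_dim_subspace_sum[OF S(2) T(2)]] by simp
qed

lemma increasing_subspaces_stabilize:
  assumes "\<And>j. subspace (L j)" "\<And>j. L j \<subseteq> L (Suc j)" "\<And>j. L j \<subseteq> V" "subspace V" "fin_dim V"
  shows "\<exists>J. \<forall>j\<ge>J. L j = L J"
proof -
  have mono: "i \<le> j \<Longrightarrow> L i \<subseteq> L j" for i j
    using lift_Suc_mono_le[of L] assms(2) by blast
  have "dim (L j) \<le> dim V" for j using assms by (intro dim_subset_fin_dim)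
  then have "finite (range (\<lambda>j. dim (L j)))" by (auto simp: finite_nat_set_iff_bounded_le)
  then obtain J where J: "dim (L J) = Max (range (\<lambda>j. dim (L j)))"
    using Max_in[of "range (\<lambda>j. dim (L j))"] by fastforce
  have "L J = L j" if "j \<ge> J" for j
  proof (rule dim_eq_imp_eq)
    show "fin_dim (L j)" using assms fin_dim_subset by blast
    show "dim (L j) \<le> dim (L J)"
      unfolding J using \<open>finite (range _)\<close> by (intro Max_ge) auto
  qed (use assms mono that in auto)
  then show ?thesis by metis
qed

end

section \<open>Hilbert's basis theorem for graded modules, with operators in place of a polynomial
  ring\<close>

section \<open>Graded modules over commuting operators\<close>

text \<open>A graded module is a sequence of subspaces, on which a set of commuting linear maps of degree
  one acts.\<close>

context graded_space begin

definition submodule :: "('b \<Rightarrow> 'b) set \<Rightarrow> (nat \<Rightarrow> 'b set) \<Rightarrow> bool" where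
  "submodule Ops N \<longleftrightarrow> (\<forall>k. subspace (N k)) \<and> (\<forall>T\<in>Ops. \<forall>k. \<forall>x\<in>N k. T x \<in> N (Suc k))"

lemma submodule_op: "submodule Ops N \<Longrightarrow> T \<in> Ops \<Longrightarrow> x \<in> N k \<Longrightarrow> T x \<in> N (Suc k)"
  by (auto simp: submodule_def)

lemma submodule_antimono: "submodule Ops N \<Longrightarrow> Ops' \<subseteq> Ops \<Longrightarrow> submodule Ops' N"
  by (auto simp: submodule_def)

lemma submodule_funpow: "submodule Ops N \<Longrightarrow> T \<in> Ops \<Longrightarrow> x \<in> N k \<Longrightarrow> (T ^^ j) x \<in> N (k + j)"
  by (induction j) (auto simp: submodule_op)

definition commuting :: "('b \<Rightarrow> 'b) set \<Rightarrow> bool" where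
  "commuting Ops \<longleftrightarrow> (\<forall>S\<in>Ops. \<forall>T\<in>Ops. \<forall>x. S (T x) = T (S x))"

lemma commuting_funpow:
  "commuting Ops \<Longrightarrow> S \<in> Ops \<Longrightarrow> T \<in> Ops \<Longrightarrow> (S ^^ j) (T x) = T ((S ^^ j) x)"
  by (induction j) (auto simp: commuting_def)

text \<open>What degree \<open>k\<close> of \<open>N\<close> generates in degree
  \<open>Suc k\<close>, modulo \<open>E\<close>. That it contains \<open>N (Suc k)\<close> for all
  large \<open>k\<close> expresses finite generation of the quotient of \<open>N\<close> by
  \<open>E\<close> without forming the quotient.\<close>

definition gen_step :: "('b \<Rightarrow> 'b) set \<Rightarrow> (nat \<Rightarrow> 'b set) \<Rightarrow> (nat \<Rightarrow> 'b set) \<Rightarrow> nat \<Rightarrow> 'b set" where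
  "gen_step Ops E N k = span (E (Suc k) \<union> (\<Union>T\<in>Ops. T ` N k))"

lemma gen_step_minimal:
  "E (Suc k) \<subseteq> V \<Longrightarrow> (\<And>T x. T \<in> Ops \<Longrightarrow> x \<in> N k \<Longrightarrow> T x \<in> V) \<Longrightarrow> subspace V \<Longrightarrow>
    gen_step Ops E N k \<subseteq> V"
  unfolding gen_step_def by (intro span_minimal) auto

lemma gen_step_ideal: "x \<in> E (Suc k) \<Longrightarrow> x \<in> gen_step Ops E N k"
  unfolding gen_step_def by (intro span_base) auto

lemma gen_step_op: "T \<in> Ops \<Longrightarrow> x \<in> N k \<Longrightarrow> T x \<in> gen_step Ops E N k"
  unfolding gen_step_def by (intro span_base) auto

lemma subspace_gen_step: "subspace (gen_step Ops E N k)"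
  unfolding gen_step_def by simp

text \<open>Hilbert's argument with lowest instead of leading coefficients: modulo \<open>E + X F\<close>, the elements
  \<open>w\<close> with \<open>X\<^sup>j w \<in> N\<close> form a submodule \<open>L j\<close> over the remaining operators, which increases with \<open>j\<close>
  and therefore stabilizes.\<close>

lemma noetherian_step:
  assumes X: "lin X" and lin: "\<And>T. T \<in> Ops \<Longrightarrow> lin T"
    and comm: "commuting (insert X Ops)"
    and F: "submodule (insert X Ops) F" "\<And>k. fin_dim (F k)"
    and E: "submodule (insert X Ops) E"
    and N: "submodule (insert X Ops) N" "\<And>k. E k \<subseteq> N k" "\<And>k. N k \<subseteq> F k"
    and gen: "\<And>k. k0 \<le> k \<Longrightarrow> F (Suc k) \<subseteq> gen_step (insert X Ops) E F k"
    and IH: "\<And>E N k0. submodule Ops E \<Longrightarrow> submodule Ops N \<Longrightarrow> (\<And>k. E k \<subseteq> N k) \<Longrightarrow>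
        (\<And>k. N k \<subseteq> F k) \<Longrightarrow> (\<And>k. k0 \<le> k \<Longrightarrow> F (Suc k) \<subseteq> gen_step Ops E F k) \<Longrightarrow>
        \<exists>k1. \<forall>k\<ge>k1. N (Suc k) \<subseteq> gen_step Ops E N k"
  shows "\<exists>k1. \<forall>k\<ge>k1. N (Suc k) \<subseteq> gen_step (insert X Ops) E N k"
proof -
  have XT: "X (T x) = T (X x)" if "T \<in> Ops" for T x using comm that by (auto simp: commuting_def)
  have XTj: "(X ^^ j) (T x) = T ((X ^^ j) x)" if "T \<in> Ops" for T x j
    using commuting_funpow[OF comm, of X T] that by auto
  have Xj: "lin (X ^^ j)" for j using lin_funpow[OF X] .
  have subE: "subspace (E k)" and subN: "subspace (N k)" and subF: "subspace (F k)" for k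
    using E N(1) F(1) by (auto simp: submodule_def)
  have XE: "X x \<in> E (Suc k)" if "x \<in> E k" for x k using E that by (simp add: submodule_op)
  have XF: "X x \<in> F (Suc k)" if "x \<in> F k" for x k using F(1) that by (simp add: submodule_op)
  have XN: "X x \<in> N (Suc k)" if "x \<in> N k" for x k using N(1) that by (simp add: submodule_op)
  \<comment> \<open>The graded submodule \<open>X F\<close>: multiplication by \<open>X\<close>
    raises the degree, so nothing arrives in degree 0.\<close>
  define XFs where "XFs k = (case k of 0 \<Rightarrow> {0} | Suc l \<Rightarrow> X ` F l)" for k
  have XFs: "XFs 0 = {0}" "XFs (Suc k) = X ` F k" for k by (simp_all add: XFs_def)
  have subXFs: "subspace (XFs k)" for k
    by (cases k) (auto simp: XFs intro: subspace_lin_image[OF X] subF)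
  have XFs_F: "XFs k \<subseteq> F k" for k
    by (cases k) (auto simp: XFs XF subspace_0[OF subF])
  have XFs_op: "T x \<in> XFs (Suc k)" if xT: "x \<in> XFs k" "T \<in> Ops" for T x k
  proof (cases k)
    case 0
    then have "T x = X 0" using that lin_zero[OF X] lin_zero[OF lin] by (simp add: XFs)
    then show ?thesis using subspace_0[OF subF] by (auto simp: XFs)
  next
    case (Suc l)
    then obtain y where y: "x = X y" "y \<in> F l" using xT by (auto simp: XFs)
    then have "T x = X (T y)" "T y \<in> F k"
      using xT XT submodule_op[OF F(1), of T] Suc by auto
    then show ?thesis by (simp add: XFs)
  qed
  \<comment> \<open>Modulo \<open>E'\<close> the operator \<open>X\<close> is zero on
    \<open>F\<close>, so that \<open>F\<close> is generated over \<open>Ops\<close> alone and the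
    induction hypothesis applies to every \<open>L j\<close> and to their union.\<close>
  define E' where "E' k = subspace_sum (E k) (XFs k)" for k
  define L where "L j k = subspace_sum (E' k) {w \<in> F k. (X ^^ j) w \<in> N (k + j)}" for j k
  have subE': "subspace (E' k)" for k unfolding E'_def by (intro subspace_subspace_sum subE subXFs)
  have subL0: "subspace {w \<in> F k. (X ^^ j) w \<in> N (k + j)}" for j k
    by (intro subspace_lin_vimage' Xj subN subF)
  have subL: "subspace (L j k)" for j k
    unfolding L_def by (intro subspace_subspace_sum subE' subL0)
  have E'_op: "T x \<in> E' (Suc k)" if "x \<in> E' k" "T \<in> Ops" for T x k
    using that submodule_op[OF E, of T] XFs_op[of _ k T] unfolding E'_def subspace_sum_def
    by (force simp: lin_add[OF lin])
  have L_op: "T x \<in> L j (Suc k)" if "x \<in> L j k" "T \<in> Ops" for T x j k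
  proof -
    obtain e w where ew: "x = e + w" "e \<in> E' k" "w \<in> F k" "(X ^^ j) w \<in> N (k + j)"
      using \<open>x \<in> L j k\<close> by (auto simp: L_def subspace_sum_def)
    have "T w \<in> F (Suc k)" "(X ^^ j) (T w) \<in> N (Suc k + j)"
      using ew that submodule_op[OF F(1), of T] submodule_op[OF N(1), of T] by (auto simp: XTj)
    then show ?thesis
      using E'_op[OF ew(2) that(2)] unfolding ew(1) lin_add[OF lin[OF that(2)]] L_def
      by (intro subspace_sumI) auto
  qed
  have E'L: "E' k \<subseteq> L j k" for j k
    unfolding L_def using subspace_sum_left[OF _ subL0] by blast
  have EF: "E k \<subseteq> F k" for k using N(2,3) by blast
  have E'F: "E' k \<subseteq> F k" for k
    unfolding E'_def by (intro subspace_sum_minimal EF XFs_F subF)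
  have LF: "L j k \<subseteq> F k" for j k
    unfolding L_def by (intro subspace_sum_minimal E'F subF) auto
  have L_Suc: "L j k \<subseteq> L (Suc j) k" for j k
    unfolding L_def subspace_sum_def using XN by fastforce
  have L_mono: "i \<le> j \<Longrightarrow> L i k \<subseteq> L j k" for i j k
    using lift_Suc_mono_le[of "\<lambda>j. L j k"] L_Suc by blast
  have E': "submodule Ops E'" using subE' E'_op by (auto simp: submodule_def)
  have L: "submodule Ops (L j)" for j using subL L_op by (auto simp: submodule_def)
  have gen': "F (Suc k) \<subseteq> gen_step Ops E' F k" if "k0 \<le> k" for k
  proof -
    have "gen_step (insert X Ops) E F k \<subseteq> gen_step Ops E' F k"
    proof (rule gen_step_minimal)
      have "E (Suc k) \<subseteq> E' (Suc k)"
        unfolding E'_def using subspace_sum_left[OF _ subXFs] by blast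
      have *: "X ` F k \<subseteq> E' (Suc k)"
        unfolding E'_def XFs(2)[symmetric] using subspace_sum_right[OF _ subE] by blast
      show "E (Suc k) \<subseteq> gen_step Ops E' F k"
        using \<open>E (Suc k) \<subseteq> E' (Suc k)\<close> by (auto intro: gen_step_ideal)
      show "T x \<in> gen_step Ops E' F k" if "T \<in> insert X Ops" "x \<in> F k" for T x
        using that * by (auto intro: gen_step_ideal gen_step_op)
    qed (rule subspace_gen_step)
    then show ?thesis using gen[OF that] by blast
  qed
  obtain kk where kk: "\<And>j k. kk j \<le> k \<Longrightarrow> L j (Suc k) \<subseteq> gen_step Ops E' (L j) k"
  proof -
    have "\<exists>k1. \<forall>k\<ge>k1. L j (Suc k) \<subseteq> gen_step Ops E' (L j) k" for j
      by (rule IH[OF E' L E'L LF gen'])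
    then show ?thesis using that by metis
  qed
  define U where "U k = (\<Union>j. L j k)" for k
  have subU: "subspace (U k)" for k
  proof (rule subspaceI)
    show "0 \<in> U k" unfolding U_def using subspace_0[OF subL] by blast
    show "x + y \<in> U k" if xy: "x \<in> U k" "y \<in> U k" for x y
    proof -
      obtain i j where ij: "x \<in> L i k" "y \<in> L j k" using xy unfolding U_def by blast
      then have "x \<in> L (max i j) k" "y \<in> L (max i j) k"
        using L_mono[of i "max i j" k] L_mono[of j "max i j" k] by auto
      then show ?thesis unfolding U_def using subspace_add[OF subL] by blast
    qed
    show "scale c x \<in> U k" if "x \<in> U k" for c x
      using that subspace_scale[OF subL] unfolding U_def by blast
  qed
  have U: "submodule Ops U" using subU L_op by (fastforce simp: submodule_def U_def)
  have "E' k \<subseteq> U k" "U k \<subseteq> F k" for k using E'L LF unfolding U_def by blast+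
  from IH[OF E' U this gen']
  obtain kU where kU: "\<And>k. kU \<le> k \<Longrightarrow> U (Suc k) \<subseteq> gen_step Ops E' U k" by blast
  have "\<exists>J. \<forall>j\<ge>J. L j k = L J k" for k
    by (rule increasing_subspaces_stabilize[where V = "F k"]) (auto simp: subL L_Suc LF subF F(2))
  then obtain JJ where JJ: "\<And>k j. JJ k \<le> j \<Longrightarrow> L j k = L (JJ k) k" by metis
  define J where "J = Max (JJ ` {..kU})"
  have JJ_J: "JJ k \<le> J" if "k \<le> kU" for k unfolding J_def using that by (intro Max_ge) auto
  \<comment> \<open>One \<open>J\<close> works for all degrees: up to \<open>kU\<close> by finite
    dimension, beyond \<open>kU\<close> because \<open>U\<close> is generated from the preceding
    degree.\<close>
  have LJ: "U k \<subseteq> L J k" for k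
  proof (induction k)
    case 0
    show ?case
    proof
      fix x assume "x \<in> U 0"
      then obtain j where "x \<in> L j 0" unfolding U_def by blast
      then have "x \<in> L (max j J) 0" using L_mono[of j "max j J"] by auto
      then show "x \<in> L J 0" using JJ[of 0] JJ_J[of 0] by (metis le0 max.cobounded2 order_trans)
    qed
  next
    case (Suc k)
    show ?case
    proof (cases "Suc k \<le> kU")
      case True
      show ?thesis
      proof
        fix x assume "x \<in> U (Suc k)"
        then obtain j where "x \<in> L j (Suc k)" unfolding U_def by blast
        then have "x \<in> L (max j J) (Suc k)" using L_mono[of j "max j J"] by auto
        then show "x \<in> L J (Suc k)"
          using JJ[of "Suc k"] JJ_J[OF True] by (metis max.cobounded2 order_trans)
      qed
    next
      case False
      then have "U (Suc k) \<subseteq> gen_step Ops E' U k" using kU by simp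
      also have "\<dots> \<subseteq> L J (Suc k)"
        using Suc E'L L_op subL by (intro gen_step_minimal) auto
      finally show ?thesis .
    qed
  qed
  have LJ': "L j k \<subseteq> L J k" for j k using LJ[of k] unfolding U_def by blast
  define D where "D = Max (kk ` {..J})"
  have kk_D: "kk j \<le> D" if "j \<le> J" for j unfolding D_def using that by (intro Max_ge) auto
  \<comment> \<open>If \<open>(X ^^ j) w\<close> has degree \<open>Suc k\<close>, then
    \<open>w\<close> has degree \<open>Suc k - j\<close>. The bound \<open>D + J\<close> keeps
    \<open>k - j\<close> above \<open>kk j\<close> for all \<open>j \<le> J\<close>.\<close>
  have "N (Suc k) \<subseteq> gen_step (insert X Ops) E N k" if k: "D + J \<le> k" for k
  proof -
    let ?G = "gen_step (insert X Ops) E N k"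
    have GN: "?G \<subseteq> N (Suc k)"
      using N(2) subN submodule_op[OF N(1)] by (intro gen_step_minimal) auto
    \<comment> \<open>Elements of \<open>N (Suc k)\<close> are pushed through the \<open>V j\<close>
      with increasing \<open>j\<close>: modulo generated elements they become divisible by ever
      higher powers of \<open>X\<close>.\<close>
    define V where "V j = subspace_sum ?G ((X ^^ j) ` F (Suc k - j))" for j
    have subV: "subspace (V j)" for j
      unfolding V_def by (intro subspace_subspace_sum subspace_gen_step subspace_lin_image Xj subF)
    have EV: "x \<in> E (Suc k) \<Longrightarrow> x \<in> V j" for x j
      unfolding V_def
      by (intro subspace_sum_left gen_step_ideal subspace_lin_image Xj subF)
    have NV: "T \<in> insert X Ops \<Longrightarrow> x \<in> N k \<Longrightarrow> T x \<in> V j" for T x j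
      unfolding V_def
      by (intro subspace_sum_left gen_step_op subspace_lin_image Xj subF)
    have FV: "x \<in> F (Suc k - j) \<Longrightarrow> (X ^^ j) x \<in> V j" for x j
      unfolding V_def by (intro subspace_sum_right subspace_gen_step) auto
    have XE'V: "(X ^^ j) x \<in> V (Suc j)" if x: "x \<in> E' (Suc k - j)" and j: "j \<le> k" for x j
    proof -
      obtain e f where ef: "x = e + X f" "e \<in> E (Suc (k - j))" "f \<in> F (k - j)"
        using x j by (auto simp: E'_def subspace_sum_def Suc_diff_le XFs)
      have "(X ^^ j) e \<in> E (Suc k)"
        using submodule_funpow[OF E _ ef(2), of X j] j by simp
      moreover have "(X ^^ j) (X f) = (X ^^ Suc j) f" by (simp add: funpow_swap1)
      moreover have "(X ^^ Suc j) f \<in> V (Suc j)" using ef by (intro FV) simp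
      ultimately show ?thesis unfolding ef(1) lin_add[OF Xj]
        using EV subspace_add[OF subV] by metis
    qed
    have step: "(X ^^ j) w \<in> V (Suc j)"
      if w: "w \<in> F (Suc k - j)" "(X ^^ j) w \<in> N (Suc k)" and j: "j \<le> k" for j w
    proof -
      have wL: "w \<in> L j (Suc k - j)"
        unfolding L_def using w j by (intro subspace_sum_right subE') auto
      show ?thesis
      proof (cases "j \<le> J")
        case True
        then have "kk j \<le> k - j" using kk_D[of j] k by linarith
        then have "w \<in> gen_step Ops E' (L j) (k - j)"
          using wL kk[of j "k - j"] j by (auto simp: Suc_diff_le)
        moreover have "gen_step Ops E' (L j) (k - j) \<subseteq> {w. (X ^^ j) w \<in> V (Suc j)}"
        proof (rule gen_step_minimal)
          show "E' (Suc (k - j)) \<subseteq> {w. (X ^^ j) w \<in> V (Suc j)}"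
            using XE'V[OF _ j] j by (auto simp: Suc_diff_le)
          show "T x \<in> {w. (X ^^ j) w \<in> V (Suc j)}" if T: "T \<in> Ops" and x: "x \<in> L j (k - j)" for T x
          proof -
            obtain e u where eu: "x = e + u" "e \<in> E' (k - j)" "(X ^^ j) u \<in> N k"
              using x j by (auto simp: L_def subspace_sum_def)
            have "(X ^^ j) (T e) \<in> V (Suc j)"
              using E'_op[OF eu(2) T] XE'V[OF _ j, of "T e"] j by (simp add: Suc_diff_le)
            moreover have "(X ^^ j) (T u) \<in> V (Suc j)"
              unfolding XTj[OF T] using eu T by (intro NV) auto
            ultimately show ?thesis
              unfolding eu(1) lin_add[OF lin[OF T]] using subspace_add[OF subV] by (simp add: lin_add[OF Xj])
          qed
          show "subspace {w. (X ^^ j) w \<in> V (Suc j)}" by (intro subspace_lin_vimage Xj subV)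
        qed
        ultimately show ?thesis by blast
      next
        case False
        then obtain i where i: "j = Suc i" "J \<le> i" by (metis not_le Suc_le_D Suc_le_mono less_eq_Suc_le)
        \<comment> \<open>Beyond \<open>J\<close> nothing new appears: modulo \<open>E'\<close>,
          already the power \<open>i = j - 1\<close> carries \<open>w\<close> into \<open>N\<close>,
          and one more \<open>X\<close> gives a generated element.\<close>
        have "w \<in> L i (Suc k - j)"
          using wL LJ' L_mono[OF i(2)] by blast
        then obtain e u where eu: "w = e + u" "e \<in> E' (Suc k - j)" "(X ^^ i) u \<in> N (Suc k - j + i)"
          by (auto simp: L_def subspace_sum_def)
        have "(X ^^ j) u \<in> V (Suc j)"
          using NV[of X "(X ^^ i) u" "Suc j"] eu(3) j by (simp add: i)
        then show ?thesis unfolding eu(1) lin_add[OF Xj]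
          using XE'V[OF eu(2) j] subspace_add[OF subV] by blast
      qed
    qed
    have NVj: "N (Suc k) \<subseteq> V j" if "j \<le> Suc k" for j
      using that
    proof (induction j)
      case 0
      then show ?case using FV[of _ 0] N(3) by auto
    next
      case (Suc j)
      then have j: "j \<le> k" by simp
      show ?case
      proof
        fix z assume z: "z \<in> N (Suc k)"
        then obtain g w where gw: "z = g + (X ^^ j) w" "g \<in> ?G" "w \<in> F (Suc k - j)"
          using Suc.IH j by (auto simp: V_def subspace_sum_def)
        have "(X ^^ j) w = z - g" using gw by simp
        then have "(X ^^ j) w \<in> N (Suc k)"
          using z gw(2) GN subspace_diff[OF subN] by auto
        then have "(X ^^ j) w \<in> V (Suc j)" using step gw(3) j by blast
        moreover have "g \<in> V (Suc j)"
          unfolding V_def using gw(2) by (intro subspace_sum_left subspace_lin_image Xj subF)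
        ultimately show "z \<in> V (Suc j)" unfolding gw(1) using subspace_add[OF subV] by blast
      qed
    qed
    show ?thesis
    proof
      fix z assume z: "z \<in> N (Suc k)"
      then obtain g w where gw: "z = g + (X ^^ Suc k) w" "g \<in> ?G" "w \<in> F 0"
        using NVj[of "Suc k"] by (auto simp: V_def subspace_sum_def)
      have "(X ^^ Suc k) w = z - g" using gw by simp
      then have XN': "(X ^^ Suc k) w \<in> N (Suc k)"
        using z gw(2) GN subspace_diff[OF subN] by auto
      \<comment> \<open>The descent ends in degree 0, where \<open>X F\<close> is zero and
        \<open>E'\<close> is just \<open>E\<close>.\<close>
      have "w \<in> L (Suc k) 0"
        unfolding L_def using gw(3) XN' by (intro subspace_sum_right subE') auto
      then have "w \<in> L k 0" using LJ' L_mono[of J k 0] k by (meson in_mono le_add2 order_trans)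
      then obtain e u where eu: "w = e + u" "e \<in> E 0" "(X ^^ k) u \<in> N k"
        by (auto simp: L_def E'_def XFs subspace_sum_def)
      have "(X ^^ Suc k) e \<in> ?G"
        using submodule_funpow[OF E _ eu(2), of X "Suc k"] by (intro gen_step_ideal) simp
      moreover have "(X ^^ Suc k) u \<in> ?G"
        using gen_step_op[of X "insert X Ops" "(X ^^ k) u" N k] eu(3) by simp
      ultimately show "z \<in> ?G"
        unfolding gw(1) eu(1) lin_add[OF Xj] using gw(2) subspace_add[OF subspace_gen_step] by blast
    qed
  qed
  then show ?thesis by blast
qed

text \<open>Induction on the operators. \<open>E\<close> has to vary, as the step replaces it by
  \<open>E + X F\<close>; without operators the generation hypothesis makes \<open>E\<close>,
  \<open>N\<close> and \<open>F\<close> agree in large degrees.\<close>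

lemma noetherian:
  assumes "finite Ops" "\<And>T. T \<in> Ops \<Longrightarrow> lin T" "commuting Ops"
    "submodule Ops F" "\<And>k. fin_dim (F k)" "submodule Ops E" "submodule Ops N"
    "\<And>k. E k \<subseteq> N k" "\<And>k. N k \<subseteq> F k" "\<And>k. k0 \<le> k \<Longrightarrow> F (Suc k) \<subseteq> gen_step Ops E F k"
  shows "\<exists>k1. \<forall>k\<ge>k1. N (Suc k) \<subseteq> gen_step Ops E N k"
  using assms
proof (induction Ops arbitrary: E N k0 rule: finite_induct)
  case empty
  have "gen_step {} E F k = E (Suc k)" "gen_step {} E N k = E (Suc k)" for k
    using empty(5) by (simp_all add: gen_step_def submodule_def)
  then show ?case using empty by (metis order_trans)
next
  case (insert X Ops)
  have "commuting Ops" "submodule Ops F"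
    using insert.prems by (auto simp: commuting_def intro: submodule_antimono)
  note hyps = this
  have IH: "\<exists>k1. \<forall>k\<ge>k1. N (Suc k) \<subseteq> gen_step Ops E N k"
    if "submodule Ops E" "submodule Ops N" "\<And>k. E k \<subseteq> N k" "\<And>k. N k \<subseteq> F k"
      and gen: "\<And>k. k0 \<le> k \<Longrightarrow> F (Suc k) \<subseteq> gen_step Ops E F k" for E N k0
  proof (rule insert.IH)
    show "F (Suc k) \<subseteq> gen_step Ops E F k" if "k0 \<le> k" for k using gen[OF that] .
  qed (use hyps insert.prems(1,4) that in auto)
  show ?case
  proof (rule noetherian_step[where ?k0.0 = k0])
    show "F (Suc k) \<subseteq> gen_step (insert X Ops) E F k" if "k0 \<le> k" for k
      by (rule insert.prems(9)[OF that])
    show "\<exists>k1. \<forall>k\<ge>k1. N (Suc k) \<subseteq> gen_step Ops E N k"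
      if "submodule Ops E" "submodule Ops N" "\<And>k. E k \<subseteq> N k" "\<And>k. N k \<subseteq> F k"
        "\<And>k. k0 \<le> k \<Longrightarrow> F (Suc k) \<subseteq> gen_step Ops E F k" for E N k0
      by (rule IH[OF that])
  qed (use insert.prems(1-8) in \<open>simp_all\<close>)
qed

end

section \<open>The Hilbert-Serre theorem and its version for alternating sums over subsets\<close>

section \<open>Pole orders of Hilbert series\<close>

definition poly_fps :: "int fps \<Rightarrow> bool" where
  "poly_fps f \<longleftrightarrow> f \<in> range fps_of_poly"

lemma poly_fps_of_poly: "poly_fps (fps_of_poly p)"
  by (simp add: poly_fps_def)

lemma poly_fpsE:
  assumes "poly_fps f" obtains p where "f = fps_of_poly p"
  using assms by (auto simp: poly_fps_def)

lemma poly_fps_diff: "poly_fps f \<Longrightarrow> poly_fps g \<Longrightarrow> poly_fps (f - g)"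
  by (metis poly_fpsE poly_fps_of_poly fps_of_poly_diff)

lemma poly_fps_mult: "poly_fps f \<Longrightarrow> poly_fps g \<Longrightarrow> poly_fps (f * g)"
  by (metis poly_fpsE poly_fps_of_poly fps_of_poly_mult)

lemma poly_fps_finite:
  assumes "\<And>k. n < k \<Longrightarrow> fps_nth f k = 0"
  shows "poly_fps f"
proof -
  have "f = fps_of_poly (Abs_poly (fps_nth f))"
  proof (rule fps_ext)
    fix k
    have "\<forall>\<^sub>\<infinity>k. fps_nth f k = 0" unfolding MOST_nat using assms by blast
    then show "fps_nth f k = fps_nth (fps_of_poly (Abs_poly (fps_nth f))) k"
      by (simp add: Abs_poly_inverse)
  qed
  then show ?thesis by (metis poly_fps_of_poly)
qed

lemma poly_fps_X: "poly_fps fps_X"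
  by (rule poly_fps_finite[of 1]) (simp add: fps_X_def)

context graded_space begin

definition hilb :: "(nat \<Rightarrow> 'b set) \<Rightarrow> int fps" where
  "hilb N = Abs_fps (\<lambda>k. int (dim (N k)))"

lemma hilb_nth [simp]: "fps_nth (hilb N) k = int (dim (N k))"
  by (simp add: hilb_def)

end

text \<open>A graded module over the polynomial ring in \<open>Ops\<close>, generated in degree 0
  with finite-dimensional pieces. All modules considered are quotients of its submodules.\<close>

locale generated_module = graded_space +
  fixes Ops :: "('b \<Rightarrow> 'b) set" and F :: "nat \<Rightarrow> 'b set"
  assumes fin_Ops: "finite Ops"
    and lin_Ops: "T \<in> Ops \<Longrightarrow> Vector_Spaces.linear scale scale T"
    and comm_Ops: "commuting Ops"
    and fin_dim_F: "fin_dim (F k)"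
    and submodule_F: "submodule Ops F"
    and generated: "F (Suc k) \<subseteq> gen_step Ops (\<lambda>k. {0}) F k"
begin

definition submod :: "(nat \<Rightarrow> 'b set) \<Rightarrow> bool" where
  "submod N \<longleftrightarrow> submodule Ops N \<and> (\<forall>k. N k \<subseteq> F k)"

lemma submod_subspace: "submod N \<Longrightarrow> subspace (N k)"
  by (simp add: submod_def submodule_def)

lemma submod_op: "submod N \<Longrightarrow> T \<in> Ops \<Longrightarrow> x \<in> N k \<Longrightarrow> T x \<in> N (Suc k)"
  by (simp add: submod_def submodule_def)

lemma submod_fin_dim: "submod N \<Longrightarrow> fin_dim (N k)"
  unfolding submod_def by (metis fin_dim_F fin_dim_subset)

lemma Ops_commute: "S \<in> Ops \<Longrightarrow> T \<in> Ops \<Longrightarrow> S (T x) = T (S x)"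
  using comm_Ops by (auto simp: commuting_def)

lemma submod_Int: "submod M \<Longrightarrow> submod N \<Longrightarrow> submod (\<lambda>k. M k \<inter> N k)"
  by (auto simp: submod_def submodule_def intro: subspace_inter)

lemma submod_sum:
  assumes "submod M" "submod N"
  shows "submod (\<lambda>k. subspace_sum (M k) (N k))"
proof -
  have "T x \<in> subspace_sum (M (Suc k)) (N (Suc k))"
    if "T \<in> Ops" "x \<in> subspace_sum (M k) (N k)" for T x k
    using that assms submod_op unfolding subspace_sum_def by (force simp: lin_add[OF lin_Ops])
  moreover have "subspace_sum (M k) (N k) \<subseteq> F k" for k
    using assms submodule_F
    by (intro subspace_sum_minimal) (auto simp: submod_def submodule_def)
  ultimately show ?thesis
    using assms by (auto simp: submod_def submodule_def intro!: subspace_subspace_sum)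
qed

lemma hilb_subspace_sum:
  assumes "submod M" "submod N"
  shows "hilb (\<lambda>k. subspace_sum (M k) (N k)) = hilb M + hilb N - hilb (\<lambda>k. M k \<inter> N k)"
proof (rule fps_ext)
  fix k
  show "fps_nth (hilb (\<lambda>k. subspace_sum (M k) (N k))) k =
      fps_nth (hilb M + hilb N - hilb (\<lambda>k. M k \<inter> N k)) k"
    using dim_subspace_sum_Int[of "M k" "N k"] assms
    by (simp add: submod_subspace submod_fin_dim)
qed

text \<open>The induction uses multiplication by \<open>y\<close> on \<open>Z/B\<close>: its kernel and its cokernel are
  annihilated by \<open>y\<close>. When all operators annihilate \<open>Z/B\<close>, this quotient is finite-dimensional.\<close>

lemma hilbert_serre:
  assumes "K \<union> set ys = Ops" "submod Z" "submod B" "\<And>k. B k \<subseteq> Z k"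
    and "\<And>T x k. T \<in> K \<Longrightarrow> x \<in> Z k \<Longrightarrow> T x \<in> B (Suc k)"
  shows "poly_fps ((1 - fps_X) ^ length ys * (hilb Z - hilb B))"
  using assms
proof (induction ys arbitrary: K Z B)
  case Nil
  have "\<exists>k1. \<forall>k\<ge>k1. Z (Suc k) \<subseteq> gen_step Ops (\<lambda>k. {0}) Z k"
  proof (rule noetherian[OF fin_Ops lin_Ops comm_Ops submodule_F fin_dim_F, where ?k0.0 = 0])
    show "submodule Ops (\<lambda>k. {0})" by (auto simp: submodule_def lin_Ops lin_zero)
  qed (use Nil generated in \<open>auto simp: submod_def submod_subspace subspace_0 submodule_def\<close>)
  then obtain k1 where k1: "\<And>k. k \<ge> k1 \<Longrightarrow> Z (Suc k) \<subseteq> gen_step Ops (\<lambda>k. {0}) Z k" by blast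
  have "Z (Suc k) = B (Suc k)" if "k1 \<le> k" for k
  proof -
    have "gen_step Ops (\<lambda>k. {0}) Z k \<subseteq> B (Suc k)"
      using Nil submod_subspace[OF Nil.prems(3)] by (intro gen_step_minimal) (auto simp: subspace_0)
    then show ?thesis using k1[OF that] Nil(4) by blast
  qed
  then have "fps_nth (hilb Z - hilb B) k = 0" if "k1 < k" for k
    using that by (cases k) auto
  then show ?case using poly_fps_finite[of k1 "hilb Z - hilb B"] by simp
next
  case (Cons y ys)
  have y: "y \<in> Ops" "lin y" using Cons.prems(1) lin_Ops by auto
  note Z = \<open>submod Z\<close> and B = \<open>submod B\<close>
  \<comment> \<open>\<open>Z' / B\<close> is the kernel of \<open>y\<close> on \<open>Z / B\<close>,
    and \<open>Z / B'\<close> is its cokernel; in degree 0 nothing is in the image of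
    \<open>y\<close>.\<close>
  define Z' where "Z' k = {z \<in> Z k. y z \<in> B (Suc k)}" for k
  define yZ where "yZ k = (case k of 0 \<Rightarrow> {0} | Suc l \<Rightarrow> y ` Z l)" for k
  have yZ: "yZ 0 = {0}" "yZ (Suc k) = y ` Z k" for k by (simp_all add: yZ_def)
  define B' where "B' k = subspace_sum (yZ k) (B k)" for k
  have Z': "submod Z'"
    unfolding submod_def submodule_def
  proof (intro conjI allI ballI)
    show "subspace (Z' k)" for k
      unfolding Z'_def using Z B y(2) by (intro subspace_lin_vimage' submod_subspace)
    show "Z' k \<subseteq> F k" for k using Z by (auto simp: Z'_def submod_def)
    fix T k x assume "T \<in> Ops" "x \<in> Z' k"
    then show "T x \<in> Z' (Suc k)"
      using Z B Ops_commute[OF y(1), of T] by (auto simp: Z'_def submod_op)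
  qed
  have sub_yZ: "subspace (yZ k)" and yZ_F: "yZ k \<subseteq> Z k" for k
    using subspace_lin_image[OF y(2) submod_subspace[OF Z]] submod_subspace[OF Z] submod_op[OF Z y(1)]
    by (cases k; auto simp: yZ subspace_0)+
  have "submod yZ"
    unfolding submod_def submodule_def
  proof (intro conjI allI ballI sub_yZ)
    show "yZ k \<subseteq> F k" for k using Z yZ_F by (auto simp: submod_def)
    fix T k x assume T: "T \<in> Ops" and x: "x \<in> yZ k"
    show "T x \<in> yZ (Suc k)"
    proof (cases k)
      case 0
      then have "T x = 0" using x T by (simp add: yZ lin_zero lin_Ops)
      then show ?thesis by (simp add: sub_yZ subspace_0)
    next
      case (Suc l)
      then obtain z where "x = y z" "z \<in> Z l" using x by (auto simp: yZ)
      then show ?thesis using Suc T Z Ops_commute[OF T y(1)] by (auto simp: yZ submod_op)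
    qed
  qed
  then have B': "submod B'" unfolding B'_def using B by (intro submod_sum)
  \<comment> \<open>\<open>y\<close> induces an isomorphism of \<open>Z k / Z' k\<close> onto
    \<open>B' (Suc k) / B (Suc k)\<close>; the map \<open>f\<close> below plays the part of the
    quotient by \<open>B (Suc k)\<close>.\<close>
  have eq: "dim (Z k) + dim (B (Suc k)) = dim (Z' k) + dim (B' (Suc k))" for k
  proof -
    obtain f where f: "lin f" "\<And>x. f x = 0 \<longleftrightarrow> x \<in> B (Suc k)"
      using exists_lin_with_kernel[OF submod_subspace[OF B]] by blast
    have fy: "lin (\<lambda>x. f (y x))" using f(1) y(2) by (simp add: Vector_Spaces.linear_iff)
    have "dim (Z k) = dim (Z' k) + dim ((\<lambda>x. f (y x)) ` Z k)"
      using rank_nullity[OF fy submod_subspace[OF Z] submod_fin_dim[OF Z]] by (simp add: Z'_def f(2))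
    moreover have "f ` B' (Suc k) = (\<lambda>x. f (y x)) ` Z k"
    proof -
      have "f ` B' (Suc k) = (\<Union>x\<in>yZ (Suc k). \<Union>b\<in>B (Suc k). {f x + f b})"
        unfolding B'_def subspace_sum_def by (force simp: lin_add[OF f(1)])
      also have "\<dots> = (\<Union>x\<in>yZ (Suc k). \<Union>b\<in>B (Suc k). {f x})"
        using f(2) by (intro SUP_cong) auto
      also have "\<dots> = f ` yZ (Suc k)" using subspace_0[OF submod_subspace[OF B]] by auto
      finally show ?thesis by (simp add: yZ image_image)
    qed
    moreover have "{x \<in> B' (Suc k). f x = 0} = B (Suc k)"
      using f(2) subspace_sum_right[OF _ sub_yZ] unfolding B'_def by blast
    ultimately show ?thesis
      using rank_nullity[OF f(1) submod_subspace[OF B'] submod_fin_dim[OF B'], of "Suc k"] by simp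
  qed
  have B'0: "B' 0 = B 0" by (auto simp: B'_def subspace_sum_def yZ)
  have "(1 - fps_X) * (hilb Z - hilb B) = (hilb Z - hilb B') - fps_X * (hilb Z' - hilb B)"
  proof (rule fps_ext)
    fix k
    show "fps_nth ((1 - fps_X) * (hilb Z - hilb B)) k =
        fps_nth ((hilb Z - hilb B') - fps_X * (hilb Z' - hilb B)) k"
    proof (cases k)
      case 0
      then show ?thesis by (simp add: B'0 left_diff_distrib)
    next
      case (Suc l)
      have "int (dim (Z l)) + int (dim (B (Suc l))) = int (dim (Z' l)) + int (dim (B' (Suc l)))"
        using eq[of l] by linarith
      then show ?thesis using Suc by (simp add: left_diff_distrib)
    qed
  qed
  then have "(1 - fps_X) ^ length (y # ys) * (hilb Z - hilb B) =
      (1 - fps_X) ^ length ys * ((hilb Z - hilb B') - fps_X * (hilb Z' - hilb B))"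
    by (simp only: length_Cons power_Suc2 mult.assoc)
  then have "(1 - fps_X) ^ length (y # ys) * (hilb Z - hilb B) =
      (1 - fps_X) ^ length ys * (hilb Z - hilb B')
      - fps_X * ((1 - fps_X) ^ length ys * (hilb Z' - hilb B))"
    by (simp only: right_diff_distrib mult.left_commute)
  moreover have "poly_fps ((1 - fps_X) ^ length ys * (hilb Z - hilb B'))"
  proof (rule Cons.IH[of "insert y K"])
    show "B' k \<subseteq> Z k" for k
      unfolding B'_def using yZ_F Cons.prems(4) submod_subspace[OF Z] by (intro subspace_sum_minimal)
    show "T x \<in> B' (Suc k)" if Tx: "T \<in> insert y K" "x \<in> Z k" for T x k
    proof (cases "T = y")
      case True
      then show ?thesis unfolding B'_def using Tx
        by (intro subspace_sum_left submod_subspace[OF B]) (auto simp: yZ)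
    next
      case False
      then show ?thesis unfolding B'_def using Tx Cons.prems(5)
        by (intro subspace_sum_right sub_yZ) auto
    qed
  qed (use Cons.prems Z B' in auto)
  moreover have "poly_fps ((1 - fps_X) ^ length ys * (hilb Z' - hilb B))"
  proof (rule Cons.IH[of "insert y K"])
    show "B k \<subseteq> Z' k" for k
      using Cons.prems(4) submod_op[OF B y(1)] by (auto simp: Z'_def)
    show "T x \<in> B (Suc k)" if "T \<in> insert y K" "x \<in> Z' k" for T x k
      using that Cons.prems(5) by (auto simp: Z'_def)
  qed (use Cons.prems(1) Z' B in auto)
  ultimately show ?case by (simp add: poly_fps_diff poly_fps_mult poly_fps_X)
qed

text \<open>Passing from the pair \<open>B \<subseteq> Z\<close> on subsets of \<open>insert i I\<close> to the cokernels and the kernels of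
  \<open>Z (insert i J) / B (insert i J) \<rightarrow> Z J / B J\<close>, which are annihilated by \<open>f i\<close>, removes \<open>i\<close>.\<close>

lemma boolean_pole_order:
  fixes f :: "'i \<Rightarrow> 'b \<Rightarrow> 'b" and Z B :: "'i set \<Rightarrow> nat \<Rightarrow> 'b set"
  assumes "finite I" "K \<union> f ` I \<union> set ys = Ops"
    and "\<And>J. J \<subseteq> I \<Longrightarrow> submod (Z J)" "\<And>J. J \<subseteq> I \<Longrightarrow> submod (B J)"
    and "\<And>J k. J \<subseteq> I \<Longrightarrow> B J k \<subseteq> Z J k"
    and "\<And>J i k. J \<subseteq> I \<Longrightarrow> i \<in> I \<Longrightarrow> Z (insert i J) k \<subseteq> Z J k"
    and "\<And>J i k. J \<subseteq> I \<Longrightarrow> i \<in> I \<Longrightarrow> B (insert i J) k \<subseteq> B J k"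
    and "\<And>J i k x. J \<subseteq> I \<Longrightarrow> i \<in> I \<Longrightarrow> x \<in> Z J k \<Longrightarrow> f i x \<in> Z (insert i J) (Suc k)"
    and "\<And>J i k x. J \<subseteq> I \<Longrightarrow> i \<in> I \<Longrightarrow> x \<in> B J k \<Longrightarrow> f i x \<in> B (insert i J) (Suc k)"
    and "\<And>J T k x. J \<subseteq> I \<Longrightarrow> T \<in> K \<Longrightarrow> x \<in> Z J k \<Longrightarrow> T x \<in> B J (Suc k)"
  shows "poly_fps ((1 - fps_X) ^ length ys * (\<Sum>J\<in>Pow I. (-1) ^ card J * (hilb (Z J) - hilb (B J))))"
  using assms
proof (induction I arbitrary: K Z B rule: finite_induct)
  case empty
  then show ?case using hilbert_serre[of K ys "Z {}" "B {}"] by simp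
next
  case (insert i I)
  note ops = insert.prems(1) and Z = insert.prems(2) and B = insert.prems(3)
    and BZ = insert.prems(4) and mZ = insert.prems(5) and mB = insert.prems(6)
    and fZ = insert.prems(7) and fB = insert.prems(8) and KZ = insert.prems(9)
  \<comment> \<open>\<open>Z J / B1 J\<close> is the cokernel and \<open>Z2 J / B2 J\<close> the
    kernel. As \<open>f i\<close> maps \<open>Z J\<close> into \<open>Z (insert i J)\<close> and
    \<open>B J\<close> into \<open>B (insert i J)\<close>, it annihilates both.\<close>
  define B1 where "B1 J k = subspace_sum (Z (insert i J) k) (B J k)" for J k
  define Z2 where "Z2 J k = Z (insert i J) k \<inter> B J k" for J k
  define B2 where "B2 J = B (insert i J)" for J
  have sub: "insert i J \<subseteq> insert i I" "J \<subseteq> insert i I" if "J \<subseteq> I" for J using that by auto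
  have subB1: "submod (B1 J)" if "J \<subseteq> I" for J
    unfolding B1_def using sub[OF that] Z B by (intro submod_sum) auto
  have subZ2: "submod (Z2 J)" if "J \<subseteq> I" for J
    unfolding Z2_def using sub[OF that] Z B by (intro submod_Int) auto
  have B1l: "x \<in> B1 J k" if "x \<in> Z (insert i J) k" "J \<subseteq> I" for x J k
    unfolding B1_def using that sub[OF that(2)] submod_subspace B by (intro subspace_sum_left) auto
  have B1r: "x \<in> B1 J k" if "x \<in> B J k" "J \<subseteq> I" for x J k
    unfolding B1_def using that sub[OF that(2)] submod_subspace Z by (intro subspace_sum_right) auto
  have ii: "insert i (insert j J) = insert j (insert i J)" for j J by (rule insert_commute)
  have B1min: "B1 J k \<subseteq> V" if "J \<subseteq> I" "Z (insert i J) k \<subseteq> V" "B J k \<subseteq> V" "subspace V" for J k V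
    unfolding B1_def using that by (intro subspace_sum_minimal) auto
  have coker: "poly_fps ((1 - fps_X) ^ length ys * (\<Sum>J\<in>Pow I. (-1) ^ card J * (hilb (Z J) - hilb (B1 J))))"
  proof (rule insert.IH[of "insert (f i) K"])
    fix J j k x assume J: "J \<subseteq> I"
    show "B1 J k \<subseteq> Z J k"
      using J sub[OF J] mZ[of J i k] BZ[of J k] submod_subspace[OF Z[of J]] by (intro B1min) auto
    {
      assume j: "j \<in> I"
      show "B1 (insert j J) k \<subseteq> B1 J k"
      proof (rule B1min)
        show "Z (insert i (insert j J)) k \<subseteq> B1 J k"
          using mZ[of "insert i J" j k] J j B1l[OF _ J] unfolding ii[of j] by blast
        show "B (insert j J) k \<subseteq> B1 J k"
          using mB[of J j k] J j B1r[OF _ J] by blast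
      qed (use J j submod_subspace[OF subB1[of J]] in auto)
      show "f j x \<in> B1 (insert j J) (Suc k)" if "x \<in> B1 J k"
      proof -
        have "B1 J k \<subseteq> {x. f j x \<in> B1 (insert j J) (Suc k)}"
        proof (rule B1min[OF J])
          show "Z (insert i J) k \<subseteq> {x. f j x \<in> B1 (insert j J) (Suc k)}"
            using J j fZ[of "insert i J" j] B1l[of _ "insert j J"] sub[OF J] by (auto simp: ii[of j])
          show "B J k \<subseteq> {x. f j x \<in> B1 (insert j J) (Suc k)}"
            using J j fB[of J j] B1r[of _ "insert j J"] sub[OF J] by auto
          show "subspace {x. f j x \<in> B1 (insert j J) (Suc k)}"
            using lin_Ops ops J j subB1[of "insert j J"] by (intro subspace_lin_vimage submod_subspace) auto
        qed
        then show ?thesis using that by blast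
      qed
    }
    show "T x \<in> B1 J (Suc k)" if "T \<in> insert (f i) K" "x \<in> Z J k" for T
      using that J fZ[of J i x k] KZ[of J T x k] B1l[of _ J] B1r[of _ J] sub[OF J] by auto
  qed (use ops Z[OF sub(2)] mZ[OF sub(2)] fZ[OF sub(2)] subB1 in auto)
  have ker: "poly_fps ((1 - fps_X) ^ length ys * (\<Sum>J\<in>Pow I. (-1) ^ card J * (hilb (Z2 J) - hilb (B2 J))))"
  proof (rule insert.IH[of "insert (f i) K"])
    fix J j k x assume J: "J \<subseteq> I"
    show "B2 J k \<subseteq> Z2 J k"
      using J mB[of J i k] BZ[of "insert i J" k] by (auto simp: Z2_def B2_def)
    {
      assume j: "j \<in> I"
      show "Z2 (insert j J) k \<subseteq> Z2 J k"
        using mZ[of "insert i J" j k] mB[of J j k] J j by (auto simp: Z2_def ii[of j])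
      show "B2 (insert j J) k \<subseteq> B2 J k"
        using mB[of "insert i J" j k] J j by (auto simp: B2_def ii[of j])
      show "f j x \<in> Z2 (insert j J) (Suc k)" if "x \<in> Z2 J k"
        using fZ[of "insert i J" j x k] fB[of J j x k] J j that by (auto simp: Z2_def ii[of j])
      show "f j x \<in> B2 (insert j J) (Suc k)" if "x \<in> B2 J k"
        using fB[of "insert i J" j x k] J j that by (auto simp: B2_def ii[of j])
    }
    show "T x \<in> B2 J (Suc k)" if "T \<in> insert (f i) K" "x \<in> Z2 J k" for T
      using that J fB[of J i x k] KZ[of "insert i J" T x k] by (auto simp: Z2_def B2_def)
  qed (use ops subZ2 B[OF sub(1)] in \<open>auto simp: B2_def\<close>)
  \<comment> \<open>The Euler characteristic of the exact sequence formed by kernel, source, target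
    and cokernel.\<close>
  have eq: "(-1) ^ card J * (hilb (Z J) - hilb (B J))
      + (-1) ^ card (insert i J) * (hilb (Z (insert i J)) - hilb (B (insert i J)))
      = (-1) ^ card J * (hilb (Z J) - hilb (B1 J)) - (-1) ^ card J * (hilb (Z2 J) - hilb (B2 J))"
    if J: "J \<subseteq> I" for J
  proof -
    have "card (insert i J) = Suc (card J)"
      using J insert.hyps finite_subset by (intro card_insert_disjoint) auto
    moreover have "hilb (B1 J) = hilb (Z (insert i J)) + hilb (B J) - hilb (Z2 J)"
      unfolding B1_def Z2_def using sub[OF J] Z B by (intro hilb_subspace_sum) auto
    ultimately show ?thesis by (simp only: B2_def power_Suc) (simp add: algebra_simps)
  qed
  have "(\<Sum>J\<in>Pow (insert i I). (-1) ^ card J * (hilb (Z J) - hilb (B J)))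
      = (\<Sum>J\<in>Pow I. (-1) ^ card J * (hilb (Z J) - hilb (B J)))
        + (\<Sum>J\<in>insert i ` Pow I. (-1) ^ card J * (hilb (Z J) - hilb (B J)))"
    unfolding Pow_insert using insert.hyps by (intro sum.union_disjoint) auto
  also have "(\<Sum>J\<in>insert i ` Pow I. (-1) ^ card J * (hilb (Z J) - hilb (B J)))
      = (\<Sum>J\<in>Pow I. (-1) ^ card (insert i J) * (hilb (Z (insert i J)) - hilb (B (insert i J))))"
    using insert.hyps by (subst sum.reindex) (auto simp: inj_on_def)
  also have "(\<Sum>J\<in>Pow I. (-1) ^ card J * (hilb (Z J) - hilb (B J))) + \<dots>
      = (\<Sum>J\<in>Pow I. (-1) ^ card J * (hilb (Z J) - hilb (B1 J)))
        - (\<Sum>J\<in>Pow I. (-1) ^ card J * (hilb (Z2 J) - hilb (B2 J)))"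
    unfolding sum.distrib[symmetric] sum_subtractf[symmetric] using eq by (intro sum.cong) auto
  finally show ?case using coker ker by (simp add: right_diff_distrib poly_fps_diff)
qed

end

section \<open>The polynomial ring: degrees, homogeneous components, and linear forms as
  primes\<close>

section \<open>Polynomials\<close>

lemma Const_add: "Const (a + b) = Const a + Const b"
  by (simp add: Const_def single_add)

lemma Const_mult: "Const (a * b) = Const a * Const b"
  by (simp add: Const_def mult_single)

lemma Const_0 [simp]: "Const 0 = 0"
  by (simp add: Const_def)

lemma Const_1 [simp]: "Const 1 = 1"
  by (simp add: Const_def)

lemma Const_sum: "Const (sum f X) = (\<Sum>x\<in>X. Const (f x))"
  by (induction X rule: infinite_finite_induct) (simp_all add: Const_add)

lemma single_Const: "Poly_Mapping.single k (c * d) = Const c * Poly_Mapping.single k d"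
  by (simp add: Const_def mult_single)

lemma Var_single: "Var i * Poly_Mapping.single k c = Poly_Mapping.single (Poly_Mapping.single i 1 + k) c"
  by (simp add: Var_def mult_single)

definition mdeg :: "('m::finite \<Rightarrow>\<^sub>0 nat) \<Rightarrow> nat" where
  "mdeg k = (\<Sum>i\<in>UNIV. Poly_Mapping.lookup k i)"

lemma mdeg_add: "mdeg (k + l) = mdeg k + mdeg l"
  by (simp add: mdeg_def lookup_add sum.distrib)

lemma mdeg_single: "mdeg (Poly_Mapping.single i n) = n"
  by (simp add: mdeg_def lookup_single when_def)

lemma mdeg_eq_0: "mdeg k = 0 \<longleftrightarrow> k = 0"
  by (auto simp: mdeg_def poly_mapping_eq_iff fun_eq_iff)

lemma mdeg_0 [simp]: "mdeg 0 = 0"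
  by (simp add: mdeg_def)

lemma exponent_split:
  fixes k :: "'m \<Rightarrow>\<^sub>0 nat"
  assumes "Poly_Mapping.lookup k i \<noteq> 0"
  shows "k = Poly_Mapping.single i 1 + (k - Poly_Mapping.single i 1)"
  using assms by (intro poly_mapping_eqI) (auto simp: lookup_add lookup_minus lookup_single when_def)

lemma cpoly_single_induct [case_names single add]:
  fixes p :: "'m cpoly"
  assumes "\<And>k c. P (Poly_Mapping.single k c)" "\<And>p q. P p \<Longrightarrow> P q \<Longrightarrow> P (p + q)"
  shows "P p"
proof -
  have "P 0" using assms(1)[of 0 0] by simp
  then have "P (\<Sum>k\<in>X. Poly_Mapping.single k (c k))" for X c
    by (induction X rule: infinite_finite_induct) (use assms in auto)
  then show ?thesis by (subst cpoly_eq_sum_single)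
qed

lemma cpoly_induct [case_names Const add Var]:
  fixes p :: "'m::finite cpoly"
  assumes "\<And>c. P (Const c)" "\<And>p q. P p \<Longrightarrow> P q \<Longrightarrow> P (p + q)" "\<And>i p. P p \<Longrightarrow> P (Var i * p)"
  shows "P p"
proof (induction p rule: cpoly_single_induct)
  case (single k c)
  show ?case
  proof (induction "mdeg k" arbitrary: k)
    case 0
    then show ?case using assms(1)[of c] by (simp add: mdeg_eq_0 Const_def)
  next
    case (Suc n)
    then obtain i where i: "Poly_Mapping.lookup k i \<noteq> 0"
      unfolding mdeg_def by (metis nat.distinct(1) sum.neutral)
    have "mdeg k = Suc (mdeg (k - Poly_Mapping.single i 1))"
      by (subst exponent_split[OF i]) (simp only: mdeg_add mdeg_single)
    then have "P (Poly_Mapping.single (k - Poly_Mapping.single i 1) c)" using Suc by auto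
    then show ?case
      using assms(3)[of _ i] exponent_split[OF i] by (metis Var_single)
  qed
qed (rule assms(2))


section \<open>Homogeneous polynomials\<close>

lemma homogeneous_iff:
  "homogeneous d p \<longleftrightarrow> (\<forall>k. Poly_Mapping.lookup p k \<noteq> 0 \<longrightarrow> int (mdeg k) = d)"
  by (auto simp: homogeneous_def mdeg_def in_keys_iff)

lemma homogeneous_0 [simp]: "homogeneous d 0"
  by (simp add: homogeneous_iff)

lemma homogeneous_add: "homogeneous d p \<Longrightarrow> homogeneous d q \<Longrightarrow> homogeneous d (p + q)"
  by (auto simp: homogeneous_iff lookup_add) (metis add_0)

lemma homogeneous_uminus [simp]: "homogeneous d (- p) \<longleftrightarrow> homogeneous d p"
  by (auto simp: homogeneous_iff)

lemma homogeneous_diff: "homogeneous d p \<Longrightarrow> homogeneous d q \<Longrightarrow> homogeneous d (p - q)"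
  using homogeneous_add[of d p "- q"] by simp

lemma homogeneous_sum: "(\<And>x. x \<in> X \<Longrightarrow> homogeneous d (f x)) \<Longrightarrow> homogeneous d (sum f X)"
  by (induction X rule: infinite_finite_induct) (auto intro: homogeneous_add)

lemma homogeneous_single: "homogeneous (int (mdeg k)) (Poly_Mapping.single k c)"
  by (auto simp: homogeneous_iff lookup_single when_def)

lemma homogeneous_expand:
  "homogeneous d p \<Longrightarrow> \<exists>X c. finite X \<and> (\<forall>k\<in>X. int (mdeg k) = d) \<and>
     p = (\<Sum>k\<in>X. Poly_Mapping.single k (c k))"
  using cpoly_eq_sum_single[of p] unfolding homogeneous_iff in_keys_iff[symmetric]
  by (metis finite_keys)

lemma homogeneous_mult:
  assumes "homogeneous d p" "homogeneous e q"
  shows "homogeneous (d + e) (p * q)"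
proof -
  obtain X c where X: "\<forall>k\<in>X. int (mdeg k) = d" "p = (\<Sum>k\<in>X. Poly_Mapping.single k (c k))"
    using homogeneous_expand[OF assms(1)] by blast
  obtain Y b where Y: "\<forall>k\<in>Y. int (mdeg k) = e" "q = (\<Sum>k\<in>Y. Poly_Mapping.single k (b k))"
    using homogeneous_expand[OF assms(2)] by blast
  have "homogeneous (d + e) (Poly_Mapping.single k (c k) * Poly_Mapping.single l (b l))"
    if "k \<in> X" "l \<in> Y" for k l
    using homogeneous_single[of "k + l" "c k * b l"] X(1) Y(1) that by (simp add: mult_single mdeg_add)
  then show ?thesis unfolding X(2) Y(2) sum_product by (intro homogeneous_sum) auto
qed

lemma homogeneous_Const: "homogeneous 0 (Const c)"
  using homogeneous_single[of 0 c] by (simp add: Const_def)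

lemma homogeneous_Const_mult: "homogeneous d p \<Longrightarrow> homogeneous d (Const c * p)"
  using homogeneous_mult[OF homogeneous_Const] by force

lemma homogeneous_Var: "homogeneous 1 (Var i)"
  using homogeneous_single[of "Poly_Mapping.single i 1" 1] by (simp add: Var_def mdeg_single)

lemma homogeneous_neg: "homogeneous d p \<Longrightarrow> d < 0 \<Longrightarrow> p = 0"
  by (intro poly_mapping_eqI) (force simp: homogeneous_iff)

lemma homogeneous_0_imp_Const:
  assumes "homogeneous 0 p"
  obtains c where "p = Const c"
proof
  show "p = Const (Poly_Mapping.lookup p 0)"
    using assms by (intro poly_mapping_eqI)
      (auto simp: homogeneous_iff Const_def lookup_single when_def mdeg_eq_0)
qed

lemma finite_mdeg: "finite {k :: 'm::finite \<Rightarrow>\<^sub>0 nat. mdeg k = n}"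
proof (rule finite_imageD)
  have "Poly_Mapping.lookup k i \<le> mdeg k" for k :: "'m \<Rightarrow>\<^sub>0 nat" and i
    unfolding mdeg_def by (rule member_le_sum) auto
  then have "Poly_Mapping.lookup ` {k :: 'm \<Rightarrow>\<^sub>0 nat. mdeg k = n} \<subseteq> PiE UNIV (\<lambda>_. {..n})"
    by auto
  then show "finite (Poly_Mapping.lookup ` {k :: 'm \<Rightarrow>\<^sub>0 nat. mdeg k = n})"
    by (rule finite_subset) (intro finite_PiE, auto)
  show "inj_on Poly_Mapping.lookup {k :: 'm \<Rightarrow>\<^sub>0 nat. mdeg k = n}"
    by (auto simp: inj_on_def)
qed

text \<open>Each monomial of positive degree is divisible by a variable. This is what makes the
  modules of coefficients generated in degree 0.\<close>

lemma homogeneous_Suc_expand: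
  assumes "homogeneous (int (Suc n)) (p :: 'm::finite cpoly)"
  shows "\<exists>q. (\<forall>i. homogeneous (int n) (q i)) \<and> p = (\<Sum>i\<in>UNIV. Var i * q i)"
proof -
  let ?P = "\<lambda>p :: 'm cpoly. \<exists>q. (\<forall>i. homogeneous (int n) (q i)) \<and> p = (\<Sum>i\<in>UNIV. Var i * q i)"
  have add: "?P (p + r)" if pr: "?P p" "?P r" for p r
  proof -
    obtain q q' where "\<forall>i. homogeneous (int n) (q i)" "p = (\<Sum>i\<in>UNIV. Var i * q i)"
      "\<forall>i. homogeneous (int n) (q' i)" "r = (\<Sum>i\<in>UNIV. Var i * q' i)"
      using pr by blast
    then show ?thesis
      by (intro exI[of _ "\<lambda>i. q i + q' i"]) (auto simp: distrib_left sum.distrib homogeneous_add)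
  qed
  have zero: "?P 0" by (intro exI[of _ "\<lambda>_. 0"]) auto
  obtain X c where X: "finite X" "\<forall>k\<in>X. int (mdeg k) = int (Suc n)"
    "p = (\<Sum>k\<in>X. Poly_Mapping.single k (c k))"
    using homogeneous_expand[OF assms] by blast
  have "?P (\<Sum>k\<in>X. Poly_Mapping.single k (c k))"
    using X(1,2)
  proof (induction X rule: finite_induct)
    case empty
    then show ?case using zero by simp
  next
    case (insert k X)
    then have k: "mdeg k = Suc n" by auto
    then obtain i where i: "Poly_Mapping.lookup k i \<noteq> 0"
      unfolding mdeg_def by (metis nat.distinct(1) sum.neutral)
    let ?l = "k - Poly_Mapping.single i 1"
    have "mdeg k = Suc (mdeg ?l)"
      by (subst exponent_split[OF i]) (simp only: mdeg_add mdeg_single)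
    then have "homogeneous (int n) (Poly_Mapping.single ?l (c k))"
      using homogeneous_single[of ?l "c k"] k by simp
    moreover have "Poly_Mapping.single k (c k) =
        (\<Sum>j\<in>UNIV. Var j * (if j = i then Poly_Mapping.single ?l (c k) else 0))"
      using exponent_split[OF i] by (simp add: if_distrib[of "\<lambda>x. _ * x"] Var_single cong: if_cong)
    ultimately have "?P (Poly_Mapping.single k (c k))"
      by (intro exI[of _ "\<lambda>j. if j = i then Poly_Mapping.single ?l (c k) else 0"]) auto
    then show ?case using insert add by auto
  qed
  then show ?thesis using X(3) by simp
qed

definition hom_comp :: "nat \<Rightarrow> 'm::finite cpoly \<Rightarrow> 'm cpoly" where
  "hom_comp d p = (\<Sum>k\<in>Poly_Mapping.keys p. Poly_Mapping.single k (if mdeg k = d then Poly_Mapping.lookup p k else 0))"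

lemma lookup_hom_comp:
  "Poly_Mapping.lookup (hom_comp d p) k = (if mdeg k = d then Poly_Mapping.lookup p k else 0)"
  by (auto simp: hom_comp_def lookup_sum lookup_single when_def in_keys_iff)

lemma hom_comp_add: "hom_comp d (p + q) = hom_comp d p + hom_comp d q"
  by (intro poly_mapping_eqI) (simp add: lookup_hom_comp lookup_add)

lemma hom_comp_0 [simp]: "hom_comp d 0 = 0"
  by (intro poly_mapping_eqI) (simp add: lookup_hom_comp)

lemma hom_comp_sum: "hom_comp d (sum f X) = (\<Sum>x\<in>X. hom_comp d (f x))"
  by (induction X rule: infinite_finite_induct) (simp_all add: hom_comp_add)

lemma hom_comp_single:
  "hom_comp d (Poly_Mapping.single k c) = (if mdeg k = d then Poly_Mapping.single k c else 0)"
  by (intro poly_mapping_eqI) (simp add: lookup_hom_comp lookup_single when_def)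

lemma hom_comp_Const_mult: "hom_comp d (Const c * p) = Const c * hom_comp d p"
proof (induction p rule: cpoly_single_induct)
  case (single k e)
  then show ?case by (simp add: hom_comp_single single_Const[symmetric])
qed (simp add: hom_comp_add distrib_left)

lemma hom_comp_Suc_Var: "hom_comp (Suc d) (Var i * p) = Var i * hom_comp d p"
proof (induction p rule: cpoly_single_induct)
  case (single k e)
  then show ?case by (simp add: hom_comp_single Var_single mdeg_add mdeg_single)
qed (simp add: hom_comp_add distrib_left)

lemma hom_comp_0_Var: "hom_comp 0 (Var i * p) = 0"
proof (induction p rule: cpoly_single_induct)
  case (single k e)
  then show ?case by (simp add: hom_comp_single Var_single mdeg_add mdeg_single)
qed (simp add: hom_comp_add distrib_left)

lemma homogeneous_iff_hom_comp:
  "homogeneous (int d) p \<longleftrightarrow> (\<forall>e. e \<noteq> d \<longrightarrow> hom_comp e p = 0)"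
proof
  assume "homogeneous (int d) p"
  then show "\<forall>e. e \<noteq> d \<longrightarrow> hom_comp e p = 0"
    by (auto intro!: poly_mapping_eqI simp: lookup_hom_comp homogeneous_iff)
next
  assume *: "\<forall>e. e \<noteq> d \<longrightarrow> hom_comp e p = 0"
  show "homogeneous (int d) p"
    unfolding homogeneous_iff
  proof (intro allI impI)
    fix k assume "Poly_Mapping.lookup p k \<noteq> 0"
    then have "hom_comp (mdeg k) p \<noteq> 0"
      using lookup_hom_comp[of "mdeg k" p k] by auto
    then show "int (mdeg k) = int d" using * by auto
  qed
qed


section \<open>Linear forms\<close>

definition lform :: "complex ^ 'm::finite \<Rightarrow> 'm cpoly" where
  "lform a = (\<Sum>j\<in>UNIV. Const (a $ j) * Var j)"

lemma linear_form_eq: "linear_form A i = lform (A i)"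
  by (simp add: linear_form_def lform_def)

lemma lform_mult: "lform a * p = (\<Sum>j\<in>UNIV. Const (a $ j) * (Var j * p))"
  by (simp add: lform_def sum_distrib_right mult.assoc)

lemma lookup_lform: "Poly_Mapping.lookup (lform a) (Poly_Mapping.single i 1) = a $ i"
proof -
  have "lform a = (\<Sum>j\<in>UNIV. Poly_Mapping.single (Poly_Mapping.single j 1) (a $ j))"
    by (simp add: lform_def Const_def Var_def mult_single)
  moreover have "Poly_Mapping.single j (1::nat) = Poly_Mapping.single i 1 \<longleftrightarrow> j = i" for j
    by (metis lookup_single_eq lookup_single_not_eq zero_neq_one)
  ultimately show ?thesis by (simp add: lookup_sum lookup_single when_def)
qed

lemma lform_inject: "lform a = lform b \<longleftrightarrow> a = b"
  by (metis lookup_lform vec_eq_iff)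

lemma lform_0 [simp]: "lform 0 = 0"
  by (simp add: lform_def)

lemma lform_eq_0 [simp]: "lform a = 0 \<longleftrightarrow> a = 0"
  using lform_inject[of a 0] by simp

lemma lform_scale: "lform (c *s a) = Const c * lform a"
  by (simp add: lform_def Const_mult sum_distrib_left mult.assoc)

lemma lform_sum: "lform (sum a X) = (\<Sum>x\<in>X. lform (a x))"
  by (simp add: lform_def Const_sum sum_distrib_right) (rule sum.swap)

lemma lform_axis: "lform (axis i 1) = Var i"
proof -
  have "Const (axis i 1 $ j) * Var j = (if j = i then Var i else 0)" for j
    by (simp add: axis_def)
  then show ?thesis by (simp add: lform_def)
qed

lemma homogeneous_lform: "homogeneous 1 (lform a)"
  unfolding lform_def by (intro homogeneous_sum homogeneous_Const_mult homogeneous_Var)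

lemma homogeneous_lform_mult: "homogeneous (int k) p \<Longrightarrow> homogeneous (int (Suc k)) (lform a * p)"
  using homogeneous_mult[OF homogeneous_lform, of "int k" p a] by (simp add: add.commute)

lemma hom_comp_Suc_lform: "hom_comp (Suc d) (lform a * p) = lform a * hom_comp d p"
  by (simp add: lform_mult hom_comp_sum hom_comp_Const_mult hom_comp_Suc_Var)

lemma hom_comp_0_lform: "hom_comp 0 (lform a * p) = 0"
  by (simp add: lform_mult hom_comp_sum hom_comp_Const_mult hom_comp_0_Var)

text \<open>Multiplication by \<open>lform a\<close> is injective and shifts homogeneous components
  by one, so it cannot hide a component of the wrong degree.\<close>

lemma homogeneous_lform_cancel:
  fixes p :: "'m::{finite,linorder} cpoly"
  assumes "homogeneous (int (Suc k)) (lform a * p)" "a \<noteq> 0"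
  shows "homogeneous (int k) p"
  unfolding homogeneous_iff_hom_comp
proof (intro allI impI)
  fix e assume "e \<noteq> k"
  then have "hom_comp (Suc e) (lform a * p) = 0"
    using assms(1) unfolding homogeneous_iff_hom_comp by auto
  then show "hom_comp e p = 0" using assms(2) by (simp add: hom_comp_Suc_lform)
qed

text \<open>A multiple of a linear form has no constant term.\<close>

lemma homogeneous_0_lform_dvd:
  assumes "homogeneous 0 (lform a * p)"
  shows "lform a * p = 0"
proof (rule poly_mapping_eqI)
  fix k
  show "Poly_Mapping.lookup (lform a * p) k = Poly_Mapping.lookup 0 k"
    using lookup_hom_comp[of 0 "lform a * p" k] assms hom_comp_0_lform[of a p]
    by (auto simp: homogeneous_iff split: if_splits)
qed

lemma lform_dvd_lform:
  fixes a b :: "complex ^ 'm::{finite,linorder}"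
  assumes "lform a dvd lform b" "a \<noteq> 0"
  obtains c where "b = c *s a"
proof -
  obtain q where q: "lform b = lform a * q" using assms(1) by (auto simp: dvd_def)
  then have "homogeneous (int (Suc 0)) (lform a * q)" using homogeneous_lform[of b] by simp
  then have "homogeneous 0 q" using homogeneous_lform_cancel[of 0 a q] assms(2) by simp
  then obtain c where "q = Const c" by (rule homogeneous_0_imp_Const)
  then have "lform b = lform (c *s a)" using q by (simp add: lform_scale mult.commute)
  then show ?thesis using that[of c] by (simp only: lform_inject)
qed

definition substitute :: "('m::finite \<Rightarrow> 'm cpoly) \<Rightarrow> 'm cpoly \<Rightarrow> 'm cpoly" where
  "substitute s p = (\<Sum>k\<in>Poly_Mapping.keys p.
     Const (Poly_Mapping.lookup p k) * (\<Prod>i\<in>UNIV. s i ^ Poly_Mapping.lookup k i))"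

lemma substitute_superset:
  assumes "finite X" "Poly_Mapping.keys p \<subseteq> X"
  shows "substitute s p = (\<Sum>k\<in>X.
     Const (Poly_Mapping.lookup p k) * (\<Prod>i\<in>UNIV. s i ^ Poly_Mapping.lookup k i))"
  unfolding substitute_def using assms
  by (intro sum.mono_neutral_left) (auto simp: in_keys_iff)

lemma substitute_add: "substitute s (p + q) = substitute s p + substitute s q"
proof -
  let ?X = "Poly_Mapping.keys p \<union> Poly_Mapping.keys q"
  have "Poly_Mapping.keys (p + q) \<subseteq> ?X" by (rule Poly_Mapping.keys_add)
  then show ?thesis
    by (simp add: substitute_superset[of ?X] lookup_add Const_add distrib_right sum.distrib)
qed

lemma substitute_single:
  "substitute s (Poly_Mapping.single k c) = Const c * (\<Prod>i\<in>UNIV. s i ^ Poly_Mapping.lookup k i)"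
  by (simp add: substitute_superset[of "{k}"])

lemma substitute_mult: "substitute s (p * q) = substitute s p * substitute s q"
proof (induction p rule: cpoly_single_induct)
  case (single k c)
  show ?case
  proof (induction q rule: cpoly_single_induct)
    case (single l d)
    show ?case
      by (simp add: mult_single substitute_single lookup_add power_add prod.distrib Const_mult)
  qed (simp add: substitute_add distrib_left)
qed (simp add: substitute_add distrib_right)

lemma substitute_Const: "substitute s (Const c) = Const c"
  using substitute_single[of s 0 c] by (simp add: Const_def)

lemma substitute_Var: "substitute s (Var i) = s i"
proof -
  have "(\<Prod>j\<in>UNIV. s j ^ Poly_Mapping.lookup (Poly_Mapping.single i 1) j) = (\<Prod>j\<in>UNIV. if j = i then s i else 1)"
    by (intro prod.cong) (auto simp: lookup_single when_def)
  then show ?thesis unfolding Var_def substitute_single by simp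
qed

lemma substitute_sum: "substitute s (sum f X) = (\<Sum>x\<in>X. substitute s (f x))"
  by (induction X rule: infinite_finite_induct)
    (simp_all add: substitute_add substitute_Const[of s 0, simplified])

text \<open>Solving \<open>lform a = 0\<close> for a variable gives a retraction of the polynomial ring with kernel
  generated by \<open>lform a\<close>.\<close>

lemma prime_lform:
  fixes p q :: "'m::{finite,linorder} cpoly"
  assumes a: "a \<noteq> 0" and dvd: "lform a dvd p * q"
  shows "lform a dvd p \<or> lform a dvd q"
proof -
  obtain j where j: "a $ j \<noteq> 0" using a by (auto simp: vec_eq_iff)
  \<comment> \<open>The factor \<open>1 / a $ j\<close> makes the substitution kill
    \<open>lform a\<close>, while each variable changes only by a multiple of
    \<open>lform a\<close>.\<close>
  define s where "s i = (if i = j then Var j - Const (1 / a $ j) * lform a else Var i)" for i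
  have s: "lform a dvd Var i - s i" for i by (simp add: s_def)
  have dvd_diff_subst: "lform a dvd r - substitute s r" for r
  proof (induction r rule: cpoly_induct)
    case (Const c)
    then show ?case by (simp add: substitute_Const)
  next
    case (add r t)
    then have "lform a dvd (r - substitute s r) + (t - substitute s t)" by (rule dvd_add)
    then show ?case by (simp add: substitute_add algebra_simps)
  next
    case (Var i r)
    have "Var i * r - substitute s (Var i * r) = (Var i - s i) * r + s i * (r - substitute s r)"
      by (simp add: substitute_mult substitute_Var algebra_simps)
    then show ?case using s[of i] Var by simp
  qed
  have "substitute s (lform a) = (\<Sum>i\<in>UNIV. Const (a $ i) * s i)"
    by (simp add: lform_def substitute_sum substitute_mult substitute_Const substitute_Var)
  also have "\<dots> = (\<Sum>i\<in>UNIV. Const (a $ i) * Var i - (if i = j then lform a else 0))"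
    using j by (intro sum.cong) (auto simp: s_def right_diff_distrib simp flip: Const_mult mult.assoc)
  also have "\<dots> = 0" by (simp add: sum_subtractf lform_def)
  finally have subst_lform: "substitute s (lform a) = 0" .
  obtain r where "p * q = lform a * r" using dvd by (auto simp: dvd_def)
  then have "substitute s p * substitute s q = 0"
    by (metis substitute_mult subst_lform mult_zero_left)
  then have "substitute s p = 0 \<or> substitute s q = 0" by simp
  then show ?thesis using dvd_diff_subst[of p] dvd_diff_subst[of q] by auto
qed

section \<open>Derivations, multiderivations, and the exterior product with a derivation\<close>

section \<open>Derivations\<close>

lemma derivationI:
  assumes "\<And>g h. D (g + h) = D g + D h" "\<And>c g. D (Const c * g) = Const c * D g"
    "\<And>g h. D (g * h) = D g * h + g * D h"
  shows "derivation D"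
  unfolding derivation_def using assms by blast

lemma derivation_add: "derivation D \<Longrightarrow> D (g + h) = D g + D h"
  unfolding derivation_def by blast

lemma derivation_Const_mult: "derivation D \<Longrightarrow> D (Const c * g) = Const c * D g"
  unfolding derivation_def by blast

lemma derivation_mult: "derivation D \<Longrightarrow> D (g * h) = D g * h + g * D h"
  unfolding derivation_def by blast

lemma derivation_0: "derivation D \<Longrightarrow> D 0 = 0"
  using derivation_add[of D 0 0] by simp

lemma derivation_Const: "derivation D \<Longrightarrow> D (Const c) = 0"
  using derivation_mult[of D 1 1] derivation_Const_mult[of D c 1] by simp

lemma derivation_sum: "derivation D \<Longrightarrow> D (sum f X) = (\<Sum>x\<in>X. D (f x))"
  by (induction X rule: infinite_finite_induct) (simp_all add: derivation_0 derivation_add)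

lemma derivation_lform: "derivation D \<Longrightarrow> D (lform a) = (\<Sum>j\<in>UNIV. Const (a $ j) * D (Var j))"
  by (simp add: lform_def derivation_sum derivation_Const_mult)

lemma derivation_zero: "derivation (\<lambda>g. 0)"
  by (simp add: derivation_def)

lemma derivation_plus: "derivation D \<Longrightarrow> derivation E \<Longrightarrow> derivation (\<lambda>g. D g + E g)"
  by (rule derivationI)
    (simp add: derivation_add algebra_simps,
      simp add: derivation_Const_mult distrib_left right_diff_distrib mult.left_commute,
      simp only: derivation_mult, simp add: algebra_simps)

lemma derivation_minus: "derivation D \<Longrightarrow> derivation E \<Longrightarrow> derivation (\<lambda>g. D g - E g)"
  by (rule derivationI)
    (simp add: derivation_add algebra_simps,
      simp add: derivation_Const_mult distrib_left right_diff_distrib mult.left_commute,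
      simp only: derivation_mult, simp add: algebra_simps)

lemma derivation_times: "derivation D \<Longrightarrow> derivation (\<lambda>g. r * D g)"
  by (rule derivationI)
    (simp add: derivation_add algebra_simps,
      simp add: derivation_Const_mult distrib_left right_diff_distrib mult.left_commute,
      simp only: derivation_mult, simp add: algebra_simps)

text \<open>The ring is a domain, so the three identities can be divided by \<open>r\<close>. This
  serves to divide a contraction by a linear form.\<close>

lemma derivation_cancel:
  fixes r :: "'m::{finite,linorder} cpoly"
  assumes "derivation (\<lambda>g. r * D g)" "r \<noteq> 0"
  shows "derivation D"
proof -
  have "r * D (g + h) = r * (D g + D h)" "r * D (Const c * g) = r * (Const c * D g)"
    "r * D (g * h) = r * (D g * h + g * D h)" for g h c
    using derivation_add[OF assms(1), of g h] derivation_Const_mult[OF assms(1), of c g]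
      derivation_mult[OF assms(1), of g h]
    by (simp_all add: algebra_simps)
  then have "D (g + h) = D g + D h" "D (Const c * g) = Const c * D g"
    "D (g * h) = D g * h + g * D h" for g h c
    using assms(2) by (metis mult_cancel_left)+
  then show ?thesis by (rule derivationI)
qed

lemma derivation_eq_0:
  fixes D :: "'m::finite cpoly \<Rightarrow> 'm cpoly"
  assumes "derivation D" "\<And>i. D (Var i) = 0"
  shows "D g = 0"
  by (induction g rule: cpoly_induct)
    (simp_all add: assms derivation_Const derivation_add derivation_mult)

definition vector_field :: "('m \<Rightarrow> 'm cpoly) \<Rightarrow> 'm::finite cpoly \<Rightarrow> 'm cpoly" where
  "vector_field c g = (\<Sum>i\<in>UNIV. c i * partial_deriv i g)"

lemma partial_deriv_Const_mult: "partial_deriv i (Const c * g) = Const c * partial_deriv i g"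
  by (simp add: partial_deriv_mult Const_def partial_deriv_single)

lemma derivation_vector_field: "derivation (vector_field c)"
  unfolding vector_field_def
  by (rule derivationI)
    (simp add: partial_deriv_add algebra_simps sum.distrib,
      simp add: partial_deriv_Const_mult sum_distrib_left mult.left_commute,
      simp only: partial_deriv_mult, simp add: algebra_simps sum.distrib sum_distrib_left)

lemma vector_field_Var: "vector_field c (Var i) = c i"
proof -
  have "partial_deriv j (Var i) = (if j = i then 1 else 0)" for j
    by (auto simp: Var_def partial_deriv_single lookup_single when_def)
  then show ?thesis by (simp add: vector_field_def if_distrib[of "\<lambda>x. _ * x"] cong: if_cong)
qed

lemma vector_field_lform: "vector_field c (lform a) = (\<Sum>j\<in>UNIV. Const (a $ j) * c j)"
  by (simp add: derivation_lform[OF derivation_vector_field] vector_field_Var)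


section \<open>Multiderivations\<close>

text \<open>Recursion on the contraction with the first argument, where only the exchange of the
  first two arguments is demanded. It opens the way to induction on \<open>p\<close>;
  \<open>multiderivation_iff\<close> proves the agreement with
  \<open>multiderivation\<close>.\<close>

primrec multider :: "nat \<Rightarrow> ('m cpoly list \<Rightarrow> 'm cpoly) \<Rightarrow> bool" where
  "multider 0 \<theta> \<longleftrightarrow> (\<forall>gs. gs \<noteq> [] \<longrightarrow> \<theta> gs = 0)"
| "multider (Suc p) \<theta> \<longleftrightarrow> \<theta> [] = 0 \<and> (\<forall>g. multider p (\<lambda>gs. \<theta> (g # gs))) \<and>
     (\<forall>gs. derivation (\<lambda>g. \<theta> (g # gs))) \<and> (\<forall>g h gs. \<theta> (g # h # gs) = - \<theta> (h # g # gs))"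

declare multider.simps(2) [simp del]

lemma multider_SucI:
  assumes "\<theta> [] = 0" "\<And>g. multider p (\<lambda>gs. \<theta> (g # gs))"
    "\<And>gs. derivation (\<lambda>g. \<theta> (g # gs))" "\<And>g h gs. \<theta> (g # h # gs) = - \<theta> (h # g # gs)"
  shows "multider (Suc p) \<theta>"
  unfolding multider.simps(2) using assms by blast

lemma multider_Nil: "multider (Suc p) \<theta> \<Longrightarrow> \<theta> [] = 0"
  unfolding multider.simps(2) by blast

lemma multider_contract: "multider (Suc p) \<theta> \<Longrightarrow> multider p (\<lambda>gs. \<theta> (g # gs))"
  unfolding multider.simps(2) by blast

lemma multider_swap: "multider p \<theta> \<Longrightarrow> \<theta> (g # h # gs) = - \<theta> (h # g # gs)"
proof (cases p)
  case (Suc q)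
  assume "multider p \<theta>"
  then show ?thesis unfolding Suc multider.simps(2) by blast
qed simp

lemma multider_head: "multider p \<theta> \<Longrightarrow> derivation (\<lambda>g. \<theta> (g # gs))"
proof (cases p)
  case (Suc q)
  assume "multider p \<theta>"
  then show ?thesis unfolding Suc multider.simps(2) by blast
qed (simp add: derivation_zero)

lemma multiderivation_imp_multider:
  fixes \<theta> :: "'a cpoly list \<Rightarrow> 'a cpoly"
  shows "multiderivation p \<theta> \<Longrightarrow> multider p \<theta>"
proof (induction p arbitrary: \<theta>)
  case 0
  then show ?case by (simp add: multiderivation_def)
next
  case (Suc p)
  have len: "\<theta> gs = 0" if "length gs \<noteq> Suc p" for gs
    using Suc.prems that by (simp add: multiderivation_def)
  have der: "derivation (\<lambda>g. \<theta> (gs[i := g]))" if "length gs = Suc p" "i < Suc p" for gs i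
    using Suc.prems that by (simp add: multiderivation_def)
  have alt: "\<theta> (gs[i := gs ! j, j := gs ! i]) = - \<theta> gs" if "length gs = Suc p" "i < j" "j < Suc p" for gs i j
    using Suc.prems that unfolding multiderivation_def by blast
  have contract: "multiderivation p (\<lambda>hs. \<theta> (g # hs))" for g
    unfolding multiderivation_def
  proof (intro conjI allI impI)
    fix gs :: "'a cpoly list" and i j assume *: "length gs = p" "i < j" "j < p"
    then show "\<theta> (g # gs[i := gs ! j, j := gs ! i]) = - \<theta> (g # gs)"
      using alt[of "g # gs" "Suc i" "Suc j"] by simp
  next
    fix gs :: "'a cpoly list" and i assume "length gs = p" "i < p"
    then show "derivation (\<lambda>h. \<theta> (g # gs[i := h]))"
      using der[of "g # gs" "Suc i"] by simp
  next
    fix gs :: "'a cpoly list" assume "length gs \<noteq> p"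
    then show "\<theta> (g # gs) = 0" by (intro len) simp
  qed
  have head: "derivation (\<lambda>g. \<theta> (g # gs))" for gs
    using der[of "undefined # gs" 0] by (cases "length gs = p") (simp_all add: len derivation_zero)
  have swap: "\<theta> (g # h # gs) = - \<theta> (h # g # gs)" for g h gs
    using alt[of "h # g # gs" 0 1] by (cases "Suc (length gs) = p") (simp_all add: len)
  show ?case
    by (rule multider_SucI[OF _ Suc.IH[OF contract] head swap]) (simp add: len)
qed

lemma multider_imp_multiderivation:
  fixes \<theta> :: "'a cpoly list \<Rightarrow> 'a cpoly"
  shows "multider p \<theta> \<Longrightarrow> multiderivation p \<theta>"
proof (induction p arbitrary: \<theta>)
  case 0
  then show ?case by (simp add: multiderivation_def)
next
  case (Suc p)
  have IH: "multiderivation p (\<lambda>hs. \<theta> (g # hs))" for g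
    using Suc.prems by (intro Suc.IH multider_contract)
  have len: "\<theta> (g # gs) = 0" if "length gs \<noteq> p" for g gs
    using IH[of g] that by (simp add: multiderivation_def)
  have der: "derivation (\<lambda>h. \<theta> (g # gs[i := h]))" if "length gs = p" "i < p" for g gs i
    using IH[of g] that by (simp add: multiderivation_def)
  have alt: "\<theta> (g # gs[i := gs ! j, j := gs ! i]) = - \<theta> (g # gs)"
    if "length gs = p" "i < j" "j < p" for g gs i j
    using IH[of g] that unfolding multiderivation_def by blast
  note swap = multider_swap[OF Suc.prems]
  show ?case
    unfolding multiderivation_def
  proof (intro conjI allI impI)
    fix gs :: "'a cpoly list" assume "length gs \<noteq> Suc p"
    then show "\<theta> gs = 0" using multider_Nil[OF Suc.prems] len by (cases gs) auto
  next
    fix gs :: "'a cpoly list" and i assume "length gs = Suc p" "i < Suc p"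
    then show "derivation (\<lambda>h. \<theta> (gs[i := h]))"
      using multider_head[OF Suc.prems] der by (cases gs; cases i) auto
  next
    fix gs :: "'a cpoly list" and i j assume *: "length gs = Suc p" "i < j" "j < Suc p"
    then obtain g gs' j' where g: "gs = g # gs'" "j = Suc j'" "length gs' = p" "j' < p"
      by (cases gs; cases j) auto
    show "\<theta> (gs[i := gs ! j, j := gs ! i]) = - \<theta> gs"
    proof (cases i)
      case (Suc i')
      then show ?thesis using alt[of gs' i' j' g] g * by simp
    next
      case 0
      obtain h hs where h: "gs' = h # hs" using g by (cases gs') auto
      show ?thesis
      proof (cases j')
        case 0
        then show ?thesis using \<open>i = 0\<close> g h swap[of h g hs] by simp
      next
        case (Suc l)
        \<comment> \<open>The exchange of the positions 0 and \<open>j\<close> is composed of the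
          exchanges (0 1), (1 j), (0 1); the middle one takes place inside a contraction.\<close>
        have "\<theta> ((hs ! l) # h # hs[l := g]) = - \<theta> (h # (hs ! l) # hs[l := g])" by (rule swap)
        also have "\<dots> = \<theta> (h # g # hs)" using alt[of "g # hs" 0 j' h] g h Suc by simp
        also have "\<dots> = - \<theta> (g # h # hs)" by (rule swap)
        finally show ?thesis using \<open>i = 0\<close> g h Suc by simp
      qed
    qed
  qed
qed

lemma multiderivation_iff: "multiderivation p \<theta> \<longleftrightarrow> multider p \<theta>"
  using multiderivation_imp_multider multider_imp_multiderivation by blast

lemma multider_zero: "multider p (\<lambda>gs. 0)"
  by (induction p) (auto simp: derivation_zero intro!: multider_SucI)

lemma multider_plus: "multider p \<theta> \<Longrightarrow> multider p \<eta> \<Longrightarrow> multider p (\<lambda>gs. \<theta> gs + \<eta> gs)"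
proof (induction p arbitrary: \<theta> \<eta>)
  case (Suc p)
  note prems = Suc.prems
  show ?case
  proof (rule multider_SucI)
    show "\<theta> (g # h # gs) + \<eta> (g # h # gs) = - (\<theta> (h # g # gs) + \<eta> (h # g # gs))" for g h gs
      using multider_swap[OF prems(1), of g h gs] multider_swap[OF prems(2), of g h gs] by simp
    show "multider p (\<lambda>gs. \<theta> (g # gs) + \<eta> (g # gs))" for g
      by (intro Suc.IH multider_contract[OF prems(1)] multider_contract[OF prems(2)])
    show "derivation (\<lambda>g. \<theta> (g # gs) + \<eta> (g # gs))" for gs
      by (intro derivation_plus multider_head[OF prems(1)] multider_head[OF prems(2)])
  qed (simp add: multider_Nil[OF prems(1)] multider_Nil[OF prems(2)])
qed auto

lemma multider_times: "multider p \<theta> \<Longrightarrow> multider p (\<lambda>gs. r * \<theta> gs)"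
proof (induction p arbitrary: \<theta>)
  case (Suc p)
  note prems = Suc.prems
  show ?case
  proof (rule multider_SucI)
    show "r * \<theta> (g # h # gs) = - (r * \<theta> (h # g # gs))" for g h gs
      using multider_swap[OF prems, of g h gs] by simp
    show "multider p (\<lambda>gs. r * \<theta> (g # gs))" for g
      using prems by (intro Suc.IH) (rule multider_contract)
    show "derivation (\<lambda>g. r * \<theta> (g # gs))" for gs
      using prems by (intro derivation_times) (rule multider_head)
  qed (simp add: multider_Nil[OF prems])
qed auto

lemma multider_diff: "multider p \<theta> \<Longrightarrow> multider p \<eta> \<Longrightarrow> multider p (\<lambda>gs. \<theta> gs - \<eta> gs)"
  using multider_plus[of p \<theta> "\<lambda>gs. - 1 * \<eta> gs"] multider_times[of p \<eta> "- 1"] by simp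

lemma multider_repeat: "multider p \<theta> \<Longrightarrow> \<theta> (g # g # gs) = 0"
proof -
  assume "multider p \<theta>"
  then have "\<theta> (g # g # gs) = - \<theta> (g # g # gs)" by (rule multider_swap)
  then have "Poly_Mapping.lookup (\<theta> (g # g # gs)) k = - Poly_Mapping.lookup (\<theta> (g # g # gs)) k" for k
    by (metis lookup_uminus)
  then show ?thesis by (intro poly_mapping_eqI) simp
qed

lemma multider_length: "multider p \<theta> \<Longrightarrow> length gs \<noteq> p \<Longrightarrow> \<theta> gs = 0"
  using multider_imp_multiderivation[of p \<theta>] by (simp add: multiderivation_def)

lemma multider_cancel:
  fixes r :: "'m::{finite,linorder} cpoly"
  assumes "multider p (\<lambda>gs. r * \<theta> gs)" "r \<noteq> 0"
  shows "multider p \<theta>"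
  using assms(1)
proof (induction p arbitrary: \<theta>)
  case 0
  then show ?case using assms(2) by simp
next
  case (Suc p)
  have contract: "multider p (\<lambda>gs. \<theta> (g # gs))" for g
    by (rule Suc.IH) (rule multider_contract[OF Suc.prems])
  have head: "derivation (\<lambda>g. \<theta> (g # gs))" for gs
    using multider_head[OF Suc.prems] assms(2) by (rule derivation_cancel)
  have swap: "r * \<theta> (g # h # gs) = r * (- \<theta> (h # g # gs))" for g h gs
    using multider_swap[OF Suc.prems, of g h gs] by simp
  then have "\<theta> (g # h # gs) = - \<theta> (h # g # gs)" for g h gs using assms(2) by (metis mult_cancel_left)
  moreover have "\<theta> [] = 0" using multider_Nil[OF Suc.prems] assms(2) by simp
  ultimately show ?case using contract head by (intro multider_SucI)
qed

lemma multider_eq_0: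
  fixes \<theta> :: "'m::finite cpoly list \<Rightarrow> 'm cpoly"
  assumes "multider p \<theta>" "\<And>is. length is = p \<Longrightarrow> \<theta> (map Var is) = 0"
  shows "\<theta> gs = 0"
  using assms
proof (induction p arbitrary: \<theta> gs)
  case 0
  then show ?case by (cases gs) auto
next
  case (Suc p)
  show ?case
  proof (cases gs)
    case (Cons g hs)
    have "\<theta> (Var i # hs) = 0" for i
      using Suc.IH[of "\<lambda>gs. \<theta> (Var i # gs)" hs] multider_contract[OF Suc.prems(1)] Suc.prems(2)[of "i # _"] by auto
    then show ?thesis
      using derivation_eq_0[OF multider_head[OF Suc.prems(1)]] Cons by auto
  qed (simp add: multider_Nil[OF Suc.prems(1)])
qed

text \<open>The exterior product \<open>\<delta> \<and> \<theta>\<close> with a derivation, expanded along the first argument.\<close>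

fun wedge_der :: "('m cpoly \<Rightarrow> 'm cpoly) \<Rightarrow> ('m cpoly list \<Rightarrow> 'm cpoly) \<Rightarrow> 'm cpoly list \<Rightarrow> 'm cpoly" where
  "wedge_der \<delta> \<theta> [] = 0"
| "wedge_der \<delta> \<theta> (g # gs) = \<delta> g * \<theta> gs - wedge_der \<delta> (\<lambda>hs. \<theta> (g # hs)) gs"

lemma wedge_der_zero: "wedge_der \<delta> (\<lambda>gs. 0) gs = 0"
  by (induction gs) auto

lemma wedge_der_minus: "wedge_der \<delta> (\<lambda>gs. - \<theta> gs) gs = - wedge_der \<delta> \<theta> gs"
  by (induction gs arbitrary: \<theta>) auto

lemma wedge_der_dvd: "(\<And>hs. f dvd \<theta> hs) \<Longrightarrow> f dvd wedge_der \<delta> \<theta> gs"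
  by (induction gs arbitrary: \<theta>) (auto intro!: dvd_diff)

text \<open>Formulated for a family \<open>\<Theta>\<close>, since the recursion of
  \<open>wedge_der\<close> moves arguments into it.\<close>

lemma derivation_wedge_der:
  "(\<And>hs. derivation (\<lambda>g. \<Theta> g hs)) \<Longrightarrow> derivation (\<lambda>g. wedge_der \<delta> (\<Theta> g) gs)"
proof (induction gs arbitrary: \<Theta>)
  case (Cons h gs)
  have "derivation (\<lambda>g. wedge_der \<delta> (\<lambda>hs. \<Theta> g (h # hs)) gs)"
    using Cons.prems by (intro Cons.IH)
  then show ?case using Cons.prems by (auto intro!: derivation_minus derivation_times)
qed (simp add: derivation_zero)

lemma derivation_times_right: "derivation D \<Longrightarrow> derivation (\<lambda>g. D g * r)"
  using derivation_times[of D r] by (simp add: mult.commute)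

lemma multider_wedge_der:
  assumes "derivation \<delta>" "multider p \<theta>"
  shows "multider (Suc p) (wedge_der \<delta> \<theta>)"
  using assms(2)
proof (induction p arbitrary: \<theta>)
  case 0
  then have *: "wedge_der \<delta> \<theta> (g # gs) = \<delta> g * \<theta> gs" for g gs by (simp add: wedge_der_zero)
  show ?case
    using 0 assms(1) by (intro multider_SucI) (auto simp: * simp del: wedge_der.simps(2) intro: derivation_times_right)
next
  case (Suc p)
  have contract: "multider (Suc p) (\<lambda>gs. wedge_der \<delta> \<theta> (g # gs))" for g
    unfolding wedge_der.simps
    by (intro multider_diff multider_times Suc.IH multider_contract Suc.prems)
  have head: "derivation (\<lambda>g. wedge_der \<delta> \<theta> (g # gs))" for gs
    unfolding wedge_der.simps
    by (intro derivation_minus derivation_times_right derivation_wedge_der assms(1)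
        multider_head[OF Suc.prems])
  have swap: "wedge_der \<delta> \<theta> (g # h # gs) = - wedge_der \<delta> \<theta> (h # g # gs)" for g h gs
  proof -
    have "(\<lambda>hs. \<theta> (g # h # hs)) = (\<lambda>hs. - \<theta> (h # g # hs))"
      using multider_swap[OF Suc.prems, of g h] by (intro ext)
    then have "wedge_der \<delta> (\<lambda>hs. \<theta> (g # h # hs)) gs = - wedge_der \<delta> (\<lambda>hs. \<theta> (h # g # hs)) gs"
      by (simp only: wedge_der_minus)
    then show ?thesis by simp
  qed
  show ?case by (rule multider_SucI[OF _ contract head swap]) simp
qed


section \<open>The logarithmic condition, one hyperplane at a time\<close>

section \<open>Logarithmic multiderivations of subarrangements\<close>

text \<open>Testing each hyperplane separately makes sense for every subset \<open>J\<close>, and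
  enlarging \<open>J\<close> merely adds conditions.\<close>

definition log_multider ::
    "('n \<Rightarrow> complex ^ 'm::finite) \<Rightarrow> 'n set \<Rightarrow> nat \<Rightarrow> ('m cpoly list \<Rightarrow> 'm cpoly) set" where
  "log_multider A J p = {\<theta>. multider p \<theta> \<and> (\<forall>i\<in>J. \<forall>gs. lform (A i) dvd \<theta> (lform (A i) # gs))}"

lemma hyperplane_scale: "c \<noteq> 0 \<Longrightarrow> A j = c *s A i \<Longrightarrow> hyperplane A j = hyperplane A i"
proof -
  assume *: "c \<noteq> 0" "A j = c *s A i"
  have "(\<Sum>k\<in>UNIV. A j $ k * v $ k) = c * (\<Sum>k\<in>UNIV. A i $ k * v $ k)" for v
    unfolding *(2) by (simp add: sum_distrib_left mult.assoc)
  then show ?thesis using *(1) by (simp add: hyperplane_def)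
qed

lemma central_lform_dvd:
  fixes A :: "'n \<Rightarrow> complex ^ 'm::{finite,linorder}"
  assumes "central_arrangement A" "lform (A i) dvd lform (A j)"
  shows "i = j"
proof -
  have nz: "A i \<noteq> 0" "A j \<noteq> 0" using assms(1) by (auto simp: central_arrangement_def)
  obtain c where c: "A j = c *s A i" using lform_dvd_lform[OF assms(2) nz(1)] by blast
  then have "hyperplane A j = hyperplane A i" using nz by (intro hyperplane_scale[of c]) auto
  then show ?thesis using assms(1) by (auto simp: central_arrangement_def inj_def)
qed

lemma derivation_prod:
  assumes "derivation D" "finite X"
  shows "D (\<Prod>i\<in>X. f i) = (\<Sum>i\<in>X. D (f i) * (\<Prod>j\<in>X - {i}. f j))"
  using assms(2)
proof (induction X rule: finite_induct)
  case empty
  then show ?case using derivation_Const[OF assms(1), of 1] by simp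
next
  case (insert x X)
  have "(\<Sum>i\<in>X. D (f i) * (\<Prod>j\<in>insert x X - {i}. f j)) = (\<Sum>i\<in>X. D (f i) * (f x * (\<Prod>j\<in>X - {i}. f j)))"
  proof (rule sum.cong)
    fix i assume "i \<in> X"
    then have "insert x X - {i} = insert x (X - {i})" using insert by auto
    then show "D (f i) * (\<Prod>j\<in>insert x X - {i}. f j) = D (f i) * (f x * (\<Prod>j\<in>X - {i}. f j))"
      using insert by simp
  qed simp
  moreover have "insert x X - {x} = X" using insert by auto
  ultimately show ?case
    using insert by (simp add: derivation_mult[OF assms(1)] sum_distrib_left mult.left_commute)
qed

lemma prime_lform_prod:
  fixes A :: "'n \<Rightarrow> complex ^ 'm::{finite,linorder}"
  assumes "central_arrangement A" "finite X" "i \<notin> X" "lform (A i) dvd r * (\<Prod>j\<in>X. lform (A j))"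
  shows "lform (A i) dvd r"
  using assms(2-4)
proof (induction X arbitrary: r rule: finite_induct)
  case (insert x X)
  have "A i \<noteq> 0" using assms(1) by (simp add: central_arrangement_def)
  have dvd: "lform (A i) dvd (r * lform (A x)) * (\<Prod>j\<in>X. lform (A j))"
    using insert.prems(2) unfolding prod.insert[OF insert.hyps(1,2)] mult.assoc .
  have "i \<notin> X" "i \<noteq> x" using insert.prems(1) by blast+
  have "lform (A i) dvd r * lform (A x)" by (rule insert.IH[OF \<open>i \<notin> X\<close> dvd])
  then have "lform (A i) dvd r \<or> lform (A i) dvd lform (A x)"
    by (rule prime_lform[OF \<open>A i \<noteq> 0\<close>])
  then show ?case using central_lform_dvd[OF assms(1), of i x] \<open>i \<noteq> x\<close> by blast
qed simp

text \<open>By the Leibniz rule \<open>D f\<close> is the sum of the \<open>D f\<^sub>i\<close>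
  times \<open>f / f\<^sub>i\<close>. Modulo \<open>f\<^sub>i\<close> only the term of index
  \<open>i\<close> survives, and the prime \<open>f\<^sub>i\<close> does not divide
  \<open>f / f\<^sub>i\<close> because the hyperplanes are distinct.\<close>

lemma log_derivations_eq:
  fixes A :: "'n::finite \<Rightarrow> complex ^ 'm::{finite,linorder}"
  assumes "central_arrangement A"
  shows "log_derivations A p = log_multider A UNIV p"
proof -
  let ?L = "\<lambda>i. lform (A i)"
  have f: "defining_poly A = (\<Prod>i\<in>UNIV. ?L i)" by (simp add: defining_poly_def linear_form_eq)
  have iff: "defining_poly A dvd \<theta> (defining_poly A # gs) \<longleftrightarrow> (\<forall>i. ?L i dvd \<theta> (?L i # gs))"
    if \<theta>: "multider p \<theta>" for \<theta> gs
  proof -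
    let ?D = "\<lambda>g. \<theta> (g # gs)"
    have D: "derivation ?D" by (rule multider_head[OF \<theta>])
    have eq: "?D (\<Prod>i\<in>UNIV. ?L i) = (\<Sum>i\<in>UNIV. ?D (?L i) * (\<Prod>j\<in>UNIV - {i}. ?L j))"
      by (rule derivation_prod[OF D]) simp
    show ?thesis
    proof (intro iffI allI)
      fix i
      assume "defining_poly A dvd ?D (defining_poly A)"
      moreover have "?L i dvd defining_poly A" unfolding f by (rule dvd_prodI) auto
      ultimately have "?L i dvd ?D (defining_poly A)" by (rule dvd_trans[rotated])
      then have "?L i dvd ?D (?L i) * (\<Prod>j\<in>UNIV - {i}. ?L j)
          + (\<Sum>k\<in>UNIV - {i}. ?D (?L k) * (\<Prod>j\<in>UNIV - {k}. ?L j))"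
        unfolding f eq by (simp add: sum.remove[of UNIV i])
      moreover have "?L i dvd (\<Sum>k\<in>UNIV - {i}. ?D (?L k) * (\<Prod>j\<in>UNIV - {k}. ?L j))"
        by (intro dvd_sum dvd_mult dvd_prodI) auto
      ultimately have "?L i dvd ?D (?L i) * (\<Prod>j\<in>UNIV - {i}. ?L j)" by (simp add: dvd_add_left_iff)
      then show "?L i dvd ?D (?L i)"
        by (rule prime_lform_prod[OF assms, rotated 2]) auto
    next
      assume *: "\<forall>i. ?L i dvd ?D (?L i)"
      have "(\<Prod>j\<in>UNIV. ?L j) dvd ?D (?L i) * (\<Prod>j\<in>UNIV - {i}. ?L j)" for i
        using * by (simp add: prod.remove[of UNIV i] mult_dvd_mono)
      then show "defining_poly A dvd ?D (defining_poly A)" unfolding f eq by (intro dvd_sum)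
    qed
  qed
  have "defining_poly A dvd \<theta> (defining_poly A # gs)" if "multider p \<theta>" "Suc (length gs) \<noteq> p" for \<theta> gs
    using multider_length[OF that(1), of "_ # gs"] that(2) by simp
  then show ?thesis
    unfolding log_derivations_def log_multider_def multiderivation_iff using iff by blast
qed

section \<open>Hilbert series of graded pieces and the bound on the pole of their alternating
  sum\<close>

section \<open>Graded pieces\<close>

interpretation MD: graded_space multider_scale
  by (rule graded_space.intro, rule vector_space_multider_scale)

lemma sum_fun_at: "sum f X x = (\<Sum>i\<in>X. f i x)" for f :: "'i \<Rightarrow> 'a \<Rightarrow> 'b::comm_monoid_add"
  by (induction X rule: infinite_finite_induct) auto

lemma MD_linI:
  assumes "\<And>\<theta> \<eta>. T (\<theta> + \<eta>) = T \<theta> + T \<eta>" "\<And>c \<theta>. T (multider_scale c \<theta>) = multider_scale c (T \<theta>)"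
  shows "MD.lin T"
  unfolding Vector_Spaces.linear_iff using vector_space_multider_scale assms by blast

text \<open>The elements of degree \<open>k - p\<close> of \<open>D\<^sub>p\<close> of the subarrangement \<open>J\<close> which vanish on
  the linear forms in \<open>C\<close>; \<open>k\<close> is the degree of the coefficients.\<close>

definition log_piece ::
    "('n \<Rightarrow> complex ^ 'm::finite) \<Rightarrow> 'n set \<Rightarrow> (complex ^ 'm) set \<Rightarrow> nat \<Rightarrow> nat \<Rightarrow>
      ('m cpoly list \<Rightarrow> 'm cpoly) set" where
  "log_piece A J C p k = {\<theta> \<in> log_multider A J p.
     (\<forall>h\<in>C. \<forall>gs. \<theta> (lform h # gs) = 0) \<and>
     (\<forall>is. length is = p \<longrightarrow> homogeneous (int k) (\<theta> (map Var is)))}"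

lemma log_pieceI:
  assumes "multider p \<theta>" "\<And>i gs. i \<in> J \<Longrightarrow> lform (A i) dvd \<theta> (lform (A i) # gs)"
    "\<And>h gs. h \<in> C \<Longrightarrow> \<theta> (lform h # gs) = 0"
    "\<And>is. length is = p \<Longrightarrow> homogeneous (int k) (\<theta> (map Var is))"
  shows "\<theta> \<in> log_piece A J C p k"
  using assms by (simp add: log_piece_def log_multider_def)

lemma log_pieceD:
  assumes "\<theta> \<in> log_piece A J C p k"
  shows "multider p \<theta>" "i \<in> J \<Longrightarrow> lform (A i) dvd \<theta> (lform (A i) # gs)"
    "h \<in> C \<Longrightarrow> \<theta> (lform h # gs) = 0" "length is = p \<Longrightarrow> homogeneous (int k) (\<theta> (map Var is))"
  using assms by (auto simp: log_piece_def log_multider_def)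

lemma subspace_log_piece: "MD.subspace (log_piece A J C p k)"
proof (rule MD.subspaceI)
  show "0 \<in> log_piece A J C p k"
    using multider_zero by (intro log_pieceI) (auto simp: zero_fun_def)
  show "\<theta> + \<eta> \<in> log_piece A J C p k" if "\<theta> \<in> log_piece A J C p k" "\<eta> \<in> log_piece A J C p k" for \<theta> \<eta>
    using multider_plus[OF log_pieceD(1)[OF that(1)] log_pieceD(1)[OF that(2)]]
      log_pieceD(2-)[OF that(1)] log_pieceD(2-)[OF that(2)]
    by (intro log_pieceI) (auto simp: plus_fun_def intro: homogeneous_add)
  show "multider_scale c \<theta> \<in> log_piece A J C p k" if "\<theta> \<in> log_piece A J C p k" for c \<theta>
    using multider_times[OF log_pieceD(1)[OF that]] log_pieceD(2-)[OF that]
    by (intro log_pieceI) (auto simp: multider_scale_def intro: homogeneous_Const_mult)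
qed

definition mult_lform :: "complex ^ 'm \<Rightarrow> ('m::finite cpoly list \<Rightarrow> 'm cpoly) \<Rightarrow> 'm cpoly list \<Rightarrow> 'm cpoly" where
  "mult_lform a \<theta> = (\<lambda>gs. lform a * \<theta> gs)"

lemma lin_mult_lform: "MD.lin (mult_lform a)"
  by (rule MD_linI) (simp_all add: mult_lform_def multider_scale_def fun_eq_iff algebra_simps)

lemma mult_lform_log_piece_insert:
  assumes "\<theta> \<in> log_piece A J C p k"
  shows "mult_lform (A i) \<theta> \<in> log_piece A (insert i J) C p (Suc k)"
  unfolding mult_lform_def using log_pieceD[OF assms]
  by (intro log_pieceI multider_times) (auto intro: homogeneous_lform_mult simp del: of_nat_Suc)

lemma mult_lform_log_piece:
  assumes "\<theta> \<in> log_piece A J C p k"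
  shows "mult_lform a \<theta> \<in> log_piece A J C p (Suc k)"
  unfolding mult_lform_def using log_pieceD[OF assms]
  by (intro log_pieceI multider_times) (auto intro: homogeneous_lform_mult simp del: of_nat_Suc)

lemma log_piece_mono: "J \<subseteq> J' \<Longrightarrow> C \<subseteq> C' \<Longrightarrow> log_piece A J' C' p k \<subseteq> log_piece A J C p k"
  by (auto simp: log_piece_def log_multider_def)

definition var_lists :: "nat \<Rightarrow> 'm cpoly list set" where
  "var_lists p = map Var ` {is. length is = p}"

text \<open>A multiderivation is determined by its values on variables. Restriction to them embeds
  the logarithmic pieces into \<open>coeff_space\<close>, a graded free module generated in degree
  0, to which the results on pole orders apply.\<close>

definition on_vars :: "nat \<Rightarrow> ('m cpoly list \<Rightarrow> 'm cpoly) \<Rightarrow> 'm cpoly list \<Rightarrow> 'm cpoly" where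
  "on_vars p \<theta> = (\<lambda>gs. if gs \<in> var_lists p then \<theta> gs else 0)"

definition coeff_space :: "nat \<Rightarrow> nat \<Rightarrow> ('m::finite cpoly list \<Rightarrow> 'm cpoly) set" where
  "coeff_space p k = {c. (\<forall>gs. gs \<notin> var_lists p \<longrightarrow> c gs = 0) \<and> (\<forall>gs\<in>var_lists p. homogeneous (int k) (c gs))}"

lemma lin_on_vars: "MD.lin (on_vars p)"
  by (rule MD_linI) (auto simp: on_vars_def multider_scale_def fun_eq_iff)

lemma on_vars_mult_lform: "mult_lform a (on_vars p \<theta>) = on_vars p (mult_lform a \<theta>)"
  by (auto simp: on_vars_def mult_lform_def)

lemma finite_var_lists: "finite (var_lists p :: 'm::finite cpoly list set)"
  unfolding var_lists_def using finite_lists_length_eq[of "UNIV :: 'm set" p] by simp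

lemma subspace_coeff_space: "MD.subspace (coeff_space p k)"
  by (rule MD.subspaceI)
    (auto simp: coeff_space_def multider_scale_def intro: homogeneous_add homogeneous_Const_mult)

lemma fin_dim_coeff_space: "MD.fin_dim (coeff_space p k :: ('m::finite cpoly list \<Rightarrow> 'm cpoly) set)"
proof -
  define e :: "'m cpoly list \<Rightarrow> ('m \<Rightarrow>\<^sub>0 nat) \<Rightarrow> 'm cpoly list \<Rightarrow> 'm cpoly"
    where "e gs m = (\<lambda>hs. if hs = gs then Poly_Mapping.single m 1 else 0)" for gs m
  let ?M = "{m :: 'm \<Rightarrow>\<^sub>0 nat. mdeg m = k}"
  let ?E = "(\<lambda>(gs, m). e gs m) ` (var_lists p \<times> ?M)"
  have "c \<in> MD.span ?E" if c: "c \<in> coeff_space p k" for c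
  proof -
    have "c = (\<Sum>gs\<in>var_lists p. \<Sum>m\<in>?M. multider_scale (Poly_Mapping.lookup (c gs) m) (e gs m))"
    proof
      fix hs
      have "(\<Sum>gs\<in>var_lists p. \<Sum>m\<in>?M. multider_scale (Poly_Mapping.lookup (c gs) m) (e gs m)) hs
          = (\<Sum>gs\<in>var_lists p. if hs = gs then
              (\<Sum>m\<in>?M. Poly_Mapping.single m (Poly_Mapping.lookup (c gs) m)) else 0)"
        unfolding sum_fun_at by (intro sum.cong) (auto simp: multider_scale_def e_def single_Const[symmetric])
      also have "\<dots> = (if hs \<in> var_lists p then
          (\<Sum>m\<in>?M. Poly_Mapping.single m (Poly_Mapping.lookup (c hs) m)) else 0)"
        by (simp add: finite_var_lists)
      also have "\<dots> = c hs"
      proof (cases "hs \<in> var_lists p")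
        case True
        then have "homogeneous (int k) (c hs)" using c by (auto simp: coeff_space_def)
        then have "Poly_Mapping.keys (c hs) \<subseteq> ?M" by (auto simp: homogeneous_iff in_keys_iff)
        then have "(\<Sum>m\<in>?M. Poly_Mapping.single m (Poly_Mapping.lookup (c hs) m)) = c hs"
          by (subst (2) cpoly_eq_sum_single)
            (intro sum.mono_neutral_right, auto simp: finite_mdeg in_keys_iff)
        then show ?thesis using True by simp
      next
        case False
        then show ?thesis using c by (auto simp: coeff_space_def)
      qed
      finally show "c hs = (\<Sum>gs\<in>var_lists p. \<Sum>m\<in>?M. multider_scale (Poly_Mapping.lookup (c gs) m) (e gs m)) hs"
        by simp
    qed
    also have "\<dots> \<in> MD.span ?E"
      by (intro MD.span_sum MD.span_scale MD.span_base) auto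
    finally show ?thesis .
  qed
  moreover have "finite ?E" using finite_var_lists finite_mdeg by (intro finite_imageI finite_cartesian_product)
  ultimately show ?thesis unfolding MD.fin_dim_def by blast
qed

text \<open>Any finite set of forms spanning the dual space will do as operators. Later
  \<open>S\<close> consists of the forms of a subarrangement and the \<open>d\<close> forms dual to
  a basis of its flat.\<close>

lemma generated_coeff_space:
  fixes S :: "(complex ^ 'm::{finite,linorder}) set"
  assumes "finite S" "\<And>i. \<exists>b. axis i 1 = (\<Sum>a\<in>S. b a *s a)"
  shows "generated_module multider_scale (mult_lform ` S) (coeff_space p)"
proof (rule generated_module.intro, rule MD.graded_space_axioms, rule generated_module_axioms.intro)
  show "finite (mult_lform ` S)" using assms(1) by simp
  show "MD.lin T" if "T \<in> mult_lform ` S" for T using that lin_mult_lform by blast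
  show "MD.commuting (mult_lform ` S)"
    by (auto simp: MD.commuting_def mult_lform_def mult.left_commute)
  show "MD.fin_dim (coeff_space p k)" for k by (rule fin_dim_coeff_space)
  show "MD.submodule (mult_lform ` S) (coeff_space p)"
    unfolding MD.submodule_def
    by (auto simp: subspace_coeff_space)
      (auto simp: coeff_space_def mult_lform_def intro: homogeneous_lform_mult simp del: of_nat_Suc)
  show "coeff_space p (Suc k) \<subseteq> MD.gen_step (mult_lform ` S) (\<lambda>k. {0}) (coeff_space p) k" for k
  proof
    fix c :: "'m cpoly list \<Rightarrow> 'm cpoly" assume c: "c \<in> coeff_space p (Suc k)"
    let ?G = "MD.gen_step (mult_lform ` S) (\<lambda>k. {0}) (coeff_space p) k"
    have "\<exists>q. (\<forall>i. homogeneous (int k) (q i)) \<and> c gs = (\<Sum>i\<in>UNIV. Var i * q i)"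
      if "gs \<in> var_lists p" for gs
    proof -
      have "homogeneous (int (Suc k)) (c gs)"
        using c that by (simp add: coeff_space_def del: of_nat_Suc)
      then show ?thesis by (rule homogeneous_Suc_expand)
    qed
    then obtain Q where Q: "\<And>gs i. gs \<in> var_lists p \<Longrightarrow> homogeneous (int k) (Q gs i)"
      "\<And>gs. gs \<in> var_lists p \<Longrightarrow> c gs = (\<Sum>i\<in>UNIV. Var i * Q gs i)" by metis
    define d where "d i = (\<lambda>gs. if gs \<in> var_lists p then Q gs i else 0)" for i
    have d: "d i \<in> coeff_space p k" for i using Q(1) by (auto simp: d_def coeff_space_def)
    have "(\<lambda>gs. Var i * d i gs) \<in> ?G" for i
    proof -
      obtain b where b: "axis i 1 = (\<Sum>a\<in>S. b a *s a)" using assms(2) by blast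
      have "Var i = (\<Sum>a\<in>S. Const (b a) * lform a)"
        unfolding lform_axis[symmetric] b lform_sum lform_scale ..
      then have eq: "(\<lambda>gs. Var i * d i gs) = (\<Sum>a\<in>S. multider_scale (b a) (mult_lform a (d i)))"
        by (auto simp: fun_eq_iff sum_fun_at multider_scale_def mult_lform_def sum_distrib_right mult.assoc)
      have "mult_lform a (d i) \<in> ?G" if "a \<in> S" for a
        using that d by (intro MD.gen_step_op) auto
      then have "(\<Sum>a\<in>S. multider_scale (b a) (mult_lform a (d i))) \<in> ?G"
        by (intro MD.subspace_sum MD.subspace_scale MD.subspace_gen_step)
      then show ?thesis unfolding eq .
    qed
    then have "(\<Sum>i\<in>UNIV. (\<lambda>gs. Var i * d i gs)) \<in> ?G"
      by (intro MD.subspace_sum MD.subspace_gen_step)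
    moreover have "(\<Sum>i\<in>UNIV. (\<lambda>gs. Var i * d i gs)) = c"
    proof
      fix gs show "(\<Sum>i\<in>UNIV. (\<lambda>gs. Var i * d i gs)) gs = c gs"
        using Q(2) c by (cases "gs \<in> var_lists p") (auto simp: sum_fun_at d_def coeff_space_def)
    qed
    ultimately show "c \<in> ?G" by (rule subst[rotated])
  qed
qed

context graded_space begin

lemma fin_dim_inj_image:
  assumes T: "lin T" and S: "subspace S" and "fin_dim (T ` S)" and inj: "\<And>x. x \<in> S \<Longrightarrow> T x = 0 \<Longrightarrow> x = 0"
  shows "fin_dim S"
proof -
  obtain b where b: "b \<subseteq> S" "independent b" "S \<subseteq> span b"
    using maximal_independent_subset[of S] by blast
  have span: "span b \<subseteq> S" using b(1) S by (intro span_minimal)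
  have "inj_on T (span b)"
  proof (rule inj_onI)
    fix x y assume "x \<in> span b" "y \<in> span b" "T x = T y"
    then have "x - y \<in> S" "T (x - y) = 0" using span S by (auto simp: lin_diff[OF T] intro: subspace_diff)
    then show "x = y" using inj by force
  qed
  then have "independent (T ` b)" "inj_on T b"
    using b(2) T by (metis module_hom.independent_injective_image module_hom_iff_linear,
        metis inj_on_subset span_superset)
  then have "finite b"
    using finite_independent_subset[OF assms(3), of "T ` b"] b(1) finite_imageD by blast
  then show ?thesis using b(3) unfolding fin_dim_def by blast
qed

lemma dim_inj_image:
  assumes "lin T" "subspace S" "fin_dim S" "\<And>x. x \<in> S \<Longrightarrow> T x = 0 \<Longrightarrow> x = 0"
  shows "dim (T ` S) = dim S"
proof -
  have "{x \<in> S. T x = 0} = {0}"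
    using assms(4) lin_zero[OF assms(1)] subspace_0[OF assms(2)] by auto
  then have "{x \<in> S. T x = 0} = span {}" by simp
  then have "dim {x \<in> S. T x = 0} = 0" by (metis card.empty dim_span_eq_card_independent independent_empty)
  then show ?thesis using rank_nullity[OF assms(1-3)] by simp
qed

lemma dim_zero: "dim {0} = 0"
  by (metis card.empty dim_span_eq_card_independent independent_empty span_empty)

end

lemma on_vars_eq_0:
  assumes "multider p (\<theta> :: 'm::finite cpoly list \<Rightarrow> 'm cpoly)" "on_vars p \<theta> = 0"
  shows "\<theta> = 0"
proof
  have "\<theta> (map Var is) = 0" if "length is = p" for "is"
    using fun_cong[OF assms(2), of "map Var is"] that by (auto simp: on_vars_def var_lists_def)
  then show "\<theta> gs = 0 gs" for gs using multider_eq_0[OF assms(1)] by simp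
qed

lemma on_vars_log_piece: "on_vars p ` log_piece A J C p k \<subseteq> coeff_space p k"
  by (auto simp: on_vars_def coeff_space_def var_lists_def dest: log_pieceD(4))

lemma fin_dim_log_piece: "MD.fin_dim (log_piece A J C p k)"
proof (rule MD.fin_dim_inj_image[OF lin_on_vars subspace_log_piece])
  show "MD.fin_dim (on_vars p ` log_piece A J C p k)"
    by (rule MD.fin_dim_subset[OF fin_dim_coeff_space on_vars_log_piece])
qed (auto dest: log_pieceD(1) on_vars_eq_0)

lemma dim_on_vars: "MD.dim (on_vars p ` log_piece A J C p k) = MD.dim (log_piece A J C p k)"
  by (rule MD.dim_inj_image[OF lin_on_vars subspace_log_piece fin_dim_log_piece])
    (auto dest: log_pieceD(1) on_vars_eq_0)

definition log_hilb :: "('n \<Rightarrow> complex ^ 'm::finite) \<Rightarrow> 'n set \<Rightarrow> (complex ^ 'm) set \<Rightarrow> nat \<Rightarrow> int fps" where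
  "log_hilb A J C p = Abs_fps (\<lambda>k. int (MD.dim (log_piece A J C p k)))"

text \<open>Instance of \<open>boolean_pole_order\<close> with all \<open>B\<close> zero. The
  alternating sum disposes of the forms \<open>A i\<close> with \<open>i \<in> I\<close>, so only
  those in \<open>hs\<close> contribute to the pole.\<close>

lemma log_hilb_boolean:
  fixes A :: "'n \<Rightarrow> complex ^ 'm::{finite,linorder}"
  assumes "finite I" "\<And>i. \<exists>b. axis i 1 = (\<Sum>a\<in>A ` I \<union> set hs. b a *s a)"
  shows "poly_fps ((1 - fps_X) ^ length hs * (\<Sum>J\<in>Pow I. (-1) ^ card J * log_hilb A J C p))"
proof -
  let ?Ops = "mult_lform ` (A ` I \<union> set hs)"
  interpret G: generated_module multider_scale ?Ops "coeff_space p"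
    using assms by (intro generated_coeff_space) auto
  define Z where "Z J k = on_vars p ` log_piece A J C p k" for J k
  have Z: "G.submod (Z J)" for J
    unfolding G.submod_def MD.submodule_def
  proof (intro conjI allI ballI)
    show "MD.subspace (Z J k)" for k
      unfolding Z_def by (intro MD.subspace_lin_image lin_on_vars subspace_log_piece)
    show "Z J k \<subseteq> coeff_space p k" for k unfolding Z_def by (rule on_vars_log_piece)
    show "T x \<in> Z J (Suc k)" if Tx: "T \<in> ?Ops" "x \<in> Z J k" for T k x
    proof -
      obtain a \<theta> where "T = mult_lform a" "x = on_vars p \<theta>" "\<theta> \<in> log_piece A J C p k"
        using Tx by (auto simp: Z_def)
      then show ?thesis
        by (auto simp: Z_def on_vars_mult_lform intro!: imageI mult_lform_log_piece)
    qed
  qed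
  define N0 where "N0 k = {0 :: 'm cpoly list \<Rightarrow> 'm cpoly}" for k :: nat
  have zero: "G.submod N0"
    unfolding N0_def G.submod_def MD.submodule_def
    using MD.lin_zero[OF lin_mult_lform] MD.subspace_0[OF subspace_coeff_space] by auto
  have "poly_fps ((1 - fps_X) ^ length (map mult_lform hs) *
      (\<Sum>J\<in>Pow I. (-1) ^ card J * (MD.hilb (Z J) - MD.hilb N0)))"
  proof (rule G.boolean_pole_order[of I "{}" "\<lambda>i. mult_lform (A i)" "map mult_lform hs" Z "\<lambda>J. N0"])
    show "{} \<union> (\<lambda>i. mult_lform (A i)) ` I \<union> set (map mult_lform hs) = ?Ops" by auto
    show "N0 k \<subseteq> Z J k" for J k using MD.subspace_0[OF G.submod_subspace[OF Z]] by (simp add: N0_def)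
    show "Z (insert i J) k \<subseteq> Z J k" for J i k
      unfolding Z_def using log_piece_mono[of J "insert i J" C C] by blast
    show "mult_lform (A i) x \<in> Z (insert i J) (Suc k)" if "x \<in> Z J k" for i J k x
      using that mult_lform_log_piece_insert[of _ A J C p k i] unfolding Z_def
      by (auto simp: on_vars_mult_lform)
  qed (use assms(1) Z zero MD.lin_zero[OF lin_mult_lform] in \<open>auto simp: N0_def\<close>)
  moreover have "MD.hilb (Z J) - MD.hilb N0 = log_hilb A J C p" for J
    by (rule fps_ext) (simp add: log_hilb_def Z_def N0_def dim_on_vars MD.dim_zero)
  ultimately show ?thesis by simp
qed

section \<open>Contraction with a linear form, split by constant fields and by the Euler
  field\<close>

section \<open>Splitting off a vector field\<close>

lemma homogeneous_wedge_der:
  fixes \<delta> :: "'m::finite cpoly \<Rightarrow> 'm cpoly"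
  assumes "\<And>i. homogeneous (int e) (\<delta> (Var i))"
    and "\<And>is. length is = p \<Longrightarrow> homogeneous (int k) (\<theta> (map Var is))" and "length is = Suc p"
  shows "homogeneous (int (k + e)) (wedge_der \<delta> \<theta> (map Var is))"
  using assms(2,3)
proof (induction "is" arbitrary: p \<theta>)
  case (Cons i "is")
  have "homogeneous (int e + int k) (\<delta> (Var i) * \<theta> (map Var is))"
    using Cons.prems by (intro homogeneous_mult assms(1)) auto
  moreover have "homogeneous (int (k + e)) (wedge_der \<delta> (\<lambda>hs. \<theta> (Var i # hs)) (map Var is))"
  proof (cases p)
    case 0
    then show ?thesis using Cons.prems by simp
  next
    case (Suc q)
    show ?thesis
    proof (rule Cons.IH[of q])
      show "homogeneous (int k) (\<theta> (Var i # map Var js))" if "length js = q" for js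
        using Cons.prems(1)[of "i # js"] that Suc by simp
    qed (use Cons.prems Suc in auto)
  qed
  ultimately show ?case by (simp add: homogeneous_diff add.commute)
qed simp

text \<open>Used with \<open>e = 0\<close> for constant fields and with \<open>e = 1\<close> for the
  Euler field, whose coefficients are linear.\<close>

lemma wedge_der_log_piece:
  assumes \<delta>: "derivation \<delta>" "\<And>i. i \<in> J \<Longrightarrow> lform (A i) dvd \<delta> (lform (A i))"
    "\<And>h. h \<in> C \<Longrightarrow> \<delta> (lform h) = 0" "\<And>i. homogeneous (int e) (\<delta> (Var i))"
    and \<eta>: "\<eta> \<in> log_piece A J C p k"
  shows "wedge_der \<delta> \<eta> \<in> log_piece A J C (Suc p) (k + e)"
proof (rule log_pieceI)
  note D = log_pieceD[OF \<eta>]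
  show "multider (Suc p) (wedge_der \<delta> \<eta>)" by (intro multider_wedge_der \<delta>(1) D(1))
  show "lform (A i) dvd wedge_der \<delta> \<eta> (lform (A i) # gs)" if "i \<in> J" for i gs
    using \<delta>(2) D(2) that by (auto intro!: dvd_diff wedge_der_dvd)
  show "wedge_der \<delta> \<eta> (lform h # gs) = 0" if "h \<in> C" for h gs
    using \<delta>(3) D(3) that by (simp add: wedge_der_zero)
  show "homogeneous (int (k + e)) (wedge_der \<delta> \<eta> (map Var is))" if "length is = Suc p" for "is"
    by (rule homogeneous_wedge_der[of e \<delta> p k \<eta>]) (use \<delta>(4) D(4) that in auto)
qed

definition contract :: "complex ^ 'm \<Rightarrow> ('m::finite cpoly list \<Rightarrow> 'm cpoly) \<Rightarrow> 'm cpoly list \<Rightarrow> 'm cpoly" where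
  "contract h \<theta> = (\<lambda>gs. \<theta> (lform h # gs))"

lemma lin_contract: "MD.lin (contract h)"
  by (rule MD_linI) (simp_all add: contract_def multider_scale_def fun_eq_iff)

lemma homogeneous_contract:
  assumes "\<theta> \<in> log_piece A J C (Suc p) k" "length is = p"
  shows "homogeneous (int k) (\<theta> (lform h # map Var is))"
proof -
  have "\<theta> (lform h # map Var is) = (\<Sum>j\<in>UNIV. Const (h $ j) * \<theta> (Var j # map Var is))"
    by (rule derivation_lform[OF multider_head[OF log_pieceD(1)[OF assms(1)]]])
  moreover have "homogeneous (int k) (\<theta> (Var j # map Var is))" for j
    using log_pieceD(4)[OF assms(1), of "j # is"] assms(2) by simp
  ultimately show ?thesis by (auto intro: homogeneous_sum homogeneous_Const_mult)
qed

lemma contract_dvd: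
  assumes "\<theta> \<in> log_piece A J C p k" "i \<in> J"
  shows "lform (A i) dvd \<theta> (g # lform (A i) # gs)"
proof -
  have "lform (A i) dvd - \<theta> (lform (A i) # g # gs)" using log_pieceD(2)[OF assms] by simp
  then show ?thesis using multider_swap[OF log_pieceD(1)[OF assms(1)], of g "lform (A i)" gs] by simp
qed

lemma contract_zero:
  assumes "\<theta> \<in> log_piece A J C p k" "h \<in> C"
  shows "\<theta> (g # lform h # gs) = 0"
  using multider_swap[OF log_pieceD(1)[OF assms(1)], of g "lform h" gs] log_pieceD(3)[OF assms] by simp

lemma contract_log_piece:
  assumes \<theta>: "\<theta> \<in> log_piece A J C (Suc p) k"
  shows "contract h \<theta> \<in> log_piece A J (insert h C) p k"
  unfolding contract_def
proof (rule log_pieceI)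
  show "multider p (\<lambda>gs. \<theta> (lform h # gs))" by (rule multider_contract[OF log_pieceD(1)[OF \<theta>]])
  show "\<theta> (lform h # lform c # gs) = 0" if "c \<in> insert h C" for c gs
    using that contract_zero[OF \<theta>] multider_repeat[OF log_pieceD(1)[OF \<theta>]] by auto
qed (use contract_dvd[OF \<theta>] homogeneous_contract[OF \<theta>] in auto)

lemma contract_kernel:
  "{\<theta> \<in> log_piece A J C p k. contract h \<theta> = 0} = log_piece A J (insert h C) p k"
  by (auto simp: log_piece_def contract_def fun_eq_iff)

lemma contract_log_piece_0: "\<theta> \<in> log_piece A J C 0 k \<Longrightarrow> contract h \<theta> = 0"
  by (auto dest!: log_pieceD(1) simp: contract_def fun_eq_iff)

lemma dim_log_piece_0:
  "MD.dim (log_piece A J C 0 k) = MD.dim (log_piece A J (insert h C) 0 k)"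
proof -
  have "log_piece A J C 0 k = log_piece A J (insert h C) 0 k"
    using contract_kernel[of A J C 0 k h] contract_log_piece_0[of _ A J C k h] by auto
  then show ?thesis by simp
qed

text \<open>Contraction with \<open>h\<close> is onto, since \<open>\<delta> \<and> \<eta>\<close>
  is a preimage of \<open>\<eta>\<close>: its contraction is \<open>\<delta>(h) \<eta>\<close>, as
  \<open>\<eta>\<close> vanishes on \<open>h\<close>. The count is then rank-nullity.\<close>

lemma dim_log_piece_split:
  assumes \<delta>: "derivation \<delta>" "\<And>i. i \<in> J \<Longrightarrow> \<delta> (lform (A i)) = 0"
    "\<And>c. c \<in> C \<Longrightarrow> \<delta> (lform c) = 0" "\<And>i. homogeneous 0 (\<delta> (Var i))" "\<delta> (lform h) = 1"
  shows "MD.dim (log_piece A J C (Suc p) k) =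
    MD.dim (log_piece A J (insert h C) (Suc p) k) + MD.dim (log_piece A J (insert h C) p k)"
proof -
  have "contract h ` log_piece A J C (Suc p) k = log_piece A J (insert h C) p k"
  proof
    show "contract h ` log_piece A J C (Suc p) k \<subseteq> log_piece A J (insert h C) p k"
      using contract_log_piece by blast
    show "log_piece A J (insert h C) p k \<subseteq> contract h ` log_piece A J C (Suc p) k"
    proof
      fix \<eta> assume \<eta>: "\<eta> \<in> log_piece A J (insert h C) p k"
      then have "\<eta> \<in> log_piece A J C p k"
        using log_piece_mono[of J J C "insert h C" A p k] by blast
      then have "wedge_der \<delta> \<eta> \<in> log_piece A J C (Suc p) (k + 0)"
        using \<delta> by (intro wedge_der_log_piece) auto
      moreover have "contract h (wedge_der \<delta> \<eta>) = \<eta>"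
        using log_pieceD(3)[OF \<eta>, of h] by (simp add: contract_def wedge_der_zero \<delta>(5) fun_eq_iff)
      ultimately show "\<eta> \<in> contract h ` log_piece A J C (Suc p) k" by (metis add_0_right image_eqI)
    qed
  qed
  then show ?thesis
    using MD.rank_nullity[OF lin_contract[of h] subspace_log_piece[of A J C "Suc p" k] fin_dim_log_piece]
    by (simp add: contract_kernel)
qed

lemma dim_mult_lform:
  fixes a :: "complex ^ 'm::{finite,linorder}"
  assumes "a \<noteq> 0"
  shows "MD.dim (mult_lform a ` log_piece A J C p k) = MD.dim (log_piece A J C p k)"
  using assms
  by (intro MD.dim_inj_image lin_mult_lform subspace_log_piece fin_dim_log_piece)
    (simp add: mult_lform_def fun_eq_iff)

text \<open>\<open>\<eta>\<close> is the contraction with \<open>df\<^sub>i / f\<^sub>i\<close>. It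
  stays logarithmic along the other hyperplanes, because their forms are primes not dividing
  \<open>f\<^sub>i\<close>.\<close>

lemma contract_dvd_log_piece:
  fixes A :: "'n \<Rightarrow> complex ^ 'm::{finite,linorder}"
  assumes "central_arrangement A" "i \<in> J" and \<theta>: "\<theta> \<in> log_piece A J {} (Suc p) k"
  shows "\<exists>\<eta>. contract (A i) \<theta> = mult_lform (A i) \<eta> \<and> multider p \<eta> \<and>
    (\<forall>j\<in>J. \<forall>gs. lform (A j) dvd \<eta> (lform (A j) # gs)) \<and> (\<forall>gs. \<eta> (lform (A i) # gs) = 0)"
proof -
  let ?L = "\<lambda>i. lform (A i)"
  have nz: "A j \<noteq> 0" for j using assms(1) by (simp add: central_arrangement_def)
  have "\<exists>q. \<theta> (?L i # gs) = ?L i * q" for gs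
    using log_pieceD(2)[OF \<theta> assms(2), of gs] by (auto simp: dvd_def)
  then have "\<exists>\<eta>. \<forall>gs. \<theta> (?L i # gs) = ?L i * \<eta> gs" by (intro choice allI)
  then obtain \<eta> where \<eta>: "\<theta> (?L i # gs) = ?L i * \<eta> gs" for gs by blast
  have "multider p (\<lambda>gs. ?L i * \<eta> gs)"
    using multider_contract[OF log_pieceD(1)[OF \<theta>], of "?L i"] by (simp add: \<eta>)
  then have md: "multider p \<eta>" by (rule multider_cancel) (simp add: nz)
  have zero: "\<eta> (?L i # gs) = 0" for gs
    using \<eta>[of "?L i # gs"] multider_repeat[OF log_pieceD(1)[OF \<theta>], of "?L i" gs] nz by simp
  have dvd: "?L j dvd \<eta> (?L j # gs)" if j: "j \<in> J" for j gs
  proof (cases "j = i")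
    case True
    then show ?thesis using zero by simp
  next
    case False
    have "?L j dvd ?L i * \<eta> (?L j # gs)"
      using contract_dvd[OF \<theta> j, of "?L i" gs] unfolding \<eta> .
    then have "?L j dvd ?L i \<or> ?L j dvd \<eta> (?L j # gs)" by (rule prime_lform[OF nz])
    then show ?thesis using central_lform_dvd[OF assms(1), of j i] False by blast
  qed
  have "contract (A i) \<theta> = mult_lform (A i) \<eta>"
    by (simp add: contract_def mult_lform_def \<eta>)
  with md zero dvd show ?thesis by blast
qed

lemma vector_field_Euler: "vector_field Var (lform a) = lform a"
  by (simp only: vector_field_lform) (simp add: lform_def)

text \<open>The Euler field \<open>E\<close> satisfies \<open>E(f\<^sub>i) = f\<^sub>i\<close>, so
  \<open>E \<and> \<eta>\<close> contracts to \<open>f\<^sub>i \<eta>\<close> when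
  \<open>\<eta>\<close> vanishes on \<open>f\<^sub>i\<close>. Conversely, a contraction can be
  divided by \<open>f\<^sub>i\<close>.\<close>

lemma contract_Euler_image:
  fixes A :: "'n \<Rightarrow> complex ^ 'm::{finite,linorder}"
  assumes A: "central_arrangement A" and i: "i \<in> J"
  shows "contract (A i) ` log_piece A J {} (Suc p) (Suc k) = mult_lform (A i) ` log_piece A J {A i} p k"
proof
  have nz: "A i \<noteq> 0" using A by (simp add: central_arrangement_def)
  show "contract (A i) ` log_piece A J {} (Suc p) (Suc k) \<subseteq> mult_lform (A i) ` log_piece A J {A i} p k"
  proof
    fix \<zeta> assume "\<zeta> \<in> contract (A i) ` log_piece A J {} (Suc p) (Suc k)"
    then obtain \<theta> where \<theta>: "\<zeta> = contract (A i) \<theta>" "\<theta> \<in> log_piece A J {} (Suc p) (Suc k)" by blast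
    obtain \<eta> where \<eta>: "contract (A i) \<theta> = mult_lform (A i) \<eta>" "multider p \<eta>"
      "\<forall>j\<in>J. \<forall>gs. lform (A j) dvd \<eta> (lform (A j) # gs)" "\<forall>gs. \<eta> (lform (A i) # gs) = 0"
      using contract_dvd_log_piece[OF A i \<theta>(2)] by blast
    have "\<eta> \<in> log_piece A J {A i} p k"
    proof (rule log_pieceI)
      show "homogeneous (int k) (\<eta> (map Var is))" if len: "length is = p" for "is"
      proof (rule homogeneous_lform_cancel[OF _ nz])
        show "homogeneous (int (Suc k)) (lform (A i) * \<eta> (map Var is))"
          using homogeneous_contract[OF \<theta>(2) len, of "A i"]
          unfolding fun_cong[OF \<eta>(1), unfolded contract_def mult_lform_def] .
      qed
    qed (use \<eta>(2-4) in auto)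
    then show "\<zeta> \<in> mult_lform (A i) ` log_piece A J {A i} p k" using \<theta>(1) \<eta>(1) by blast
  qed
  show "mult_lform (A i) ` log_piece A J {A i} p k \<subseteq> contract (A i) ` log_piece A J {} (Suc p) (Suc k)"
  proof
    fix \<zeta> assume "\<zeta> \<in> mult_lform (A i) ` log_piece A J {A i} p k"
    then obtain \<eta> where \<eta>: "\<zeta> = mult_lform (A i) \<eta>" "\<eta> \<in> log_piece A J {A i} p k" by blast
    let ?\<theta> = "wedge_der (vector_field Var) \<eta>"
    have "\<eta> \<in> log_piece A J {} p k"
      using \<eta>(2) log_piece_mono[of J J "{}" "{A i}" A p k] by blast
    then have "?\<theta> \<in> log_piece A J {} (Suc p) (k + 1)"
      by (intro wedge_der_log_piece)
        (auto simp: derivation_vector_field vector_field_Euler vector_field_Var homogeneous_Var)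
    moreover have "contract (A i) ?\<theta> = \<zeta>"
      using log_pieceD(3)[OF \<eta>(2), of "A i"]
      by (simp add: contract_def wedge_der_zero vector_field_Euler fun_eq_iff \<eta>(1) mult_lform_def)
    ultimately show "\<zeta> \<in> contract (A i) ` log_piece A J {} (Suc p) (Suc k)"
      by (metis Suc_eq_plus1 image_eqI)
  qed
qed

text \<open>Here the coefficients are constants, and a constant divisible by a linear form is
  0.\<close>

lemma contract_Euler_0:
  fixes A :: "'n \<Rightarrow> complex ^ 'm::{finite,linorder}"
  assumes A: "central_arrangement A" and i: "i \<in> J" and \<theta>: "\<theta> \<in> log_piece A J {} (Suc p) 0"
  shows "contract (A i) \<theta> = 0"
proof -
  obtain \<eta> where \<eta>: "contract (A i) \<theta> = mult_lform (A i) \<eta>"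
    using contract_dvd_log_piece[OF A i \<theta>] by blast
  have md: "multider p (contract (A i) \<theta>)"
    unfolding contract_def by (rule multider_contract[OF log_pieceD(1)[OF \<theta>]])
  have "contract (A i) \<theta> (map Var is) = 0" if len: "length is = p" for "is"
  proof -
    have "homogeneous 0 (lform (A i) * \<eta> (map Var is))"
      using homogeneous_contract[OF \<theta> len, of "A i"]
      unfolding fun_cong[OF \<eta>, unfolded contract_def mult_lform_def] by simp
    then show ?thesis unfolding \<eta> mult_lform_def by (rule homogeneous_0_lform_dvd)
  qed
  then show ?thesis using multider_eq_0[OF md] by (simp add: fun_eq_iff)
qed

lemma dim_log_piece_Euler:
  fixes A :: "'n \<Rightarrow> complex ^ 'm::{finite,linorder}"
  assumes A: "central_arrangement A" and i: "i \<in> J"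
  shows "MD.dim (log_piece A J {} (Suc p) (Suc k)) =
      MD.dim (log_piece A J {A i} (Suc p) (Suc k)) + MD.dim (log_piece A J {A i} p k)"
    and "MD.dim (log_piece A J {} (Suc p) 0) = MD.dim (log_piece A J {A i} (Suc p) 0)"
proof -
  have nz: "A i \<noteq> 0" using A by (simp add: central_arrangement_def)
  show "MD.dim (log_piece A J {} (Suc p) (Suc k)) =
      MD.dim (log_piece A J {A i} (Suc p) (Suc k)) + MD.dim (log_piece A J {A i} p k)"
    using MD.rank_nullity[OF lin_contract[of "A i"] subspace_log_piece[of A J "{}" "Suc p" "Suc k"] fin_dim_log_piece]
    unfolding contract_kernel contract_Euler_image[OF A i] dim_mult_lform[OF nz] .
  have "log_piece A J {A i} (Suc p) 0 = log_piece A J {} (Suc p) 0"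
    using contract_kernel[of A J "{}" "Suc p" 0 "A i"] contract_Euler_0[OF A i] by blast
  then show "MD.dim (log_piece A J {} (Suc p) 0) = MD.dim (log_piece A J {A i} (Suc p) 0)" by simp
qed

lemma multider_not_distinct:
  assumes "multider p \<theta>" "\<not> distinct gs"
  shows "\<theta> gs = 0"
proof (cases "length gs = p")
  case True
  obtain i j where ij: "i < j" "j < length gs" "gs ! i = gs ! j"
    using assms(2) unfolding distinct_conv_nth by (metis linorder_neqE_nat)
  then have "gs[i := gs ! j, j := gs ! i] = gs" by (metis list_update_id)
  then have "\<theta> gs = - \<theta> gs"
    using multider_imp_multiderivation[OF assms(1)] True ij unfolding multiderivation_def by metis
  then have "Poly_Mapping.lookup (\<theta> gs) k = - Poly_Mapping.lookup (\<theta> gs) k" for k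
    by (metis lookup_uminus)
  then show ?thesis by (intro poly_mapping_eqI) simp
qed (use multider_length[OF assms(1)] in simp)

lemma log_piece_large:
  fixes A :: "'n \<Rightarrow> complex ^ 'm::finite"
  assumes "CARD('m) < p"
  shows "log_piece A J C p k = {0}"
proof -
  have "\<theta> = 0" if "\<theta> \<in> log_piece A J C p k" for \<theta>
  proof
    fix gs
    have "\<theta> (map Var is) = 0" if len: "length is = p" for "is"
    proof (rule multider_not_distinct[OF log_pieceD(1)[OF \<open>\<theta> \<in> _\<close>]])
      have "card (set is) \<le> CARD('m)" by (rule card_mono) auto
      then have "\<not> distinct is" using assms len distinct_card[of "is"] by auto
      then show "\<not> distinct (map Var is :: 'm cpoly list)" by (simp add: distinct_map)
    qed
    then show "\<theta> gs = 0 gs" using multider_eq_0[OF log_pieceD(1)[OF that]] by simp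
  qed
  then show ?thesis using MD.subspace_0[OF subspace_log_piece] by blast
qed

lemma log_hilb_nth [simp]: "fps_nth (log_hilb A J C p) k = int (MD.dim (log_piece A J C p k))"
  by (simp add: log_hilb_def)

lemma log_hilb_large:
  fixes A :: "'n \<Rightarrow> complex ^ 'm::finite"
  shows "CARD('m) < p \<Longrightarrow> log_hilb A J C p = 0"
  by (rule fps_ext) (simp add: log_piece_large MD.dim_zero)

lemma log_hilb_0: "log_hilb A J (insert h C) 0 = log_hilb A J C 0"
  by (rule fps_ext) (simp add: dim_log_piece_0[of A J C _ h])

lemma log_hilb_split:
  assumes "derivation \<delta>" "\<And>i. i \<in> J \<Longrightarrow> \<delta> (lform (A i)) = 0"
    "\<And>c. c \<in> C \<Longrightarrow> \<delta> (lform c) = 0" "\<And>i. homogeneous 0 (\<delta> (Var i))" "\<delta> (lform h) = 1"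
  shows "log_hilb A J C (Suc p) = log_hilb A J (insert h C) (Suc p) + log_hilb A J (insert h C) p"
  by (rule fps_ext) (simp add: dim_log_piece_split[OF assms])

lemma log_hilb_Euler:
  fixes A :: "'n \<Rightarrow> complex ^ 'm::{finite,linorder}"
  assumes "central_arrangement A" "i \<in> J"
  shows "log_hilb A J {} (Suc p) = log_hilb A J {A i} (Suc p) + fps_X * log_hilb A J {A i} p"
proof (rule fps_ext)
  fix k
  show "fps_nth (log_hilb A J {} (Suc p)) k =
      fps_nth (log_hilb A J {A i} (Suc p) + fps_X * log_hilb A J {A i} p) k"
    using dim_log_piece_Euler[OF assms, of p] by (cases k) auto
qed

section \<open>Linear algebra of a flat: dual bases and spanning sets of forms\<close>

section \<open>Coordinates adapted to a flat\<close>

text \<open>Bilinear, without conjugation: it pairs the coefficient vector of a form with a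
  vector.\<close>

definition cdot :: "complex ^ 'm::finite \<Rightarrow> complex ^ 'm \<Rightarrow> complex" where
  "cdot x y = (\<Sum>j\<in>UNIV. x $ j * y $ j)"

definition flat :: "('n \<Rightarrow> complex ^ 'm::finite) \<Rightarrow> 'n set \<Rightarrow> (complex ^ 'm) set" where
  "flat A J = (\<Inter>i\<in>J. hyperplane A i)"

lemma mem_flat: "v \<in> flat A J \<longleftrightarrow> (\<forall>i\<in>J. cdot (A i) v = 0)"
  by (simp add: flat_def hyperplane_def cdot_def)

lemma cdot_commute: "cdot x y = cdot y x"
  by (simp add: cdot_def mult.commute)

lemma exists_dual_vector:
  fixes C :: "(complex ^ 'm::finite) set"
  assumes "vec.independent C" "vec.span C = UNIV"
  shows "\<exists>g. \<forall>x. cdot g x = vec.representation C x c"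
proof (intro exI allI)
  fix x :: "complex ^ 'm"
  let ?g = "\<chi> j. vec.representation C (axis j 1) c"
  have "vec.representation C (\<Sum>j\<in>UNIV. x $ j *s axis j 1) c
      = (\<Sum>j\<in>UNIV. vec.representation C (x $ j *s axis j 1) c)"
    using assms by (subst vec.representation_sum) auto
  also have "\<dots> = (\<Sum>j\<in>UNIV. x $ j * vec.representation C (axis j 1) c)"
    using assms by (simp add: vec.representation_scale)
  finally show "cdot ?g x = vec.representation C x c"
    by (simp add: cdot_def basis_expansion mult.commute)
qed

text \<open>If a basis of the span had to be extended by a vector \<open>c\<close>, the coordinate
  function of \<open>c\<close>, read as a vector, would be a nonzero common zero of
  \<open>S\<close>.\<close>

lemma span_UNIV_if_no_common_zero:
  fixes S :: "(complex ^ 'm::finite) set"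
  assumes "\<And>w. (\<forall>s\<in>S. cdot s w = 0) \<Longrightarrow> w = 0"
  shows "vec.span S = UNIV"
proof -
  obtain b where b: "b \<subseteq> S" "vec.independent b" "S \<subseteq> vec.span b"
    using vec.maximal_independent_subset[of S] by blast
  let ?C = "vec.extend_basis b"
  have C: "b \<subseteq> ?C" "vec.independent ?C" "vec.span ?C = UNIV"
    using vec.extend_basis_superset[OF b(2)] vec.independent_extend_basis[OF b(2)]
      vec.span_extend_basis[OF b(2)] by auto
  have "?C \<subseteq> b"
  proof
    fix c assume c: "c \<in> ?C"
    show "c \<in> b"
    proof (rule ccontr)
      assume "c \<notin> b"
      obtain g where g: "\<And>x. cdot g x = vec.representation ?C x c"
        using exists_dual_vector[OF C(2,3)] by blast
      have "cdot s g = 0" if "s \<in> S" for s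
      proof -
        have "vec.representation ?C s = vec.representation b s"
          using C(1,2) b(3) that by (intro vec.representation_extend) auto
        then have "vec.representation ?C s c = 0"
          using vec.representation_ne_zero[of b s c] \<open>c \<notin> b\<close> by auto
        then show ?thesis using g[of s] by (simp add: cdot_commute)
      qed
      then have "g = 0" using assms by blast
      moreover have "cdot g c = 1"
        using g[of c] vec.representation_basis[OF C(2) c] by simp
      ultimately show False by (simp add: cdot_def)
    qed
  qed
  then have "vec.span b = UNIV" using C by (metis subset_antisym)
  then show ?thesis using b(1) vec.span_mono by blast
qed

text \<open>\<open>v\<close> is a basis whose members with index in \<open>T\<close> form a basis of
  the flat, and \<open>h\<close> is the dual basis. The last clause supplies the spanning set of
  forms that serves as set of operators.\<close>

definition adapted_basis ::
    "('n \<Rightarrow> complex ^ 'm::finite) \<Rightarrow> 'n set \<Rightarrow> 'm set \<Rightarrow> ('m \<Rightarrow> complex ^ 'm) \<Rightarrow> ('m \<Rightarrow> complex ^ 'm) \<Rightarrow> bool"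
  where "adapted_basis A J T v h \<longleftrightarrow> card T = vec.dim (flat A J) \<and>
    (\<forall>a b. cdot (h a) (v b) = (if a = b then 1 else 0)) \<and> (\<forall>b\<in>T. v b \<in> flat A J) \<and>
    (\<forall>i. \<exists>b. axis i 1 = (\<Sum>a\<in>A ` J \<union> h ` T. b a *s a))"

lemma exists_adapted_basis:
  fixes A :: "'n::finite \<Rightarrow> complex ^ 'm::finite"
  shows "\<exists>T v h. adapted_basis A J T v h"
proof -
  let ?Y = "flat A J"
  obtain B where B: "B \<subseteq> ?Y" "vec.independent B" "?Y \<subseteq> vec.span B" "card B = vec.dim ?Y"
    using vec.basis_exists[of ?Y] by blast
  let ?C = "vec.extend_basis B"
  have C: "B \<subseteq> ?C" "vec.independent ?C" "vec.span ?C = UNIV"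
    using vec.extend_basis_superset[OF B(2)] vec.independent_extend_basis[OF B(2)]
      vec.span_extend_basis[OF B(2)] by auto
  have fC: "finite ?C" by (rule vec.finiteI_independent[OF C(2)])
  have "card ?C = vec.dim (UNIV :: (complex ^ 'm) set)"
    using C by (intro vec.basis_card_eq_dim) auto
  then have "card ?C = CARD('m)" by (simp add: card_cart_basis)
  then obtain v where v: "bij_betw v (UNIV :: 'm set) ?C"
    using finite_same_card_bij[of "UNIV :: 'm set" ?C] fC by auto
  define T where "T = v -` B"
  have vT: "v ` T = B" using v C(1) unfolding T_def bij_betw_def by auto
  have inj: "inj v" using v by (simp add: bij_betw_def)
  have vC: "v b \<in> ?C" for b using v by (auto simp: bij_betw_def)
  have "\<exists>g. \<forall>x. cdot g x = vec.representation ?C x c" for c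
    by (rule exists_dual_vector[OF C(2,3)])
  then obtain g where g: "\<And>c x. cdot (g c) x = vec.representation ?C x c" by metis
  define h where "h a = g (v a)" for a
  \<comment> \<open>As the forms of \<open>J\<close> annihilate \<open>w\<close>, it lies in the
    flat, where the \<open>h a\<close> with \<open>a \<in> T\<close> are its coordinates.\<close>
  have "w = 0" if w: "\<forall>s\<in>A ` J \<union> h ` T. cdot s w = 0" for w
  proof -
    have "w \<in> ?Y" using w by (simp add: mem_flat)
    then have wB: "w \<in> vec.span B" using B(3) by blast
    have "vec.representation ?C w = vec.representation B w"
      using C(1,2) wB by (intro vec.representation_extend) auto
    moreover have "vec.representation ?C w b = 0" if "b \<in> B" for b
    proof -
      obtain a where "a \<in> T" "b = v a" using vT \<open>b \<in> B\<close> by blast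
      then show ?thesis using w g[of "v a" w] by (simp add: h_def)
    qed
    ultimately have "(\<Sum>b\<in>B. vec.representation B w b *s b) = 0" by simp
    moreover have "(\<Sum>b\<in>B. vec.representation B w b *s b) = w"
      using wB B(2) fC C(1) finite_subset by (intro vec.sum_representation_eq) auto
    ultimately show ?thesis by simp
  qed
  then have "vec.span (A ` J \<union> h ` T) = UNIV" by (rule span_UNIV_if_no_common_zero)
  then have "axis i 1 \<in> vec.span (A ` J \<union> h ` T)" for i by simp
  then have span: "\<exists>b. axis i 1 = (\<Sum>a\<in>A ` J \<union> h ` T. b a *s a)" for i
    by (subst (asm) vec.span_finite) auto
  have "adapted_basis A J T v h"
    unfolding adapted_basis_def
  proof (intro conjI allI ballI)
    show "card T = vec.dim ?Y"
      using B(4) vT inj card_image[of v T] by (metis inj_on_subset subset_UNIV)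
    show "cdot (h a) (v b) = (if a = b then 1 else 0)" for a b
      using g[of "v a" "v b"] vec.representation_basis[OF C(2) vC[of b]] inj
      by (auto simp: h_def inj_eq)
    show "v b \<in> ?Y" if "b \<in> T" for b using that B(1) by (auto simp: T_def)
    show "\<exists>b. axis i 1 = (\<Sum>a\<in>A ` J \<union> h ` T. b a *s a)" for i by (rule span)
  qed
  then show ?thesis by blast
qed


section \<open>Data of the empty arrangement: the Hilbert series of the coordinate ring\<close>

section \<open>The polynomial ring\<close>

text \<open>A monomial in \<open>insert x S\<close> either avoids \<open>x\<close> or is
  \<open>x\<close> times such a monomial; each variable thus contributes a factor
  \<open>1 / (1 - X)\<close>.\<close>

lemma card_monomials:
  fixes S :: "'m::finite set"
  shows "Abs_fps (\<lambda>k. int (card {m :: 'm \<Rightarrow>\<^sub>0 nat. Poly_Mapping.keys m \<subseteq> S \<and> mdeg m = k}))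
    * (1 - fps_X) ^ card S = 1"
proof -
  let ?M = "\<lambda>S k. {m :: 'm \<Rightarrow>\<^sub>0 nat. Poly_Mapping.keys m \<subseteq> S \<and> mdeg m = k}"
  let ?N = "\<lambda>S. Abs_fps (\<lambda>k. int (card (?M S k)))"
  have fin: "finite (?M S k)" for S k by (rule finite_subset[OF _ finite_mdeg[of k]]) auto
  have M0: "?M S 0 = {0}" for S by (auto simp: mdeg_eq_0)
  have step: "?N (insert x S) * (1 - fps_X) = ?N S" if x: "x \<notin> S" for x S
  proof (rule fps_ext)
    fix k
    show "fps_nth (?N (insert x S) * (1 - fps_X)) k = fps_nth (?N S) k"
    proof (cases k)
      case 0
      then show ?thesis by (simp add: M0 right_diff_distrib)
    next
      case (Suc l)
      let ?f = "\<lambda>m. Poly_Mapping.single x 1 + m"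
      have "?M (insert x S) (Suc l) = ?M S (Suc l) \<union> ?f ` ?M (insert x S) l"
      proof (intro equalityI subsetI)
        fix m assume m: "m \<in> ?M (insert x S) (Suc l)"
        show "m \<in> ?M S (Suc l) \<union> ?f ` ?M (insert x S) l"
        proof (cases "Poly_Mapping.lookup m x = 0")
          case True
          then show ?thesis using m by (auto simp: in_keys_iff)
        next
          case False
          let ?m = "m - Poly_Mapping.single x 1"
          have eq: "m = ?f ?m" by (rule exponent_split[OF False])
          have "mdeg m = Suc (mdeg ?m)" by (subst eq) (simp only: mdeg_add mdeg_single)
          moreover have "Poly_Mapping.keys ?m \<subseteq> Poly_Mapping.keys m"
            by (auto simp: in_keys_iff lookup_minus)
          ultimately have "?m \<in> ?M (insert x S) l" using m by auto
          then show ?thesis using eq by blast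
        qed
      next
        fix m assume "m \<in> ?M S (Suc l) \<union> ?f ` ?M (insert x S) l"
        then show "m \<in> ?M (insert x S) (Suc l)"
        proof
          assume "m \<in> ?f ` ?M (insert x S) l"
          then obtain m' where m': "m = ?f m'" "m' \<in> ?M (insert x S) l" by blast
          have "mdeg m = Suc l" using m' by (simp add: mdeg_add mdeg_single)
          moreover have "Poly_Mapping.keys m \<subseteq> insert x S"
            using m' Poly_Mapping.keys_add[of "Poly_Mapping.single x 1" m'] by auto
          ultimately show ?thesis by simp
        qed auto
      qed
      moreover have "?M S (Suc l) \<inter> ?f ` ?M (insert x S) l = {}"
      proof -
        have "x \<in> Poly_Mapping.keys (?f m)" for m :: "'m \<Rightarrow>\<^sub>0 nat" by (simp add: in_keys_iff lookup_add)
        then show ?thesis using x by blast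
      qed
      moreover have "card (?f ` ?M (insert x S) l) = card (?M (insert x S) l)"
        by (intro card_image inj_onI) simp
      ultimately have "card (?M (insert x S) (Suc l)) = card (?M S (Suc l)) + card (?M (insert x S) l)"
        using card_Un_disjoint[OF fin[of S "Suc l"] finite_imageI[OF fin[of "insert x S" l], of ?f]] by simp
      then show ?thesis using Suc by (simp add: right_diff_distrib)
    qed
  qed
  have "finite S" by simp
  then show ?thesis
  proof (induction S rule: finite_induct)
    case empty
    have "?M {} k = (if k = 0 then {0} else {})" for k by auto
    then have "fps_nth (?N {}) k = fps_nth 1 k" for k by simp
    then have "?N {} = 1" by (intro fps_ext)
    then show ?case by simp
  next
    case (insert x S)
    have "?N (insert x S) * (1 - fps_X) ^ card (insert x S) = (?N (insert x S) * (1 - fps_X)) * (1 - fps_X) ^ card S"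
      using insert.hyps by (simp add: mult.assoc)
    then show ?case unfolding step[OF insert.hyps(2)] insert.IH .
  qed
qed

lemma dim_homogeneous:
  fixes A :: "'n \<Rightarrow> complex ^ 'm::finite"
  shows "MD.dim (log_piece A {} C 0 k) = card {m :: 'm \<Rightarrow>\<^sub>0 nat. mdeg m = k}"
proof -
  let ?M = "{m :: 'm \<Rightarrow>\<^sub>0 nat. mdeg m = k}"
  define e :: "('m \<Rightarrow>\<^sub>0 nat) \<Rightarrow> 'm cpoly list \<Rightarrow> 'm cpoly"
    where "e m = (\<lambda>gs. if gs = [] then Poly_Mapping.single m 1 else 0)" for m
  have V: "\<theta> \<in> log_piece A {} C 0 k \<longleftrightarrow> (\<forall>gs. gs \<noteq> [] \<longrightarrow> \<theta> gs = 0) \<and> homogeneous (int k) (\<theta> [])"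
    for \<theta> :: "'m cpoly list \<Rightarrow> 'm cpoly"
    by (auto simp: log_piece_def log_multider_def)
  have at_Nil: "(\<Sum>m\<in>?M. multider_scale (c m) (e m)) [] = (\<Sum>m\<in>?M. Poly_Mapping.single m (c m))" for c
    unfolding sum_fun_at by (intro sum.cong) (auto simp: multider_scale_def e_def single_Const[symmetric])
  have lookup: "Poly_Mapping.lookup (\<Sum>m\<in>?M. Poly_Mapping.single m (c m)) m = c m" if "m \<in> ?M" for c m
    using that by (simp add: lookup_sum lookup_single when_def finite_mdeg)
  have inj: "inj_on e ?M"
    by (rule inj_onI) (metis (no_types, lifting) e_def inj_single lookup_single_eq lookup_single_not_eq zero_neq_one)
  show ?thesis
  proof (rule MD.dim_unique[of "e ` ?M"])
    show "e ` ?M \<subseteq> log_piece A {} C 0 k"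
      unfolding V image_subset_iff subset_iff using homogeneous_single by (auto simp: e_def)
    show "card (e ` ?M) = card ?M" by (rule card_image[OF inj])
    show "log_piece A {} C 0 k \<subseteq> MD.span (e ` ?M)"
    proof
      fix \<theta> :: "'m cpoly list \<Rightarrow> 'm cpoly" assume \<theta>: "\<theta> \<in> log_piece A {} C 0 k"
      have "Poly_Mapping.keys (\<theta> []) \<subseteq> ?M" using \<theta> by (auto simp: V homogeneous_iff in_keys_iff)
      then have eq: "(\<Sum>m\<in>?M. Poly_Mapping.single m (Poly_Mapping.lookup (\<theta> []) m)) = \<theta> []"
        by (subst (2) cpoly_eq_sum_single)
          (intro sum.mono_neutral_right, auto simp: finite_mdeg in_keys_iff)
      have "\<theta> = (\<Sum>m\<in>?M. multider_scale (Poly_Mapping.lookup (\<theta> []) m) (e m))"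
      proof
        fix gs
        show "\<theta> gs = (\<Sum>m\<in>?M. multider_scale (Poly_Mapping.lookup (\<theta> []) m) (e m)) gs"
        proof (cases gs)
          case Nil
          then show ?thesis using eq by (simp only: at_Nil)
        next
          case (Cons g hs)
          then show ?thesis using \<theta> by (simp add: V sum_fun_at multider_scale_def e_def)
        qed
      qed
      also have "\<dots> \<in> MD.span (e ` ?M)" by (intro MD.span_sum MD.span_scale MD.span_base) auto
      finally show "\<theta> \<in> MD.span (e ` ?M)" .
    qed
    show "MD.independent (e ` ?M)"
    proof (rule MD.independent_if_scalars_zero)
      show "finite (e ` ?M)" using finite_mdeg by blast
      fix f x assume 0: "(\<Sum>x\<in>e ` ?M. multider_scale (f x) x) = 0" and "x \<in> e ` ?M"
      then obtain m where m: "x = e m" "m \<in> ?M" by blast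
      have "(\<Sum>m\<in>?M. multider_scale (f (e m)) (e m)) = 0"
        using 0 by (simp add: sum.reindex[OF inj])
      then have "(\<Sum>m\<in>?M. Poly_Mapping.single m (f (e m))) = 0"
        using at_Nil[of "\<lambda>m. f (e m)"] by simp
      then show "f x = 0" using lookup[OF m(2), of "\<lambda>m. f (e m)"] m(1) by simp
    qed
  qed
qed

lemma log_hilb_empty:
  fixes A :: "'n \<Rightarrow> complex ^ 'm::finite"
  shows "log_hilb A {} C 0 * (1 - fps_X) ^ CARD('m) = 1"
  using card_monomials[of "UNIV :: 'm set"] unfolding log_hilb_def dim_homogeneous by simp

text \<open>A derivation that vanishes on forms spanning the dual space vanishes on all
  variables.\<close>

lemma log_hilb_vanishing:
  fixes A :: "'n \<Rightarrow> complex ^ 'm::finite"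
  assumes "finite C" "\<And>i. \<exists>b. axis i 1 = (\<Sum>a\<in>C. b a *s a)"
  shows "log_hilb A J C (Suc p) = 0"
proof (rule fps_ext)
  fix k
  have "\<theta> = 0" if \<theta>: "\<theta> \<in> log_piece A J C (Suc p) k" for \<theta>
  proof
    fix gs show "\<theta> gs = 0 gs"
    proof (cases gs)
      case Nil
      then show ?thesis using multider_Nil[OF log_pieceD(1)[OF \<theta>]] by simp
    next
      case (Cons g hs)
      have der: "derivation (\<lambda>g. \<theta> (g # hs))" by (rule multider_head[OF log_pieceD(1)[OF \<theta>]])
      have "\<theta> (Var i # hs) = 0" for i
      proof -
        obtain b where b: "axis i 1 = (\<Sum>a\<in>C. b a *s a)" using assms(2) by blast
        have "Var i = (\<Sum>a\<in>C. Const (b a) * lform a)"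
          unfolding lform_axis[symmetric] b lform_sum lform_scale ..
        then have "\<theta> (Var i # hs) = (\<Sum>a\<in>C. Const (b a) * \<theta> (lform a # hs))"
          by (simp only: derivation_sum[OF der] derivation_Const_mult[OF der])
        then show ?thesis using log_pieceD(3)[OF \<theta>] by simp
      qed
      then show ?thesis using derivation_eq_0[OF der] Cons by simp
    qed
  qed
  then have "log_piece A J C (Suc p) k = {0}"
    using MD.subspace_0[OF subspace_log_piece] by blast
  then show "fps_nth (log_hilb A J C (Suc p)) k = fps_nth 0 k" by (simp add: MD.dim_zero)
qed

section \<open>Formal identities for the sum over \<open>p\<close>, and evaluation at one\<close>

section \<open>Values at one of power series which are polynomials\<close>

text \<open>Polynomiality and the value at one are asserted together, so that both pass through sums
  and products at once.\<close>

definition fps_value :: "int fps \<Rightarrow> int \<Rightarrow> bool" where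
  "fps_value f c \<longleftrightarrow> (\<exists>G. f = fps_of_poly G \<and> poly G 1 = c)"

lemma fps_valueI: "f = fps_of_poly G \<Longrightarrow> poly G 1 = c \<Longrightarrow> fps_value f c"
  by (auto simp: fps_value_def)

lemma poly_fps_value:
  assumes "poly_fps f" obtains c where "fps_value f c"
  using assms by (metis poly_fpsE fps_valueI)

lemma fps_value_add: "fps_value f a \<Longrightarrow> fps_value g b \<Longrightarrow> fps_value (f + g) (a + b)"
  unfolding fps_value_def by (metis fps_of_poly_add poly_add)

lemma fps_value_diff: "fps_value f a \<Longrightarrow> fps_value g b \<Longrightarrow> fps_value (f - g) (a - b)"
  unfolding fps_value_def by (metis fps_of_poly_diff poly_diff)

lemma fps_value_mult: "fps_value f a \<Longrightarrow> fps_value g b \<Longrightarrow> fps_value (f * g) (a * b)"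
  unfolding fps_value_def by (metis fps_of_poly_mult poly_mult)

lemma fps_value_of_int: "fps_value (of_int a) a"
proof (rule fps_valueI[of _ "[:a:]"])
  show "of_int a = fps_of_poly [:a:]" by (simp add: fps_of_poly_pCons flip: fps_of_int)
qed simp

lemma fps_value_1: "fps_value 1 1"
  using fps_value_of_int[of 1] by simp

lemma fps_value_0: "fps_value 0 0"
  using fps_value_of_int[of 0] by simp

lemma fps_value_power: "fps_value f a \<Longrightarrow> fps_value (f ^ n) (a ^ n)"
  by (induction n) (auto intro: fps_value_1 fps_value_mult)

lemma fps_value_minus_one_power: "fps_value ((-1) ^ n) ((-1) ^ n)"
  using fps_value_of_int[of "(-1) ^ n"] by simp

lemma fps_value_X: "fps_value fps_X 1"
  by (rule fps_valueI[of _ "[:0, 1:]"]) simp_all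

lemma fps_value_1_minus_X: "fps_value (1 - fps_X) 0"
  using fps_value_diff[OF fps_value_1 fps_value_X] by simp

lemma fps_value_sum: "(\<And>x. x \<in> A \<Longrightarrow> fps_value (f x) (c x)) \<Longrightarrow> fps_value (sum f A) (sum c A)"
  by (induction A rule: infinite_finite_induct) (auto intro: fps_value_0 fps_value_add)

lemma fps_value_unique: "fps_value f a \<Longrightarrow> fps_value f b \<Longrightarrow> a = b"
  by (auto simp: fps_value_def fps_of_poly_eq_iff)


section \<open>The polynomial \<open>\<Sum>\<^sub>p H\<^sub>p (z - 1)\<^sup>p\<close>\<close>

text \<open>The variable \<open>z\<close> stands for \<open>s (1 - X)\<close>. Keeping it formal
  holds back the factor \<open>(1 - X) ^ j\<close>, which has to cancel the poles.\<close>

definition gen_poly :: "nat \<Rightarrow> (nat \<Rightarrow> int fps) \<Rightarrow> int fps poly" where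
  "gen_poly m H = (\<Sum>p\<le>m. [:H p:] * [:- 1, 1:] ^ p)"

text \<open>Up to order \<open>n\<close> both sides differ by one top term, which
  \<open>K m = 0\<close> removes at the end. For \<open>c = 1\<close>, the case of a constant field,
  the new factor is \<open>z\<close> itself.\<close>

lemma gen_poly_split:
  assumes "H 0 = K 0" "\<And>p. H (Suc p) = K (Suc p) + c * K p" "K m = 0"
  shows "gen_poly m H = (1 + [:c:] * [:- 1, 1:]) * gen_poly m K"
proof -
  have "gen_poly n H = (1 + [:c:] * [:- 1, 1:]) * gen_poly n K - [:c * K n:] * [:- 1, 1:] ^ Suc n" for n
  proof (induction n)
    case 0
    have "gen_poly 0 H = [:K 0:]" "gen_poly 0 K = [:K 0:]" by (simp_all add: gen_poly_def assms(1))
    then show ?case by (simp add: one_pCons algebra_simps)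
  next
    case (Suc n)
    let ?Y = "[:- 1, 1:] :: int fps poly"
    have eqs: "[:c * K p:] = [:c:] * [:K p:]" for p by simp
    have H: "[:H (Suc n):] = [:K (Suc n):] + [:c:] * [:K n:]" by (simp add: assms(2))
    have gH: "gen_poly (Suc n) H = gen_poly n H + [:H (Suc n):] * ?Y ^ Suc n"
      and K: "gen_poly (Suc n) K = gen_poly n K + [:K (Suc n):] * ?Y ^ Suc n"
      by (simp_all only: gen_poly_def sum.atMost_Suc)
    have alg: "(1 + C * Y) * G - C * k * (Y * Z) + (k' + C * k) * (Y * Z)
        = (1 + C * Y) * (G + k' * (Y * Z)) - C * k' * (Y * (Y * Z))" for C Y G k k' Z :: "int fps poly"
      by (simp add: algebra_simps)
    show ?case unfolding gH Suc.IH H K eqs power_Suc by (rule alg)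
  qed
  from this[of m] assms(3) show ?thesis by simp
qed

lemma coeff_gen_poly: "coeff (gen_poly m H) j = (\<Sum>p\<le>m. H p * coeff ([:- 1, 1:] ^ p) j)"
  by (simp add: gen_poly_def coeff_sum)

lemma coeff_minus_one_power:
  "coeff ([:- 1, 1:] ^ p :: int fps poly) j = of_nat (p choose j) * (-1) ^ (p - j)"
proof (cases "j \<le> p")
  case True
  then show ?thesis by (simp add: coeff_linear_poly_power)
next
  case False
  have "degree ([:- 1, 1:] ^ p :: int fps poly) \<le> 1 * p"
    by (rule degree_power_le[THEN order_trans]) simp
  then show ?thesis using False by (simp add: coeff_eq_0)
qed

lemma fps_value_coeff_minus_one_power:
  "\<exists>c. fps_value (coeff ([:- 1, 1:] ^ p :: int fps poly) j) c"
  unfolding coeff_minus_one_power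
  using fps_value_mult[OF fps_value_of_int[of "int (p choose j)"] fps_value_minus_one_power[of "p - j"]]
  by auto

text \<open>The coefficient of \<open>s\<^sup>j\<close> in \<open>\<Sum>\<^sub>p H\<^sub>p (s (1 - X) - 1)\<^sup>p\<close>.\<close>

definition psi :: "nat \<Rightarrow> (nat \<Rightarrow> int fps) \<Rightarrow> nat \<Rightarrow> int fps" where
  "psi m H j = (1 - fps_X) ^ j * coeff (gen_poly m H) j"

text \<open>The substitution \<open>s = -1/X\<close>, for which \<open>s (1 - X) - 1\<close> becomes \<open>-1/X\<close>, with
  denominators cleared.\<close>

lemma psi_alternating_sum:
  "(\<Sum>j\<le>m. (-1) ^ j * fps_X ^ (m - j) * psi m H j) = (\<Sum>p\<le>m. (-1) ^ p * fps_X ^ (m - p) * H p)"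
proof -
  let ?X = "fps_X :: int fps"
  \<comment> \<open>Once signs and powers of \<open>X\<close> are collected, the binomial theorem
    gives \<open>((1 - X) + X) ^ p = 1\<close>.\<close>
  have inner: "(\<Sum>j\<le>m. (-1) ^ j * ?X ^ (m - j) * (1 - ?X) ^ j * (of_nat (p choose j) * (-1) ^ (p - j)))
      = (-1) ^ p * ?X ^ (m - p)" if p: "p \<le> m" for p
  proof -
    have "(\<Sum>j\<le>m. (-1) ^ j * ?X ^ (m - j) * (1 - ?X) ^ j * (of_nat (p choose j) * (-1) ^ (p - j)))
        = (\<Sum>j\<le>p. (-1) ^ j * ?X ^ (m - j) * (1 - ?X) ^ j * (of_nat (p choose j) * (-1) ^ (p - j)))"
      using p by (intro sum.mono_neutral_right) auto
    also have "\<dots> = (\<Sum>j\<le>p. (-1) ^ p * ?X ^ (m - p) * (of_nat (p choose j) * (1 - ?X) ^ j * ?X ^ (p - j)))"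
    proof (rule sum.cong)
      fix j assume j: "j \<in> {..p}"
      have "?X ^ (m - j) = ?X ^ (m - p) * ?X ^ (p - j)"
        using j p by (simp flip: power_add)
      moreover have "(-1 :: int fps) ^ p = (-1) ^ j * (-1) ^ (p - j)"
        using j by (simp flip: power_add)
      ultimately show "(-1) ^ j * ?X ^ (m - j) * (1 - ?X) ^ j * (of_nat (p choose j) * (-1) ^ (p - j))
          = (-1) ^ p * ?X ^ (m - p) * (of_nat (p choose j) * (1 - ?X) ^ j * ?X ^ (p - j))"
        by (simp only: mult_ac)
    qed simp
    also have "\<dots> = (-1) ^ p * ?X ^ (m - p) * ((1 - ?X) + ?X) ^ p"
      by (simp only: binomial_ring sum_distrib_left)
    finally show ?thesis by simp
  qed
  have "(\<Sum>j\<le>m. (-1) ^ j * ?X ^ (m - j) * psi m H j) = (\<Sum>j\<le>m. \<Sum>p\<le>m.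
      H p * ((-1) ^ j * ?X ^ (m - j) * (1 - ?X) ^ j * (of_nat (p choose j) * (-1) ^ (p - j))))"
    by (intro sum.cong refl)
      (simp only: psi_def coeff_gen_poly coeff_minus_one_power sum_distrib_left mult_ac)
  also have "\<dots> = (\<Sum>p\<le>m. H p * (\<Sum>j\<le>m.
      (-1) ^ j * ?X ^ (m - j) * (1 - ?X) ^ j * (of_nat (p choose j) * (-1) ^ (p - j))))"
    by (subst sum.swap) (simp only: sum_distrib_left)
  also have "\<dots> = (\<Sum>p\<le>m. (-1) ^ p * ?X ^ (m - p) * H p)"
    using inner by (intro sum.cong refl) (simp only: atMost_iff mult_ac)
  finally show ?thesis .
qed

text \<open>The sum telescopes: up to order \<open>n\<close> only the term with \<open>u n\<close>
  is left.\<close>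

lemma Euler_alternating_sum:
  fixes H u :: "nat \<Rightarrow> int fps"
  assumes "H 0 = u 0" "\<And>p. H (Suc p) = u (Suc p) + fps_X * u p" "u m = 0"
  shows "(\<Sum>p\<le>m. (-1) ^ p * fps_X ^ (m - p) * H p) = 0"
proof -
  have "(\<Sum>p\<le>n. (-1) ^ p * fps_X ^ (m - p) * H p) = (-1) ^ n * fps_X ^ (m - n) * u n" if "n \<le> m" for n
    using that
  proof (induction n)
    case (Suc n)
    have "m - n = Suc (m - Suc n)" using Suc.prems by simp
    then have "fps_X ^ (m - n) = fps_X * (fps_X ^ (m - Suc n) :: int fps)" by simp
    with Suc show ?case by (simp add: assms(2) algebra_simps)
  qed (simp add: assms(1))
  from this[of m] assms(3) show ?thesis by simp
qed


section \<open>Sums over subsets\<close>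

lemma sum_Pow_insert:
  assumes "finite I" "x \<notin> I"
  shows "(\<Sum>K\<in>Pow (insert x I). F K) = (\<Sum>K\<in>Pow I. F K + F (insert x K))"
proof -
  have "(\<Sum>K\<in>Pow (insert x I). F K) = (\<Sum>K\<in>Pow I. F K) + (\<Sum>K\<in>insert x ` Pow I. F K)"
    unfolding Pow_insert using assms by (intro sum.union_disjoint) auto
  also have "(\<Sum>K\<in>insert x ` Pow I. F K) = (\<Sum>K\<in>Pow I. F (insert x K))"
    using assms by (subst sum.reindex) (auto simp: inj_on_def)
  finally show ?thesis by (simp add: sum.distrib)
qed

lemma card_insert_Pow: "finite I \<Longrightarrow> x \<notin> I \<Longrightarrow> K \<in> Pow I \<Longrightarrow> card (insert x K) = Suc (card K)"
  by (metis PowD card_insert_disjoint finite_subset in_mono)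

lemma sum_alternating_Pow:
  assumes "finite I" "I \<noteq> {}"
  shows "(\<Sum>K\<in>Pow I. (-1) ^ card K) = (0 :: int)"
proof -
  obtain x J where "I = insert x J" "x \<notin> J" using assms(2) by (metis Set.set_insert ex_in_conv)
  then show ?thesis using assms(1) by (simp add: sum_Pow_insert card_insert_Pow)
qed

text \<open>The signed sum over subsets is its own inverse; it extracts from Whitney's sum the
  contribution of \<open>J\<close> alone.\<close>

lemma inclusion_exclusion_Pow:
  fixes g :: "'a set \<Rightarrow> int"
  assumes "finite J"
  shows "(\<Sum>I\<in>Pow J. (-1) ^ card I * (\<Sum>K\<in>Pow I. (-1) ^ card K * g K)) = g J"
  using assms
proof (induction J arbitrary: g rule: finite_induct)
  case (insert x J)
  let ?S = "\<lambda>g I. \<Sum>K\<in>Pow I. (-1) ^ card K * g K"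
  have S: "?S g (insert x I) = ?S g I - ?S (\<lambda>K. g (insert x K)) I" if "I \<in> Pow J" for I
  proof -
    have I: "finite I" "x \<notin> I" using that insert.hyps finite_subset by auto
    show ?thesis
      by (simp add: sum_Pow_insert[OF I] card_insert_Pow[OF I] sum_subtractf sum.distrib sum_negf)
  qed
  have "(\<Sum>I\<in>Pow (insert x J). (-1) ^ card I * ?S g I)
      = (\<Sum>I\<in>Pow J. (-1) ^ card I * ?S g I + (-1) ^ card (insert x I) * ?S g (insert x I))"
    by (rule sum_Pow_insert[OF insert.hyps])
  also have "\<dots> = (\<Sum>I\<in>Pow J. (-1) ^ card I * ?S (\<lambda>K. g (insert x K)) I)"
    by (intro sum.cong refl) (simp only: S card_insert_Pow[OF insert.hyps] power_Suc, simp add: algebra_simps)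
  also have "\<dots> = g (insert x J)" by (rule insert.IH)
  finally show ?case .
qed simp


section \<open>The induction over subarrangements\<close>

section \<open>The value at one for all subarrangements\<close>

lemma lform_vector_field_const: "vector_field (\<lambda>i. Const (v $ i)) (lform a) = Const (cdot a v)"
  by (simp add: vector_field_lform cdot_def Const_sum Const_mult)

text \<open>There is nothing in order \<open>m + 1\<close>, and dimensions are nonnegative, so both
  terms of the relation vanish there.\<close>

lemma log_hilb_top_zero:
  fixes A :: "'n \<Rightarrow> complex ^ 'm::finite"
  assumes "\<And>p. log_hilb A J C (Suc p) = log_hilb A J C' (Suc p) + log_hilb A J C' p"
  shows "log_hilb A J C' CARD('m) = 0"
proof (rule fps_ext)
  fix k
  have "fps_nth (log_hilb A J C (Suc CARD('m))) k = 0" by (simp only: log_hilb_large lessI fps_zero_nth)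
  then show "fps_nth (log_hilb A J C' CARD('m)) k = fps_nth 0 k" unfolding assms by simp
qed

lemma log_hilb_Euler_top_zero:
  fixes A :: "'n \<Rightarrow> complex ^ 'm::{finite,linorder}"
  assumes "central_arrangement A" "i \<in> J"
  shows "log_hilb A J {A i} CARD('m) = 0"
proof (rule fps_ext)
  fix k
  have "fps_nth (log_hilb A J {} (Suc CARD('m))) (Suc k) = 0"
    by (simp only: log_hilb_large lessI fps_zero_nth)
  then show "fps_nth (log_hilb A J {A i} CARD('m)) k = fps_nth 0 k"
    unfolding log_hilb_Euler[OF assms] by simp
qed

text \<open>The constant field along a vector \<open>v b\<close> of the flat kills the forms of
  \<open>J\<close>, and by duality all \<open>h a\<close> with \<open>a \<noteq> b\<close>. Each
  field split off gives a factor \<open>z\<close>.\<close>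

lemma gen_poly_log_hilb:
  fixes A :: "'n \<Rightarrow> complex ^ 'm::finite" and T :: "'m set"
  assumes "finite T" "\<And>a b. cdot (h a) (v b) = (if a = b then 1 else 0)" "\<And>b. b \<in> T \<Longrightarrow> v b \<in> flat A J"
  shows "gen_poly CARD('m) (log_hilb A J {}) = monom 1 (card T) * gen_poly CARD('m) (log_hilb A J (h ` T))"
  using assms(1,3)
proof (induction T rule: finite_induct)
  case empty
  then show ?case by simp
next
  case (insert b T)
  let ?\<delta> = "vector_field (\<lambda>i. Const (v b $ i))"
  have split: "log_hilb A J (h ` T) (Suc p)
      = log_hilb A J (insert (h b) (h ` T)) (Suc p) + log_hilb A J (insert (h b) (h ` T)) p" for p
  proof (rule log_hilb_split[of ?\<delta>])
    show "?\<delta> (lform (A i)) = 0" if "i \<in> J" for i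
      using insert.prems[of b] that by (simp add: lform_vector_field_const mem_flat)
    show "?\<delta> (lform c) = 0" if "c \<in> h ` T" for c
      using insert.hyps(2) that assms(2) by (auto simp: lform_vector_field_const)
    show "?\<delta> (lform (h b)) = 1" using assms(2) by (simp add: lform_vector_field_const)
  qed (simp_all add: derivation_vector_field vector_field_Var homogeneous_Const)
  have "gen_poly CARD('m) (log_hilb A J (h ` T))
      = (1 + [:1:] * [:- 1, 1:]) * gen_poly CARD('m) (log_hilb A J (insert (h b) (h ` T)))"
    by (rule gen_poly_split) (simp_all add: split log_hilb_0 log_hilb_top_zero[OF split])
  also have "1 + [:1:] * [:- 1, 1:] = (monom 1 1 :: int fps poly)"
    by (simp add: monom_altdef one_pCons)
  finally show ?case
    using insert by (simp add: mult_monom flip: mult.assoc)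
qed

text \<open>\<open>char_coeff A J j\<close> is the coefficient of \<open>t\<^sup>j\<close> in Whitney's expression
  \<open>\<Sum>\<^sub>I (-1)\<^bsup>|I|\<^esup> t\<^bsup>dim I\<^esup>\<close> for the characteristic polynomial of the subarrangement \<open>J\<close>.\<close>

definition char_coeff :: "('n \<Rightarrow> complex ^ 'm::finite) \<Rightarrow> 'n set \<Rightarrow> nat \<Rightarrow> int" where
  "char_coeff A J j = (\<Sum>I\<in>Pow J. (-1) ^ card I * (if vec.dim (flat A I) = j then 1 else 0))"

lemma dim_flat_le: "vec.dim (flat A J) \<le> CARD('m)" for A :: "'n \<Rightarrow> complex ^ 'm::finite"
  using vec.dim_subset_UNIV[of "flat A J"] by (simp add: card_cart_basis vec.dimension_def)

text \<open>At \<open>t = 1\<close> Whitney's expression counts the subsets of \<open>J\<close> with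
  signs.\<close>

lemma sum_char_coeff:
  fixes A :: "'n \<Rightarrow> complex ^ 'm::finite"
  assumes "finite J" "J \<noteq> {}"
  shows "(\<Sum>j\<le>CARD('m). char_coeff A J j) = 0"
proof -
  have "(\<Sum>j\<le>CARD('m). char_coeff A J j)
      = (\<Sum>I\<in>Pow J. (-1) ^ card I * (\<Sum>j\<le>CARD('m). if vec.dim (flat A I) = j then 1 else 0))"
    unfolding char_coeff_def by (subst sum.swap) (simp only: sum_distrib_left)
  also have "\<dots> = (\<Sum>I\<in>Pow J. (-1) ^ card I)"
    using dim_flat_le[of A] by (intro sum.cong) auto
  finally show ?thesis using sum_alternating_Pow[OF assms] by simp
qed

text \<open>All \<open>m\<close> constant fields split off, which leaves only order 0; there
  \<open>(1 - X) ^ m\<close> cancels the Hilbert series of the polynomial ring.\<close>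

lemma psi_empty:
  fixes A :: "'n::finite \<Rightarrow> complex ^ 'm::{finite,linorder}"
  shows "psi CARD('m) (log_hilb A {} {}) j = (if j = CARD('m) then 1 else 0)"
proof -
  obtain T v h where "adapted_basis A {} T v h" using exists_adapted_basis by blast
  then have T: "card T = vec.dim (flat A {})"
    and dual: "\<And>a b. cdot (h a) (v b) = (if a = b then 1 else 0)"
    and vT: "\<And>b. b \<in> T \<Longrightarrow> v b \<in> flat A {}"
    and span: "\<And>i. \<exists>b. axis i 1 = (\<Sum>a\<in>A ` {} \<union> h ` T. b a *s a)"
    unfolding adapted_basis_def by blast+
  have cT: "card T = CARD('m)" using T by (simp add: flat_def vec.dim_UNIV card_cart_basis)
  have "finite T" by simp
  have zero: "log_hilb A {} (h ` T) (Suc p) = 0" for p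
    using span by (intro log_hilb_vanishing) auto
  have "gen_poly n (log_hilb A {} (h ` T)) = [:log_hilb A {} (h ` T) 0:]" for n
    by (induction n) (simp_all add: gen_poly_def zero)
  then have "coeff (gen_poly CARD('m) (log_hilb A {} {})) j
      = (if j = CARD('m) then log_hilb A {} (h ` T) 0 else 0)"
    using gen_poly_log_hilb[OF \<open>finite T\<close> dual vT]
    by (auto simp: cT coeff_monom_mult coeff_pCons split: nat.splits)
  then show ?thesis
    using log_hilb_empty[of A "h ` T"] by (simp add: psi_def mult.commute)
qed

text \<open>A common factor \<open>z ^ d\<close> comes out of all terms. For
  \<open>j \<ge> d\<close> what remains is \<open>(1 - X) ^ (j - d)\<close> times a polynomial,
  which vanishes at one unless \<open>j = d\<close>.\<close>

lemma boolean_sum_psi: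
  fixes A :: "'n::finite \<Rightarrow> complex ^ 'm::{finite,linorder}"
  shows "\<exists>c. \<forall>j. fps_value (\<Sum>I\<in>Pow J. (-1) ^ card I * psi CARD('m) (log_hilb A I {}) j)
    (if j = vec.dim (flat A J) then c else 0)"
proof -
  obtain T v h where "adapted_basis A J T v h" using exists_adapted_basis by blast
  then have T: "card T = vec.dim (flat A J)"
    and dual: "\<And>a b. cdot (h a) (v b) = (if a = b then 1 else 0)"
    and vT: "\<And>b. b \<in> T \<Longrightarrow> v b \<in> flat A J"
    and span: "\<And>i. \<exists>b. axis i 1 = (\<Sum>a\<in>A ` J \<union> h ` T. b a *s a)"
    unfolding adapted_basis_def by blast+
  have "inj h" using dual by (metis injI zero_neq_one)
  obtain hs where hs: "set hs = h ` T" "distinct hs"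
    using finite_distinct_list[of "h ` T"] by auto
  have len: "length hs = card T"
    using hs card_image[of h T] \<open>inj h\<close> by (metis distinct_card inj_on_subset subset_UNIV)
  let ?d = "card T"
  define S where "S p = (\<Sum>I\<in>Pow J. (-1) ^ card I * log_hilb A I (h ` T) p)" for p
  have "poly_fps ((1 - fps_X) ^ ?d * S p)" for p
    using log_hilb_boolean[of J A hs "h ` T" p] span unfolding S_def hs(1) len by simp
  then have "\<exists>c. fps_value ((1 - fps_X) ^ ?d * S p) c" for p by (metis poly_fps_value)
  then obtain s where s: "\<And>p. fps_value ((1 - fps_X) ^ ?d * S p) (s p)" by metis
  obtain q where q: "\<And>p l. fps_value (coeff ([:- 1, 1:] ^ p :: int fps poly) l) (q p l)"
    using fps_value_coeff_minus_one_power by metis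
  have gen: "gen_poly CARD('m) (log_hilb A I {}) = monom 1 ?d * gen_poly CARD('m) (log_hilb A I (h ` T))"
    if "I \<in> Pow J" for I
    using that vT by (intro gen_poly_log_hilb[OF _ dual]) (auto simp: mem_flat)
  have coeff: "(\<Sum>I\<in>Pow J. (-1) ^ card I * coeff (gen_poly CARD('m) (log_hilb A I (h ` T))) l)
      = (\<Sum>p\<le>CARD('m). S p * coeff ([:- 1, 1:] ^ p) l)" for l
    unfolding coeff_gen_poly S_def sum_distrib_left sum_distrib_right
    by (subst sum.swap) (simp only: mult.assoc)
  have val: "fps_value ((1 - fps_X) ^ ?d * (\<Sum>p\<le>CARD('m). S p * coeff ([:- 1, 1:] ^ p) l))
      (\<Sum>p\<le>CARD('m). s p * q p l)" for l
    unfolding sum_distrib_left mult.assoc[symmetric]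
    by (intro fps_value_sum fps_value_mult s q)
  have main: "(\<Sum>I\<in>Pow J. (-1) ^ card I * psi CARD('m) (log_hilb A I {}) j) =
      (if j < ?d then 0 else (1 - fps_X) ^ (j - ?d) *
        ((1 - fps_X) ^ ?d * (\<Sum>p\<le>CARD('m). S p * coeff ([:- 1, 1:] ^ p) (j - ?d))))" for j
  proof -
    have "(\<Sum>I\<in>Pow J. (-1) ^ card I * psi CARD('m) (log_hilb A I {}) j) =
        (\<Sum>I\<in>Pow J. if j < ?d then 0 else (1 - fps_X) ^ j *
          ((-1) ^ card I * coeff (gen_poly CARD('m) (log_hilb A I (h ` T))) (j - ?d)))"
      by (intro sum.cong refl) (simp add: psi_def gen coeff_monom_mult mult.left_commute)
    also have "\<dots> = (if j < ?d then 0 else (1 - fps_X) ^ j *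
        (\<Sum>p\<le>CARD('m). S p * coeff ([:- 1, 1:] ^ p) (j - ?d)))"
      by (simp add: sum_distrib_left[symmetric] coeff)
    finally show ?thesis by (simp flip: mult.assoc power_add)
  qed
  let ?c = "\<Sum>p\<le>CARD('m). s p * q p 0"
  have "fps_value (\<Sum>I\<in>Pow J. (-1) ^ card I * psi CARD('m) (log_hilb A I {}) j)
      (if j = ?d then ?c else 0)" for j
  proof (cases j ?d rule: linorder_cases)
    case less
    then show ?thesis unfolding main by (simp add: fps_value_0)
  next
    case equal
    then show ?thesis unfolding main using val[of 0] by simp
  next
    case greater
    then show ?thesis
      unfolding main
      using fps_value_mult[OF fps_value_power[OF fps_value_1_minus_X, of "j - ?d"] val[of "j - ?d"]]
      by (simp add: zero_power)
  qed
  then show ?thesis unfolding T by blast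
qed

lemma fps_value_psi:
  fixes A :: "'n::finite \<Rightarrow> complex ^ 'm::{finite,linorder}"
  assumes A: "central_arrangement A"
  shows "fps_value (psi CARD('m) (log_hilb A J {}) j) ((-1) ^ (CARD('m) + j) * char_coeff A J j)"
proof -
  have "finite J" by simp
  then show ?thesis
  proof (induction J arbitrary: j rule: finite_psubset_induct)
    case (psubset J)
    let ?m = "CARD('m)" and ?d = "vec.dim (flat A J)"
    let ?psi = "\<lambda>I. psi ?m (log_hilb A I {})"
    show ?case
    proof (cases "J = {}")
      case True
      have "char_coeff A {} j = (if j = ?m then 1 else 0)"
        by (simp add: char_coeff_def flat_def vec.dim_UNIV card_cart_basis)
      then show ?thesis
        unfolding True psi_empty by (simp add: fps_value_0 fps_value_1 flip: mult_2 power_mult)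
    next
      case False
      then obtain i where i: "i \<in> J" by blast
      obtain c where c: "\<And>j. fps_value (\<Sum>I\<in>Pow J. (-1) ^ card I * ?psi I j) (if j = ?d then c else 0)"
        using boolean_sum_psi[of A J] by blast
      \<comment> \<open>\<open>c\<close> should be \<open>(-1) ^ (?m + ?d)\<close>, the contribution
        of \<open>J\<close> to Whitney's sum. \<open>?e\<close> is the deviation up to sign, and it
        affects only the coefficient \<open>j = ?d\<close>.\<close>
      let ?e = "(-1) ^ card J * (c - (-1) ^ (?m + ?d))"
      let ?w = "\<lambda>j. (-1) ^ (?m + j) * char_coeff A J j + (if j = ?d then ?e else 0)"
      have val: "fps_value (?psi J j) (?w j)" for j
      proof -
        let ?P = "Pow J - {J}"
        have lower: "fps_value (\<Sum>I\<in>?P. (-1) ^ card I * ?psi I j)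
            (\<Sum>I\<in>?P. (-1) ^ card I * ((-1) ^ (?m + j) * char_coeff A I j))"
          by (intro fps_value_sum fps_value_mult fps_value_minus_one_power psubset.IH) auto
        have split: "sum F (Pow J) = F J + sum F ?P" for F :: "'n set \<Rightarrow> 'a::comm_monoid_add"
          by (rule sum.remove) auto
        have sq: "(-1) ^ card J * ((-1) ^ card J * x) = x" for x :: "'a::comm_ring_1"
          by (simp flip: mult.assoc power_add mult_2 power_mult)
        have "?psi J j = (-1) ^ card J * ((\<Sum>I\<in>Pow J. (-1) ^ card I * ?psi I j) - (\<Sum>I\<in>?P. (-1) ^ card I * ?psi I j))"
          unfolding split by (simp add: sq)
        moreover have "fps_value \<dots> ((-1) ^ card J * ((if j = ?d then c else 0) -
            (\<Sum>I\<in>?P. (-1) ^ card I * ((-1) ^ (?m + j) * char_coeff A I j))))"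
          by (intro fps_value_mult fps_value_minus_one_power fps_value_diff c lower)
        moreover have "(\<Sum>I\<in>?P. (-1) ^ card I * ((-1) ^ (?m + j) * char_coeff A I j))
            = (-1) ^ (?m + j) * ((if ?d = j then 1 else 0) - (-1) ^ card J * char_coeff A J j)"
        proof -
          have "(\<Sum>I\<in>Pow J. (-1) ^ card I * char_coeff A I j) = (if ?d = j then 1 else 0)"
            unfolding char_coeff_def by (rule inclusion_exclusion_Pow) simp
          then have eq: "(\<Sum>I\<in>?P. (-1) ^ card I * char_coeff A I j)
              = (if ?d = j then 1 else 0) - (-1) ^ card J * char_coeff A J j"
            unfolding split by simp
          show ?thesis
            unfolding eq[symmetric] sum_distrib_left
            by (simp only: mult.left_commute)
        qed
        moreover have "(-1) ^ card J * ((if j = ?d then c else 0) -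
            (-1) ^ (?m + j) * ((if ?d = j then 1 else 0) - (-1) ^ card J * char_coeff A J j)) = ?w j"
          using sq[of "(-1) ^ (?m + j) * char_coeff A J j"] by (auto simp: algebra_simps)
        ultimately show ?thesis by simp
      qed
      \<comment> \<open>At \<open>X = 1\<close> this relation becomes vanishing at
        \<open>s = -1\<close>. The part from \<open>char_coeff\<close> vanishes there by itself,
        which forces \<open>?e = 0\<close>.\<close>
      have "(\<Sum>j\<le>?m. (-1) ^ j * fps_X ^ (?m - j) * ?psi J j) = 0"
        unfolding psi_alternating_sum
        by (rule Euler_alternating_sum[of _ "log_hilb A J {A i}"])
          (simp_all add: log_hilb_0 log_hilb_Euler[OF A i] log_hilb_Euler_top_zero[OF A i])
      moreover have "fps_value (\<Sum>j\<le>?m. (-1) ^ j * fps_X ^ (?m - j) * ?psi J j)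
          (\<Sum>j\<le>?m. (-1) ^ j * 1 ^ (?m - j) * ?w j)"
        by (intro fps_value_sum fps_value_mult fps_value_minus_one_power fps_value_power fps_value_X val)
      ultimately have "(\<Sum>j\<le>?m. (-1) ^ j * ?w j) = 0"
        using fps_value_unique[OF _ fps_value_0] by simp
      moreover have "(\<Sum>j\<le>?m. (-1) ^ j * ?w j)
          = (-1) ^ ?m * (\<Sum>j\<le>?m. char_coeff A J j) + (-1) ^ ?d * ?e"
      proof -
        have "(-1) ^ j * ?w j = (-1) ^ ?m * char_coeff A J j + (if j = ?d then (-1) ^ ?d * ?e else 0)" for j
        proof -
          have sign: "(-1) ^ j * ((-1) ^ (?m + j) * x) = (-1) ^ ?m * x" for x :: int
            by (simp add: power_add flip: mult.assoc)
          show ?thesis unfolding distrib_left sign by simp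
        qed
        then have "(\<Sum>j\<le>?m. (-1) ^ j * ?w j) = (\<Sum>j\<le>?m. (-1) ^ ?m * char_coeff A J j)
            + (\<Sum>j\<le>?m. if j = ?d then (-1) ^ ?d * ?e else 0)"
          by (simp only: sum.distrib)
        also have "(\<Sum>j\<le>?m. if j = ?d then (-1) ^ ?d * ?e else 0) = (-1) ^ ?d * ?e"
          using dim_flat_le[of A J] by (subst sum.delta) auto
        finally show ?thesis by (simp only: sum_distrib_left)
      qed
      ultimately have "?e = 0" using sum_char_coeff[of J A] False by simp
      then show ?thesis using val[of j] by (simp only: if_cancel add_0_right)
    qed
  qed
qed

section \<open>Whitney's theorem\<close>

section \<open>The characteristic polynomial\<close>

lemma intersection_lattice_eq: "intersection_lattice A = range (flat A)"
  by (auto simp: intersection_lattice_def flat_def)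

lemma flat_empty [simp]: "flat A {} = UNIV"
  by (simp add: flat_def)

lemma subset_flat_iff: "X \<subseteq> flat A I \<longleftrightarrow> (\<forall>i\<in>I. X \<subseteq> hyperplane A i)"
  by (auto simp: flat_def)

lemma hyperplane_proper:
  assumes "A i \<noteq> 0"
  shows "hyperplane A i \<noteq> UNIV"
proof -
  obtain j where "A i $ j \<noteq> 0" using assms by (auto simp: vec_eq_iff)
  moreover have "(\<Sum>k\<in>UNIV. A i $ k * axis j 1 $ k) = A i $ j"
    by (simp add: axis_def if_distrib[of "\<lambda>x. _ * x"] cong: if_cong)
  ultimately have "axis j 1 \<notin> hyperplane A i" by (simp add: hyperplane_def)
  then show ?thesis by blast
qed

text \<open>Induction on the number of flats strictly above \<open>X\<close>. The signed sums obey
  the recursion of the Moebius function: for \<open>X \<noteq> UNIV\<close> the sets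
  \<open>I\<close> with \<open>X \<subseteq> flat A I\<close> are all subsets of a nonempty set, so
  their signs cancel.\<close>

lemma moebius_eq_alternating_sum:
  fixes A :: "'n::finite \<Rightarrow> complex ^ 'm::finite"
  assumes A: "\<And>i. A i \<noteq> 0" and X: "X \<in> intersection_lattice A"
  shows "moebius (intersection_lattice A) UNIV X = (\<Sum>I | flat A I = X. (-1) ^ card I)"
  using X
proof (induction "card {Y \<in> intersection_lattice A. X \<subset> Y}" arbitrary: X rule: less_induct)
  case less
  let ?L = "intersection_lattice A"
  have fin: "finite ?L" unfolding intersection_lattice_eq by simp
  have flat_UNIV: "flat A I = UNIV \<longleftrightarrow> I = {}" for I
    using hyperplane_proper[of A, OF A] by (auto simp: flat_def)
  show ?case
  proof (cases "X = UNIV")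
    case True
    then show ?thesis by (simp add: flat_UNIV moebius.simps)
  next
    case False
    let ?above = "{Y \<in> ?L. X \<subset> Y}"
    have "moebius ?L UNIV X = - (\<Sum>Y\<in>?above. moebius ?L UNIV Y)"
      by (subst moebius.simps) (use False fin in auto)
    also have "(\<Sum>Y\<in>?above. moebius ?L UNIV Y) = (\<Sum>Y\<in>?above. \<Sum>I | flat A I = Y. (-1) ^ card I)"
    proof (rule sum.cong)
      fix Y assume Y: "Y \<in> ?above"
      then have "{Z \<in> ?L. Y \<subset> Z} \<subset> ?above" by auto
      then have "card {Z \<in> ?L. Y \<subset> Z} < card ?above" using fin by (intro psubset_card_mono) auto
      then show "moebius ?L UNIV Y = (\<Sum>I | flat A I = Y. (-1) ^ card I)"
        using Y by (intro less.hyps) auto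
    qed simp
    also have "\<dots> = (\<Sum>Y\<in>?above. \<Sum>I | I \<in> {I. X \<subset> flat A I} \<and> flat A I = Y. (-1) ^ card I)"
      by (intro sum.cong) auto
    also have "\<dots> = (\<Sum>I | X \<subset> flat A I. (-1) ^ card I)"
      using fin by (intro sum.group) (auto simp: intersection_lattice_eq)
    also have "\<dots> = (\<Sum>I | X \<subseteq> flat A I. (-1) ^ card I) - (\<Sum>I | flat A I = X. (-1) ^ card I)"
    proof -
      have "{I. X \<subseteq> flat A I} = {I. X \<subset> flat A I} \<union> {I. flat A I = X}" by auto
      moreover have "{I. X \<subset> flat A I} \<inter> {I. flat A I = X} = {}" by auto
      ultimately show ?thesis by (simp add: sum.union_disjoint)
    qed
    also have "(\<Sum>I | X \<subseteq> flat A I. (-1) ^ card I) = (0 :: int)"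
    proof -
      have "{I. X \<subseteq> flat A I} = Pow {i. X \<subseteq> hyperplane A i}" by (auto simp: subset_flat_iff)
      moreover have "{i. X \<subseteq> hyperplane A i} \<noteq> {}"
      proof -
        obtain J where "X = flat A J" using less.prems by (auto simp: intersection_lattice_eq)
        moreover from this False obtain i where "i \<in> J" by (auto simp: flat_UNIV)
        ultimately show ?thesis by (auto simp: flat_def)
      qed
      ultimately show ?thesis using sum_alternating_Pow[of "{i. X \<subseteq> hyperplane A i}"] by simp
    qed
    finally show ?thesis by simp
  qed
qed

lemma pcompose_power: "pcompose (p ^ n) q = pcompose p q ^ n"
  by (induction n) (simp_all add: pcompose_mult pcompose_1)

lemma fps_to_fls_sum: "fps_to_fls (sum f X) = (\<Sum>x\<in>X. fps_to_fls (f x))"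
  by (induction X rule: infinite_finite_induct) simp_all

text \<open>Essentiality makes the rank equal to \<open>m\<close>, so the exponent at a flat is its
  dimension; the flats are then replaced by the subsets that cut them out.\<close>

lemma char_poly_eq:
  fixes A :: "'n::finite \<Rightarrow> complex ^ 'm::finite"
  assumes "central_arrangement A" "essential A"
  shows "char_poly A = (\<Sum>j\<le>CARD('m). monom (char_coeff A UNIV j) j)"
proof -
  let ?L = "intersection_lattice A"
  have A: "A i \<noteq> 0" for i using assms(1) by (simp add: central_arrangement_def)
  have "vec.dim ({0} :: (complex ^ 'm) set) = 0" by simp
  then have rank: "arr_rank A = CARD('m)"
    using assms(2) by (simp add: arr_rank_def essential_def codim_def)
  have dim: "arr_rank A - codim (flat A I) = vec.dim (flat A I)" for I
    using dim_flat_le[of A I] by (simp add: rank codim_def)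
  have "char_poly A = (\<Sum>X\<in>?L. \<Sum>I | flat A I = X. monom ((-1) ^ card I) (vec.dim (flat A I)))"
    unfolding char_poly_def
  proof (rule sum.cong)
    fix X assume X: "X \<in> ?L"
    then obtain J where J: "X = flat A J" by (auto simp: intersection_lattice_eq)
    have "monom (moebius ?L UNIV X) (arr_rank A - codim X)
        = (\<Sum>I | flat A I = X. monom ((-1) ^ card I) (vec.dim X))"
      unfolding moebius_eq_alternating_sum[OF A X] by (simp add: J dim monom_sum)
    then show "monom (moebius ?L UNIV X) (arr_rank A - codim X)
        = (\<Sum>I | flat A I = X. monom ((-1) ^ card I) (vec.dim (flat A I)))" by simp
  qed simp
  also have "\<dots> = (\<Sum>I\<in>UNIV. monom ((-1) ^ card I) (vec.dim (flat A I)))"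
    using sum.image_gen[of UNIV "\<lambda>I. monom ((-1 :: int) ^ card I) (vec.dim (flat A I))" "flat A"]
    by (simp add: intersection_lattice_eq)
  also have "\<dots> = (\<Sum>I\<in>UNIV. \<Sum>j\<le>CARD('m). monom ((-1) ^ card I * (if vec.dim (flat A I) = j then 1 else 0)) j)"
  proof (rule sum.cong)
    fix I
    have "(\<Sum>j\<le>CARD('m). monom ((-1 :: int) ^ card I * (if vec.dim (flat A I) = j then 1 else 0)) j)
        = (\<Sum>j\<le>CARD('m). if j = vec.dim (flat A I) then monom ((-1) ^ card I) j else 0)"
      by (intro sum.cong) auto
    then show "monom ((-1 :: int) ^ card I) (vec.dim (flat A I))
        = (\<Sum>j\<le>CARD('m). monom ((-1) ^ card I * (if vec.dim (flat A I) = j then 1 else 0)) j)"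
      using dim_flat_le[of A I] by simp
  qed simp
  also have "\<dots> = (\<Sum>j\<le>CARD('m). monom (char_coeff A UNIV j) j)"
    unfolding char_coeff_def Pow_UNIV
    by (subst sum.swap) (intro sum.cong refl poly_eqI, simp add: coeff_sum)
  finally show ?thesis .
qed


section \<open>Back from the coefficients of powers of \<open>s\<close> to the Laurent
  series\<close>

section \<open>Coefficientwise computation of \<open>Psi\<close>\<close>

text \<open>The ring embedding of \<open>Z[[t]]\<close> in \<open>Z[s][[t]]\<close>: Hilbert series
  have integer coefficients, while \<open>Psi\<close> lives over \<open>Z[s]\<close>.\<close>

definition const_fps :: "int fps \<Rightarrow> int poly fps" where
  "const_fps f = Abs_fps (\<lambda>k. [:fps_nth f k:])"

lemma const_fps_nth [simp]: "fps_nth (const_fps f) k = [:fps_nth f k:]"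
  by (simp add: const_fps_def)

lemma const_fps_add: "const_fps (f + g) = const_fps f + const_fps g"
  by (rule fps_ext) simp

lemma const_add: "[:a + b:] = [:a:] + [:b:]"
  by simp

lemma const_sum: "[:sum f X:] = (\<Sum>x\<in>X. [:f x:])"
  by (induction X rule: infinite_finite_induct) (simp_all add: const_add)

lemma const_fps_mult: "const_fps (f * g) = const_fps f * const_fps g"
  by (rule fps_ext) (simp add: fps_mult_nth const_sum mult.commute)

lemma const_fps_0: "const_fps 0 = 0"
  by (rule fps_ext) simp

lemma const_fps_sum: "const_fps (sum f X) = (\<Sum>x\<in>X. const_fps (f x))"
  by (induction X rule: infinite_finite_induct) (simp_all add: const_fps_add const_fps_0)

lemma const_fps_1: "const_fps 1 = 1"
  by (rule fps_ext) (simp add: one_pCons)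

lemma const_fps_power: "const_fps (f ^ n) = const_fps f ^ n"
  by (induction n) (simp_all add: const_fps_1 const_fps_mult)

lemma const_fps_minus: "const_fps (- f) = - const_fps f"
  by (rule fps_ext) simp

lemma const_fps_of_nat: "const_fps (of_nat n) = of_nat n"
  by (induction n) (simp_all add: const_fps_0 const_fps_1 const_fps_add)

lemma const_fps_X: "const_fps fps_X = fps_X"
  by (rule fps_ext) (simp add: fps_X_def one_pCons)

lemma const_fps_of_poly: "const_fps (fps_of_poly G) = fps_of_poly (map_poly (\<lambda>a. [:a:]) G)"
  by (rule fps_ext) (simp add: coeff_map_poly)

lemma poly_map_poly_const_1: "poly (map_poly (\<lambda>a. [:a:]) G) 1 = [:poly G (1::int):]"
  by (induction G) (simp_all add: map_poly_pCons)

text \<open>The factor \<open>t ^ p\<close> turns the degree of a multiderivation into that of its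
  coefficients, so negative exponents disappear.\<close>

lemma hilbert_series_D_eq:
  fixes A :: "'n::finite \<Rightarrow> complex ^ 'm::{finite,linorder}"
  assumes A: "central_arrangement A"
  shows "hilbert_series_D A p * fls_X ^ p = fps_to_fls (const_fps (log_hilb A UNIV {} p))"
proof (rule fls_eqI)
  fix n :: int
  define V where "V d = {\<theta> \<in> log_derivations A p. homogeneous_multiderivation p d \<theta>}" for d
  have V_nat: "V (int k - int p) = log_piece A UNIV {} p k" for k
    unfolding V_def log_derivations_eq[OF A] log_piece_def homogeneous_multiderivation_def by simp
  have V_neg: "V d = {0}" if "d + int p < 0" for d
  proof -
    have "\<theta> = 0" if \<theta>: "\<theta> \<in> V d" for \<theta>
    proof
      fix gs
      have "\<theta> (map Var is) = 0" if "length is = p" for "is"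
        using \<theta> that \<open>d + int p < 0\<close> homogeneous_neg
        unfolding V_def homogeneous_multiderivation_def by blast
      moreover have "multider p \<theta>"
        using \<theta> unfolding V_def log_derivations_eq[OF A] log_multider_def by blast
      ultimately show "\<theta> gs = 0 gs" using multider_eq_0 by auto
    qed
    moreover have "0 \<in> V d"
      using multider_zero
      by (auto simp: V_def log_derivations_eq[OF A] log_multider_def homogeneous_multiderivation_def zero_fun_def)
    ultimately show ?thesis by blast
  qed
  \<comment> \<open>\<open>Abs_fls\<close> returns the given coefficients only if almost all of
    negative index vanish; here those below \<open>-p\<close> do.\<close>
  have "\<forall>\<^sub>\<infinity>n. of_nat (MD.dim (V (- int n))) = (0 :: int poly)"
    unfolding MOST_nat by (intro exI[of _ p] allI impI) (simp add: V_neg MD.dim_zero)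
  then have nth: "fls_nth (hilbert_series_D A p) d = of_nat (MD.dim (V d))" for d
    unfolding hilbert_series_D_def V_def[symmetric] by (rule nth_Abs_fls)
  have lhs: "fls_nth (hilbert_series_D A p * fls_X ^ p) n = of_nat (MD.dim (V (n - int p)))"
    by (simp add: fls_X_power_times_conv_shift nth)
  show "fls_nth (hilbert_series_D A p * fls_X ^ p) n = fls_nth (fps_to_fls (const_fps (log_hilb A UNIV {} p))) n"
  proof (cases "n < 0")
    case True
    then show ?thesis unfolding lhs by (simp add: V_neg MD.dim_zero)
  next
    case False
    then have "V (n - int p) = log_piece A UNIV {} p (nat n)" using V_nat[of "nat n"] by simp
    then show ?thesis unfolding lhs using False by (simp add: of_nat_poly)
  qed
qed

text \<open>The binomial expansion of \<open>(s (1 - t) - 1) ^ p\<close> in powers of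
  \<open>s (1 - t)\<close>, with the sums exchanged, collects the coefficient of each
  \<open>s ^ j\<close>.\<close>

lemma Psi_eq:
  fixes A :: "'n::finite \<Rightarrow> complex ^ 'm::{finite,linorder}"
  assumes A: "central_arrangement A"
  shows "Psi A = fps_to_fls (\<Sum>j\<le>CARD('m). fps_const ([:0, 1:] ^ j) *
    const_fps (psi CARD('m) (log_hilb A UNIV {}) j))"
proof -
  let ?m = "CARD('m)" and ?H = "\<lambda>p. log_hilb A UNIV {} p"
  let ?s = "fps_const [:0, 1:] :: int poly fps"
  let ?\<sigma> = "?s * (1 - fps_X)"
  have y: "(?\<sigma> - 1) ^ p = (\<Sum>j\<le>?m. ?\<sigma> ^ j * const_fps (of_nat (p choose j) * (-1) ^ (p - j)))"
    if p: "p \<le> ?m" for p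
  proof -
    have "(?\<sigma> - 1) ^ p = (\<Sum>j\<le>p. of_nat (p choose j) * ?\<sigma> ^ j * (-1) ^ (p - j))"
      using binomial_ring[of ?\<sigma> "- 1" p] by simp
    also have "\<dots> = (\<Sum>j\<le>?m. of_nat (p choose j) * ?\<sigma> ^ j * (-1) ^ (p - j))"
      using p by (intro sum.mono_neutral_left) auto
    finally show ?thesis
      by (simp add: const_fps_mult const_fps_of_nat const_fps_power const_fps_minus const_fps_1 mult_ac)
  qed
  have X: "fls_const [:0, 1:] * (1 - fls_X) - 1 = fps_to_fls (?\<sigma> - 1)"
    by (simp add: fls_times_fps_to_fls)
  have "Psi A = (\<Sum>p\<le>?m. fps_to_fls (const_fps (?H p) * (?\<sigma> - 1) ^ p))"
    unfolding Psi_def hilbert_series_D_eq[OF A] X atLeast0AtMost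
    by (simp only: fls_times_fps_to_fls fps_to_fls_power)
  also have "\<dots> = fps_to_fls (\<Sum>p\<le>?m. const_fps (?H p) * (?\<sigma> - 1) ^ p)"
    by (simp only: fps_to_fls_sum)
  also have "(\<Sum>p\<le>?m. const_fps (?H p) * (?\<sigma> - 1) ^ p)
      = (\<Sum>p\<le>?m. \<Sum>j\<le>?m. ?\<sigma> ^ j * const_fps (?H p * (of_nat (p choose j) * (-1) ^ (p - j))))"
  proof (rule sum.cong)
    fix p assume "p \<in> {..?m}"
    then have "p \<le> ?m" by simp
    show "const_fps (?H p) * (?\<sigma> - 1) ^ p
        = (\<Sum>j\<le>?m. ?\<sigma> ^ j * const_fps (?H p * (of_nat (p choose j) * (-1) ^ (p - j))))"
      unfolding y[OF \<open>p \<le> ?m\<close>] sum_distrib_left const_fps_mult[of "?H p"]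
      by (simp only: mult.left_commute)
  qed simp
  also have "\<dots> = (\<Sum>j\<le>?m. ?\<sigma> ^ j * const_fps (coeff (gen_poly ?m ?H) j))"
    unfolding coeff_gen_poly coeff_minus_one_power const_fps_sum sum_distrib_left by (rule sum.swap)
  also have "\<dots> = (\<Sum>j\<le>?m. fps_const ([:0, 1:] ^ j) * const_fps (psi ?m ?H j))"
  proof (rule sum.cong)
    fix j
    have "const_fps (1 - fps_X) = 1 - fps_X"
      using const_fps_add[of 1 "- fps_X"] by (simp add: const_fps_1 const_fps_minus const_fps_X)
    then show "?\<sigma> ^ j * const_fps (coeff (gen_poly ?m ?H) j) = fps_const ([:0, 1:] ^ j) * const_fps (psi ?m ?H j)"
      by (simp add: psi_def const_fps_mult const_fps_power power_mult_distrib mult.assoc)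
  qed simp
  finally show ?thesis .
qed

lemma laurent_fps_of_poly:
  shows "is_laurent_polynomial (fps_to_fls (fps_of_poly Q))"
    and "laurent_at_one (fps_to_fls (fps_of_poly Q)) = poly Q (1 :: 'a::comm_ring_1)"
proof -
  let ?F = "fps_to_fls (fps_of_poly Q)"
  have sub: "{k. fls_nth ?F k \<noteq> 0} \<subseteq> int ` {..degree Q}"
  proof
    fix k assume "k \<in> {k. fls_nth ?F k \<noteq> 0}"
    then have "k \<ge> 0" "coeff Q (nat k) \<noteq> 0" by (auto split: if_splits)
    then show "k \<in> int ` {..degree Q}"
      by (intro image_eqI[of _ _ "nat k"]) (auto intro: le_degree)
  qed
  then show "is_laurent_polynomial ?F" unfolding is_laurent_polynomial_def by (rule finite_subset) simp
  have "laurent_at_one ?F = (\<Sum>k\<in>int ` {..degree Q}. fls_nth ?F k)"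
    unfolding laurent_at_one_def using sub by (intro sum.mono_neutral_left) auto
  also have "\<dots> = (\<Sum>k\<le>degree Q. coeff Q k)" by (subst sum.reindex) auto
  finally show "laurent_at_one ?F = poly Q 1" by (simp add: poly_altdef)
qed

theorem mainTheorem4:
  fixes A :: "'n::finite \<Rightarrow> complex ^ 'm::{finite,linorder}"
  assumes "central_arrangement A"
    and "essential A"
    and "tame A \<or> log_complex_exact A"
  shows "is_laurent_polynomial (Psi A) \<and>
    laurent_at_one (Psi A) = (-1) ^ CARD('m) * pcompose (char_poly A) [:0, -1:]"
proof -
  let ?m = "CARD('m)" and ?psi = "psi CARD('m) (log_hilb A UNIV {})"
  have "\<exists>G. ?psi j = fps_of_poly G \<and> poly G 1 = (-1) ^ (?m + j) * char_coeff A UNIV j" for j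
    using fps_value_psi[OF assms(1), of UNIV j] unfolding fps_value_def .
  then obtain G where G: "\<And>j. ?psi j = fps_of_poly (G j)"
    "\<And>j. poly (G j) 1 = (-1) ^ (?m + j) * char_coeff A UNIV j" by metis
  \<comment> \<open>\<open>Q\<close> is \<open>Psi A\<close> as a polynomial in \<open>t\<close>
    over \<open>Z[s]\<close>; its coefficients of powers of \<open>s\<close> are the
    \<open>G j\<close>.\<close>
  define Q where "Q = (\<Sum>j\<le>?m. smult ([:0, 1:] ^ j) (map_poly (\<lambda>a. [:a:]) (G j)))"
  have Psi: "Psi A = fps_to_fls (fps_of_poly Q)"
    unfolding Psi_eq[OF assms(1)] G(1) Q_def fps_of_poly_sum
    by (simp add: const_fps_of_poly fps_of_poly_smult)
  have "pcompose (monom c j) [:0, -1:] = smult c ((-1) ^ j * [:0, 1:] ^ j)" for c :: int and j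
  proof -
    have "[:0, -1 :: int:] = - 1 * [:0, 1:]" by simp
    then have "[:0, -1 :: int:] ^ j = (-1) ^ j * [:0, 1:] ^ j" by (metis power_mult_distrib)
    moreover have "pcompose (monom c j) [:0, -1:] = smult c ([:0, -1:] ^ j)"
      by (simp add: monom_altdef pcompose_smult pcompose_power pcompose_pCons)
    ultimately show ?thesis by simp
  qed
  then have "pcompose (char_poly A) [:0, -1:] = (\<Sum>j\<le>?m. smult (char_coeff A UNIV j) ((-1) ^ j * [:0, 1:] ^ j))"
    unfolding char_poly_eq[OF assms(1,2)] by (simp add: pcompose_sum)
  moreover have "poly Q 1 = (\<Sum>j\<le>?m. [:0, 1:] ^ j * [:(-1) ^ (?m + j) * char_coeff A UNIV j:])"
    unfolding Q_def poly_sum by (simp add: poly_map_poly_const_1 G(2))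
  \<comment> \<open>\<open>(-1) ^ (?m + j)\<close> splits into the global sign and the sign
    \<open>(-1) ^ j\<close> that comes from substituting \<open>-s\<close>.\<close>
  moreover have "[:0, 1:] ^ j * [:(-1) ^ (?m + j) * c:] = (-1) ^ ?m * smult c ((-1) ^ j * [:0, 1:] ^ j)"
    for j and c :: int
  proof -
    have "(-1 :: int poly) ^ k = [:(-1) ^ k:]" for k
      by (induction k) (simp_all add: one_pCons)
    then show ?thesis by (simp add: power_add mult_ac)
  qed
  ultimately have "poly Q 1 = (-1) ^ ?m * pcompose (char_poly A) [:0, -1:]"
    by (simp only: sum_distrib_left)
  then show ?thesis unfolding Psi using laurent_fps_of_poly[of Q] by simp
qed


end
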